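(* Let $\mathscr{K}$ be a real closed field equipped with a nontrivial and convex valuation $\mathrm{val}:\mathscr{K}\to\Gamma\cup\{-\infty\}$. Suppose that the set $\mathscr{S}\subset\mathscr{K}^n$ is semialgebraic. Then every stratum of $\mathrm{val}(\mathscr{S})$ is semilinear.
   Context: Max-convention for valuations: $\Gamma$ is an ordered abelian group and $\mathrm{val}:\mathscr{K}\to\Gamma\cup\{-\infty\}$ is surjective with $\mathrm{val}(x)=-\infty\iff x=0$, $\mathrm{val}(xy)=\mathrm{val}(x)+\mathrm{val}(y)$, $\mathrm{val}(x+y)\le\max(\mathrm{val}(x),\mathrm{val}(y))$; here $-\infty$ is the least element. It is nontrivial if $\Gamma\neq\{0\}$. With $\mathscr{O}=\{x:\mathrm{val}(x)\le0\}$, it is convex (with respect to the unique order of the real closed field $\mathscr{K}$) if $x_1\in\mathscr{O}$, $x_2\in\mathscr{K}$ and $0\le x_2\le x_1$ imply $x_2\in\mathscr{O}$. $\mathrm{val}$ is applied coordinatewise to points of $\mathscr{K}^n$. (Since $\mathscr{K}$ is real closed, $\Gamma$ is divisible.) A set $\mathscr{S}\subset\mathscr{K}^n$ is semialgebraic if it is a finite union of sets of the form $\{x\in\mathscr{K}^n: P_1(x)>0,\dots,P_p(x)>0,\,P_{p+1}(x)=\dots=P_q(x)=0\}$ with $P_i\in\mathscr{K}[X_1,\dots,X_n]$. A subset of $\Gamma^N$ ($\Gamma$ a divisible ordered abelian group) is semilinear if it is a finite union of sets of the form $\{g\in\Gamma^N: f_i(g)>h^{(i)}\ (1\le i\le p),\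 f_i(g)=h^{(i)}\ (p+1\le i\le q)\}$, where the $f_i\in\mathbb{Z}[X_1,\dots,X_N]$ are homogeneous linear polynomials and $h^{(i)}\in\Gamma$. The support of $x\in(\Gamma\cup\{-\infty\})^n$ is $\{k:x_k\ne-\infty\}$. For nonempty $K\subset\{1,\dots,n\}$, the stratum of $S\subset(\Gamma\cup\{-\infty\})^n$ associated with $K$ is the set of $(x_k)_{k\in K}\in\Gamma^K$ for $x\in S$ with support exactly $K$. *)

theory Defs
  imports
    "HOL-Library.FuncSet"
    "HOL-Library.Option_ord"
    "HOL-Library.Poly_Mapping"
begin

text \<open>
  Points of \<open>X\<^sup>I\<close> for a finite index set \<open>I\<close> of natural numbers are extensional functions, i.e.
  elements of \<open>I \<rightarrow>\<^sub>E UNIV\<close>; in particular \<open>X\<^sup>n\<close> is \<open>{1..n} \<rightarrow>\<^sub>E UNIV\<close>.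
\<close>

text \<open>
  The square root axiom makes the given order the only field order. Polynomials are written
  out as coefficient sequences, as in the library class \<open>alg_closed_field\<close>.
\<close>

class real_closed_field = linordered_field +
  assumes nonneg_is_square: "0 \<le> x \<Longrightarrow> \<exists>y. y ^ 2 = x"
    and odd_degree_root: "odd n \<Longrightarrow> f n \<noteq> 0 \<Longrightarrow> \<exists>x. (\<Sum>k\<le>n. f k * x ^ k) = 0"

text \<open>
  Valuations use the max-convention: the monoid \<open>\<Gamma> \<union> {-\<infinity>}\<close> is \<open>'g option\<close> with \<open>None\<close> for \<open>-\<infinity>\<close>; the order of
  \<open>Option_ord\<close> makes \<open>None\<close> the least element.
\<close>

fun minf_add :: "'g::plus option \<Rightarrow> 'g option \<Rightarrow> 'g option" (infixl "\<oplus>\<^sub>\<infinity>" 65) where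
  "Some a \<oplus>\<^sub>\<infinity> Some b = Some (a + b)"
| "None \<oplus>\<^sub>\<infinity> b = None"
| "a \<oplus>\<^sub>\<infinity> None = None"

locale valuation =
  fixes val :: "'k::field \<Rightarrow> 'g::linordered_ab_group_add option"
  assumes surj_val: "surj val"
    and val_eq_None_iff: "val x = None \<longleftrightarrow> x = 0"
    and val_mult: "val (x * y) = val x \<oplus>\<^sub>\<infinity> val y"
    and val_add: "val (x + y) \<le> max (val x) (val y)"

text \<open>Since a valuation is surjective, \<open>\<Gamma>\<close> is the whole type \<open>'g\<close>.\<close>

definition nontrivial_valuation :: "('k \<Rightarrow> 'g::zero option) \<Rightarrow> bool" where
  "nontrivial_valuation val \<longleftrightarrow> (UNIV :: 'g set) \<noteq> {0}"

definition valuation_ring :: "('k \<Rightarrow> 'g::{zero,preorder} option) \<Rightarrow> 'k set" where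
  "valuation_ring val = {x. val x \<le> Some 0}"

definition convex_valuation :: "('k::linordered_field \<Rightarrow> 'g::{zero,preorder} option) \<Rightarrow> bool" where
  "convex_valuation val \<longleftrightarrow>
    (\<forall>x1 \<in> valuation_ring val. \<forall>x2. 0 \<le> x2 \<and> x2 \<le> x1 \<longrightarrow> x2 \<in> valuation_ring val)"

definition val_image :: "nat \<Rightarrow> ('k \<Rightarrow> 'g option) \<Rightarrow> (nat \<Rightarrow> 'k) set \<Rightarrow> (nat \<Rightarrow> 'g option) set" where
  "val_image n val S = (\<lambda>x. \<lambda>k\<in>{1..n}. val (x k)) ` S"

text \<open>
  A multivariate polynomial is a finitely supported map from monomials to coefficients, a monomial
  being a finitely supported map from variable indices to exponents.
\<close>

type_synonym 'a mpolynomial = "(nat \<Rightarrow>\<^sub>0 nat) \<Rightarrow>\<^sub>0 'a"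

definition mpolynomials :: "nat \<Rightarrow> 'a::zero mpolynomial set" where
  "mpolynomials n = {P. \<forall>m \<in> Poly_Mapping.keys P. Poly_Mapping.keys m \<subseteq> {1..n}}"

definition mpoly_eval :: "'a::comm_semiring_1 mpolynomial \<Rightarrow> (nat \<Rightarrow> 'a) \<Rightarrow> 'a" where
  "mpoly_eval P x =
    (\<Sum>m \<in> Poly_Mapping.keys P. Poly_Mapping.lookup P m *
      (\<Prod>k \<in> Poly_Mapping.keys m. x k ^ Poly_Mapping.lookup m k))"

definition basic_semialgebraic :: "nat \<Rightarrow> (nat \<Rightarrow> 'k::linordered_field) set \<Rightarrow> bool" where
  "basic_semialgebraic n S \<longleftrightarrow>
    (\<exists>p q (P :: nat \<Rightarrow> 'k mpolynomial). p \<le> q \<and> (\<forall>i\<in>{1..q}. P i \<in> mpolynomials n) \<and>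
      S = {x \<in> {1..n} \<rightarrow>\<^sub>E UNIV. (\<forall>i\<in>{1..p}. mpoly_eval (P i) x > 0) \<and>
                              (\<forall>i\<in>{p+1..q}. mpoly_eval (P i) x = 0)})"

definition semialgebraic :: "nat \<Rightarrow> (nat \<Rightarrow> 'k::linordered_field) set \<Rightarrow> bool" where
  "semialgebraic n S \<longleftrightarrow> (\<exists>F. finite F \<and> (\<forall>A\<in>F. basic_semialgebraic n A) \<and> S = \<Union>F)"

definition zmult :: "int \<Rightarrow> 'g::ab_group_add \<Rightarrow> 'g" where
  "zmult z g = (if 0 \<le> z then (\<Sum>_<nat z. g) else - (\<Sum>_<nat (- z). g))"

text \<open>
  A homogeneous linear polynomial over the integers in the variables \<open>X\<^sub>k\<close>, \<open>k \<in> I\<close>, is given by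
  its coefficient family \<open>a\<close>.
\<close>

definition linear_form :: "nat set \<Rightarrow> (nat \<Rightarrow> int) \<Rightarrow> (nat \<Rightarrow> 'g::ab_group_add) \<Rightarrow> 'g" where
  "linear_form I a g = (\<Sum>k\<in>I. zmult (a k) (g k))"

definition basic_semilinear :: "nat set \<Rightarrow> (nat \<Rightarrow> 'g::linordered_ab_group_add) set \<Rightarrow> bool" where
  "basic_semilinear I A \<longleftrightarrow>
    (\<exists>p q (f :: nat \<Rightarrow> nat \<Rightarrow> int) (h :: nat \<Rightarrow> 'g). p \<le> q \<and>
      A = {g \<in> I \<rightarrow>\<^sub>E UNIV. (\<forall>i\<in>{1..p}. linear_form I (f i) g > h i) \<and>
                           (\<forall>i\<in>{p+1..q}. linear_form I (f i) g = h i)})"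

definition semilinear :: "nat set \<Rightarrow> (nat \<Rightarrow> 'g::linordered_ab_group_add) set \<Rightarrow> bool" where
  "semilinear I A \<longleftrightarrow> (\<exists>F. finite F \<and> (\<forall>B\<in>F. basic_semilinear I B) \<and> A = \<Union>F)"

definition support :: "nat \<Rightarrow> (nat \<Rightarrow> 'g option) \<Rightarrow> nat set" where
  "support n x = {k \<in> {1..n}. x k \<noteq> None}"

definition stratum :: "nat \<Rightarrow> nat set \<Rightarrow> (nat \<Rightarrow> 'g option) set \<Rightarrow> (nat \<Rightarrow> 'g) set" where
  "stratum n K S = (\<lambda>x. \<lambda>k\<in>K. the (x k)) ` {x \<in> S. support n x = K}"

end

theory Submission
  imports Defs "HOL-Algebra.Algebraic_Closure_Type"
begin

text \<open>
  The proof eliminates the field variables one at a time from two-sorted formulas whose atoms are signs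
  of polynomials and linear inequalities between valuations of polynomials and value group variables.
  To eliminate \<open>y\<close>, close the polynomials in \<open>y\<close> under derivatives. If \<open>a\<close> is a root of the family nearest
  to \<open>y\<close> then no cancellation occurs in the Taylor expansions at \<open>a\<close>:
  \<open>val (P y) = max\<^sub>k (val (P\<^sup>(\<^sup>k\<^sup>) a) + k val (y - a))\<close>, and the sign of \<open>P y\<close> is read off the first
  nonvanishing derivative at \<open>a\<close>. So \<open>y\<close> may be replaced by a root \<open>a\<close> and a value group variable
  \<open>t = val (y - a)\<close>, which Fourier-Motzkin style sampling eliminates. A variable constrained by an equation
  \<open>Q a = 0\<close> is eliminated by induction on the degree of \<open>Q\<close>: after reduction modulo \<open>Q\<close> only roots of
  polynomials of smaller degree are needed as centres. Once all field variables are gone, the atoms are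
  inequalities between linear forms on the value group.
\<close>

section \<open>Intermediate values in real closed fields\<close>

text \<open>Why no cancellation occurs: the interval with midpoint \<open>y\<close> and endpoint
  \<open>a\<close> contains no root of a nonzero derivative of \<open>P\<close>. A Taylor term at
  \<open>y\<close> larger than \<open>P y\<close> would force such a root, so all terms at
  \<open>y\<close> are bounded by \<open>P y\<close>; expanding about \<open>a\<close>, at distance
  exactly the radius of that interval, transfers the bounds to the Taylor terms at \<open>a\<close>.
  Convexity enters only as: |u| \<le> |v| implies val u \<le> val v. It also gives all positive
  integers valuation 0, so the factorials of the Taylor formula are harmless. The obstacle is a
  variable bound by an equation Q y = 0: centres taken among the roots of Q would be circular. The
  centres come from Q' and from remainders instead; Q is monotone between adjacent centres, so a gap
  contains at most one root, and its distance to the centre is found without knowing the root. The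
  class axioms provide only square roots and roots in odd degree. The intermediate value theorem
  therefore has to be derived first, through factorisation over the field with a square root of -1
  adjoined.\<close>

abbreviation lift_poly :: "'a::field poly \<Rightarrow> 'a alg_closure poly" where
  "lift_poly \<equiv> map_poly to_ac"

lemma lift_poly_add: "lift_poly (p + q) = lift_poly p + lift_poly q"
  by (rule poly_eqI) (simp add: coeff_map_poly)

lemma lift_poly_mult: "lift_poly (p * q) = lift_poly p * lift_poly q"
  by (rule poly_eqI) (simp add: coeff_map_poly coeff_mult to_ac_sum)

lemma lift_poly_smult: "lift_poly (smult c p) = smult (to_ac c) (lift_poly p)"
  by (rule poly_eqI) (simp add: coeff_map_poly)

lemma poly_lift_poly: "poly (lift_poly p) (to_ac x) = to_ac (poly p x)"
  by (induction p) (simp_all add: map_poly_pCons)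

lemma degree_lift_poly: "Polynomial.degree (lift_poly p) = Polynomial.degree p"
  by (rule degree_map_poly) simp

lemma lift_poly_pcompose: "lift_poly (pcompose p q) = pcompose (lift_poly p) (lift_poly q)"
  by (induction p) (simp_all add: map_poly_pCons pcompose_pCons lift_poly_add lift_poly_mult)

lemma lift_poly_eq_0_iff: "lift_poly p = 0 \<longleftrightarrow> p = 0"
  by (rule map_poly_eq_0_iff) simp_all

lemma in_range_to_ac [intro]:
  assumes "x \<in> range to_ac" "y \<in> range to_ac"
  shows "x + y \<in> range to_ac" "x - y \<in> range to_ac" "x * y \<in> range to_ac"
    "- x \<in> range to_ac" "x ^ n \<in> range to_ac" "x / y \<in> range to_ac"
  using assms by (auto simp flip: to_ac_add to_ac_diff to_ac_mult to_ac_minus to_ac_power to_ac_divide)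

text \<open>The Euclidean algorithm for the resultant of \<open>p\<close> and \<open>h\<close>.\<close>

lemma prod_roots_in_range:
  fixes h p :: "'a::field poly"
  assumes "lift_poly p = (\<Prod>x\<in>#A. [:-x, 1:])"
  shows "(\<Prod>x\<in>#A. poly (lift_poly h) x) \<in> range to_ac"
  using assms
proof (induction "Polynomial.degree h" arbitrary: h p A rule: less_induct)
  case less
  show ?case
  proof (cases "Polynomial.degree h = 0")
    case True
    then obtain c where "h = [:c:]" by (rule degree_eq_zeroE)
    then have "(\<Prod>x\<in>#A. poly (lift_poly h) x) = to_ac (c ^ size A)"
      by (simp add: map_poly_pCons)
    then show ?thesis by blast
  next
    case False
    define l where "l = lead_coeff h"
    have l0: "l \<noteq> 0" using False by (auto simp: l_def)
    have "lift_poly h \<noteq> 0" using False by (auto simp: lift_poly_eq_0_iff)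
    from alg_closed_imp_factorization[OF this] obtain B where
      B: "lift_poly h = smult (to_ac l) (\<Prod>y\<in>#B. [:-y, 1:])"
      by (auto simp: l_def degree_lift_poly coeff_map_poly)
    have B': "lift_poly (smult (inverse l) h) = (\<Prod>y\<in>#B. [:-y, 1:])"
      using l0 by (simp add: lift_poly_smult B)
    have "Polynomial.degree (p mod h) < Polynomial.degree h"
      using l0 False degree_mod_less[of h p] by (force simp: l_def)
    from less.hyps[OF this B'] have IH: "(\<Prod>y\<in>#B. poly (lift_poly (p mod h)) y) \<in> range to_ac" .
    have root: "poly (lift_poly h) y = 0" if "y \<in># B" for y
      using that by (simp add: B poly_prod_mset prod_mset_zero_iff)
    have eq: "poly (lift_poly (p mod h)) y = poly (lift_poly p) y" if "y \<in># B" for y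
    proof -
      have "lift_poly p = lift_poly (p div h) * lift_poly h + lift_poly (p mod h)"
        by (simp flip: lift_poly_add lift_poly_mult)
      then show ?thesis using root[OF that] by simp
    qed
    \<comment> \<open>Exchange the two products: up to sign and a power of \<open>l\<close>, the
      values of \<open>h\<close> at the roots of \<open>p\<close> and the values of \<open>p\<close>
      at the roots of \<open>h\<close> have the same product, and at the roots of \<open>h\<close>
      one may replace \<open>p\<close> by \<open>p mod h\<close>.\<close>
    have "(\<Prod>x\<in>#A. poly (lift_poly h) x) = (\<Prod>x\<in>#A. to_ac l * (\<Prod>y\<in>#B. x - y))"
      by (simp add: B poly_prod_mset)
    also have "\<dots> = to_ac l ^ size A * (\<Prod>x\<in>#A. \<Prod>y\<in>#B. x - y)"
      by (simp add: prod_mset.distrib)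
    also have "(\<Prod>x\<in>#A. \<Prod>y\<in>#B. x - y) = (\<Prod>y\<in>#B. \<Prod>x\<in>#A. x - y)"
      by (rule prod_mset.swap)
    also have "\<dots> = (\<Prod>y\<in>#B. (-1) ^ size A * poly (lift_poly p) y)"
    proof -
      have "(\<Prod>x\<in>#A. x - y) = (-1) ^ size A * poly (lift_poly p) y" for y
        unfolding less.prems
        by (induction A) (simp_all add: poly_prod_mset algebra_simps)
      then show ?thesis by simp
    qed
    also have "\<dots> = (\<Prod>y\<in>#B. (-1) ^ size A * poly (lift_poly (p mod h)) y)"
      by (intro arg_cong[where f = prod_mset] image_mset_cong) (simp add: eq)
    also have "\<dots> = to_ac (((-1) ^ size A) ^ size B) * (\<Prod>y\<in>#B. poly (lift_poly (p mod h)) y)"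
      by (simp add: prod_mset.distrib)
    finally show ?thesis using IH
      by (metis in_range_to_ac(3) rangeI to_ac_power)
  qed
qed

text \<open>Divide repeatedly by X - z0. The quotient is not controlled at z0, hence the exceptional
  set \<open>S\<close>, which grows by one point per division. With
  \<open>prod_roots_in_range\<close> this takes the place of the theorem on symmetric polynomials:
  coefficients are recognised through values.\<close>

lemma lift_poly_if_values_in_range:
  fixes f :: "'a::field_char_0 alg_closure poly"
  assumes "finite S" "\<And>z. z \<notin> S \<Longrightarrow> poly f (to_ac z) \<in> range to_ac"
  shows "f \<in> range lift_poly"
  using assms
proof (induction "Polynomial.degree f" arbitrary: f S rule: less_induct)
  case less
  obtain z0 where z0: "z0 \<notin> S" using ex_new_if_finite[OF infinite_UNIV_char_0 less.prems(1)] by blast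
  then obtain c where c: "poly f (to_ac z0) = to_ac c" using less.prems(2) by blast
  show ?case
  proof (cases "Polynomial.degree f = 0")
    case True
    then obtain b where "f = [:b:]" by (rule degree_eq_zeroE)
    then have "f = lift_poly [:c:]" using c by (simp add: map_poly_pCons)
    then show ?thesis by blast
  next
    case False
    have "[:- to_ac z0, 1:] dvd f - [:to_ac c:]"
      using c by (simp add: poly_eq_0_iff_dvd flip: poly_eq_0_iff_dvd)
    then obtain g where g: "f - [:to_ac c:] = [:- to_ac z0, 1:] * g" by (elim dvdE)
    then have f: "f = [:to_ac c:] + [:- to_ac z0, 1:] * g" by (simp add: algebra_simps)
    have "g \<noteq> 0" using False f by auto
    then have deg: "Polynomial.degree ([:- to_ac z0, 1:] * g) = Suc (Polynomial.degree g)"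
      by (subst degree_mult_eq) auto
    have "Polynomial.degree f = Suc (Polynomial.degree g)"
      unfolding f by (subst degree_add_eq_right) (auto simp: deg simp del: mult_pCons_left)
    then have "Polynomial.degree g < Polynomial.degree f" by simp
    moreover have "poly g (to_ac z) \<in> range to_ac" if "z \<notin> insert z0 S" for z
    proof -
      have "poly f (to_ac z) = to_ac c + (to_ac z - to_ac z0) * poly g (to_ac z)"
        unfolding f by (simp add: algebra_simps)
      then have "poly g (to_ac z) = (poly f (to_ac z) - to_ac c) / to_ac (z - z0)"
        using that by simp
      also have "\<dots> \<in> range to_ac" using less.prems(2)[of z] that by blast
      finally show ?thesis .
    qed
    ultimately have "g \<in> range lift_poly" using less.hyps[of g "insert z0 S"] less.prems(1) by blast
    then obtain g' where "g = lift_poly g'" by blast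
    then have "f = lift_poly ([:c:] + [:-z0, 1:] * g')"
      unfolding f lift_poly_add lift_poly_mult by (simp only: map_poly_pCons to_ac_0 to_ac_1 to_ac_minus map_poly_0 simp_thms)
    then show ?thesis by blast
  qed
qed

text \<open>The square root of a power series with constant term 1: each coefficient of the root is
  a coefficient of the square minus products of earlier coefficients, divided by 2. Reversing the
  coefficients turns the leading coefficient 1 into a constant term.\<close>

lemma lift_poly_if_square:
  fixes q :: "'a::field_char_0 alg_closure poly"
  assumes "lead_coeff q = 1" "q\<^sup>2 \<in> range lift_poly"
  shows "q \<in> range lift_poly"
proof -
  define r where "r = reflect_poly q"
  have r0: "coeff r 0 = 1" using assms by (simp add: r_def)
  obtain s where s: "q\<^sup>2 = lift_poly s" using assms by blast
  have rr: "coeff (r * r) k \<in> range to_ac" for k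
  proof -
    have "r * r = reflect_poly (lift_poly s)"
      unfolding r_def s[symmetric] power2_eq_square by (rule reflect_poly_mult[symmetric])
    also have "\<dots> = lift_poly (reflect_poly s)"
      by (intro poly_eqI) (simp add: coeff_reflect_poly degree_lift_poly coeff_map_poly)
    finally show ?thesis by (simp add: coeff_map_poly)
  qed
  have r: "coeff r k \<in> range to_ac" for k
  proof (induction k rule: less_induct)
    case (less k)
    show ?case
    proof (cases "k = 0")
      case True
      then show ?thesis using r0 by (auto intro: range_eqI[of _ _ 1])
    next
      case False
      define S where "S = (\<Sum>i\<in>{1..<k}. coeff r i * coeff r (k - i))"
      have "coeff (r * r) k = (\<Sum>i\<le>k. coeff r i * coeff r (k - i))" by (rule coeff_mult)
      also have "{..k} = insert 0 (insert k {1..<k})" using False by auto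
      also have "(\<Sum>i\<in>\<dots>. coeff r i * coeff r (k - i)) =
          coeff r 0 * coeff r (k - 0) + (coeff r k * coeff r (k - k) + S)"
        unfolding S_def using False by (subst sum.insert; simp)
      also have "\<dots> = to_ac 2 * coeff r k + S" using r0 by simp
      finally have eq: "coeff r k = (coeff (r * r) k - S) / to_ac 2" by simp
      have "S = to_ac (\<Sum>i\<in>{1..<k}. of_ac (coeff r i) * of_ac (coeff r (k - i)))"
        using less False unfolding S_def to_ac_sum by (intro sum.cong) (simp_all add: to_ac_of_ac)
      then show ?thesis unfolding eq using rr by (metis in_range_to_ac(2,6) rangeI)
    qed
  qed
  have "coeff q k \<in> range to_ac" for k
  proof (cases "k \<le> Polynomial.degree q")
    case True
    then have "coeff q k = coeff r (Polynomial.degree q - k)"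
      by (simp add: r_def coeff_reflect_poly)
    then show ?thesis using r by simp
  next
    case False
    then show ?thesis by (auto simp: coeff_eq_0 intro: range_eqI[of _ _ 0])
  qed
  then have "q = lift_poly (map_poly of_ac q)"
    by (intro poly_eqI) (simp add: coeff_map_poly to_ac_of_ac)
  then show ?thesis by blast
qed

lemma prod_roots_in_range':
  fixes h p :: "'a::field poly"
  assumes "lift_poly p = (\<Prod>i<d. [:- \<alpha> i, 1:])"
  shows "(\<Prod>i<d. poly (lift_poly h) (\<alpha> i)) \<in> range to_ac"
  using prod_roots_in_range[of p "image_mset \<alpha> (mset_set {..<d})" h] assms
  by (simp add: prod_unfold_prod_mset image_mset.compositionality o_def)

text \<open>The value at z is the product over the roots of \<open>p\<close> of the values of z - h,
  which \<open>prod_roots_in_range'\<close> puts into the base field.\<close>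

lemma map_roots_lift_poly:
  fixes h p :: "'a::field_char_0 poly"
  assumes "lift_poly p = (\<Prod>i<d. [:- \<alpha> i, 1:])"
  shows "(\<Prod>i<d. [:- poly (lift_poly h) (\<alpha> i), 1:]) \<in> range lift_poly"
proof (rule lift_poly_if_values_in_range)
  fix z :: 'a
  have "poly (\<Prod>i<d. [:- poly (lift_poly h) (\<alpha> i), 1:]) (to_ac z) =
      (\<Prod>i<d. poly (lift_poly ([:z:] + smult (-1) h)) (\<alpha> i))"
    unfolding lift_poly_add lift_poly_smult by (simp add: poly_prod map_poly_pCons)
  then show "poly (\<Prod>i<d. [:- poly (lift_poly h) (\<alpha> i), 1:]) (to_ac z) \<in> range to_ac"
    using prod_roots_in_range'[OF assms] by simp
qed (rule finite.emptyI)

definition pairs :: "nat \<Rightarrow> (nat \<times> nat) set" where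
  "pairs d = {(i, j). i < j \<and> j < d}"

lemma square_eq_pairs:
  "{..<d} \<times> {..<d} = pairs d \<union> (\<lambda>i. (i, i)) ` {..<d} \<union> prod.swap ` pairs d"
  unfolding pairs_def by (auto simp: image_iff)

lemma finite_pairs: "finite (pairs d)"
  using finite_subset[of "pairs d" "{..<d} \<times> {..<d}"] square_eq_pairs by blast

lemma prod_square_eq:
  fixes f :: "nat \<Rightarrow> nat \<Rightarrow> 'a::comm_monoid_mult"
  assumes "\<And>i j. f i j = f j i"
  shows "(\<Prod>i<d. \<Prod>j<d. f i j) = (\<Prod>i<d. f i i) * (\<Prod>(i, j)\<in>pairs d. f i j)\<^sup>2"
proof -
  have "(\<Prod>i<d. \<Prod>j<d. f i j) = (\<Prod>(i, j)\<in>{..<d} \<times> {..<d}. f i j)"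
    by (rule prod.cartesian_product)
  also have "\<dots> = (\<Prod>(i, j)\<in>pairs d \<union> (\<lambda>i. (i, i)) ` {..<d}. f i j) *
      (\<Prod>(i, j)\<in>prod.swap ` pairs d. f i j)"
    unfolding square_eq_pairs
    by (rule prod.union_disjoint) (auto simp: finite_pairs, auto simp: pairs_def)
  also have "(\<Prod>(i, j)\<in>pairs d \<union> (\<lambda>i. (i, i)) ` {..<d}. f i j) =
      (\<Prod>(i, j)\<in>pairs d. f i j) * (\<Prod>(i, j)\<in>(\<lambda>i. (i, i)) ` {..<d}. f i j)"
    by (rule prod.union_disjoint) (auto simp: finite_pairs, auto simp: pairs_def)
  also have "(\<Prod>(i, j)\<in>(\<lambda>i. (i, i)) ` {..<d}. f i j) = (\<Prod>i<d. f i i)"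
    by (subst prod.reindex) (auto simp: inj_on_def)
  also have "(\<Prod>(i, j)\<in>prod.swap ` pairs d. f i j) = (\<Prod>(i, j)\<in>pairs d. f i j)"
    by (subst prod.reindex) (auto simp: inj_on_def assms intro!: prod.cong)
  finally show ?thesis by (simp add: power2_eq_square mult_ac)
qed

lemma card_pairs: "2 * card (pairs d) + d = d * d"
proof -
  have "card ({..<d} \<times> {..<d}) = card (pairs d \<union> (\<lambda>i. (i, i)) ` {..<d}) + card (prod.swap ` pairs d)"
    unfolding square_eq_pairs
    by (rule card_Un_disjoint) (auto simp: finite_pairs, auto simp: pairs_def)
  moreover have "card (pairs d \<union> (\<lambda>i. (i, i)) ` {..<d}) = card (pairs d) + card ((\<lambda>i. (i, i)) ` {..<d})"
    by (rule card_Un_disjoint) (auto simp: finite_pairs, auto simp: pairs_def)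
  moreover have "card (prod.swap ` pairs d) = card (pairs d)" by (rule card_image) (auto simp: inj_on_def)
  ultimately show ?thesis by (simp add: card_image inj_on_def)
qed

text \<open>The product over all ordered pairs (i, j) is D times the square of the product over i <
  j, where D collects the diagonal. Both the full product and D take values in the base field, so
  off the roots of D the square does too; then the monic square root has its coefficients
  there.\<close>

lemma pair_sums_lift_poly:
  fixes p :: "'a::field_char_0 poly"
  assumes "lift_poly p = (\<Prod>i<d. [:- s i, 1:])"
  shows "(\<Prod>(i, j)\<in>pairs d. [:- (s i + s j), 1:]) \<in> range lift_poly" (is "?q \<in> _")
proof (rule lift_poly_if_square)
  have "(\<Prod>i<d. [:- poly (lift_poly [:0, 2:]) (s i), 1:]) \<in> range lift_poly"
    by (rule map_roots_lift_poly[OF assms])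
  then obtain D where D: "(\<Prod>i<d. [:- (s i + s i), 1:]) = lift_poly D"
    by (auto simp: map_poly_pCons mult_2_right)
  have "lead_coeff (lift_poly D) = 1" unfolding D[symmetric] by (simp add: lead_coeff_prod)
  then have D0: "D \<noteq> 0" by auto
  show "lead_coeff ?q = 1" by (simp add: lead_coeff_prod case_prod_unfold)
  show "?q\<^sup>2 \<in> range lift_poly"
  proof (rule lift_poly_if_values_in_range[of "{z. poly D z = 0}"])
    show "finite {z. poly D z = 0}" using poly_roots_finite[OF D0] .
    fix z assume z: "z \<notin> {z. poly D z = 0}"
    have "(\<Prod>i<d. \<Prod>j<d. [:- (s i + s j), 1:]) = lift_poly D * ?q\<^sup>2"
      unfolding D[symmetric] by (rule prod_square_eq) (simp add: add.commute)
    then have "poly (\<Prod>i<d. \<Prod>j<d. [:- (s i + s j), 1:]) (to_ac z) = to_ac (poly D z) * poly (?q\<^sup>2) (to_ac z)"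
      by (simp add: poly_lift_poly)
    moreover have "poly (\<Prod>i<d. \<Prod>j<d. [:- (s i + s j), 1:]) (to_ac z) =
        (\<Prod>i<d. poly (lift_poly (pcompose p [:z, -1:])) (s i))"
      by (simp add: poly_prod lift_poly_pcompose poly_pcompose map_poly_pCons assms algebra_simps)
    ultimately have "poly (?q\<^sup>2) (to_ac z) =
        (\<Prod>i<d. poly (lift_poly (pcompose p [:z, -1:])) (s i)) / to_ac (poly D z)"
      using z by (simp add: field_simps)
    then show "poly (?q\<^sup>2) (to_ac z) \<in> range to_ac"
      using prod_roots_in_range'[OF assms] in_range_to_ac(6) by (metis rangeI)
  qed
qed

lemma monic_lift_poly_splits:
  fixes p :: "'a::field poly"
  assumes "lead_coeff p = 1"
  obtains \<alpha> where "lift_poly p = (\<Prod>i<Polynomial.degree p. [:- \<alpha> i, 1:])"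
proof -
  have "lift_poly p \<noteq> 0" using assms by (auto simp: lift_poly_eq_0_iff)
  from alg_closed_imp_factorization[OF this] obtain A where
    A: "size A = Polynomial.degree p" "lift_poly p = (\<Prod>x\<in>#A. [:-x, 1:])"
    using assms by (auto simp: degree_lift_poly coeff_map_poly)
  obtain xs where xs: "mset xs = A" using ex_mset by blast
  have "(\<Prod>x\<in>#A. [:-x, 1:]) = prod_list (map (\<lambda>x. [:-x, 1:]) xs)"
    unfolding xs[symmetric] by (simp flip: prod_mset_prod_list)
  also have "\<dots> = (\<Prod>i<length xs. [:- (xs ! i), 1:])"
    by (simp add: prod.list_conv_set_nth atLeast0LessThan)
  finally show ?thesis using that[of "\<lambda>i. xs ! i"] A xs by auto
qed

section \<open>Adjoining a square root of -1\<close>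

definition gaussian :: "'a::field alg_closure \<Rightarrow> 'a alg_closure set" where
  "gaussian I = {to_ac a + to_ac b * I |a b. True}"

lemma gaussian_add: "x \<in> gaussian I \<Longrightarrow> y \<in> gaussian I \<Longrightarrow> x + y \<in> gaussian I"
proof -
  assume "x \<in> gaussian I" "y \<in> gaussian I"
  then obtain a b c d where "x = to_ac a + to_ac b * I" "y = to_ac c + to_ac d * I"
    by (auto simp: gaussian_def)
  then have "x + y = to_ac (a + c) + to_ac (b + d) * I" by (simp add: algebra_simps)
  then show ?thesis unfolding gaussian_def by blast
qed

lemma gaussian_mult:
  assumes "I\<^sup>2 = -1" "x \<in> gaussian I" "y \<in> gaussian I"
  shows "x * y \<in> gaussian I"
proof -
  obtain a b c d where *: "x = to_ac a + to_ac b * I" "y = to_ac c + to_ac d * I"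
    using assms by (auto simp: gaussian_def)
  have "x * y = to_ac a * to_ac c + to_ac b * to_ac d * I\<^sup>2 + (to_ac a * to_ac d + to_ac b * to_ac c) * I"
    unfolding * by (simp add: algebra_simps power2_eq_square)
  also have "\<dots> = to_ac (a * c - b * d) + to_ac (a * d + b * c) * I"
    using assms(1) by simp
  finally show ?thesis unfolding gaussian_def by blast
qed

lemma gaussian_to_ac: "to_ac a \<in> gaussian I"
  unfolding gaussian_def by (rule CollectI, rule exI[of _ a], rule exI[of _ 0]) simp

lemma gaussian_diff: "I\<^sup>2 = -1 \<Longrightarrow> x \<in> gaussian I \<Longrightarrow> y \<in> gaussian I \<Longrightarrow> x - y \<in> gaussian I"
  using gaussian_add[of x I "to_ac (-1) * y"] gaussian_mult[of I "to_ac (-1)" y] gaussian_to_ac[of "-1" I]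
  by simp

text \<open>The usual formula for complex square roots: with r^2 = a^2 + b^2, the two parts of the
  root are square roots of (r + a) / 2 and (r - a) / 2, with the sign of the second chosen so that 2
  c d = b.\<close>

lemma gaussian_sqrt:
  fixes u :: "'a::real_closed_field alg_closure"
  assumes I: "I\<^sup>2 = -1" and u: "u\<^sup>2 \<in> gaussian I"
  shows "u \<in> gaussian I"
proof -
  obtain a b where ab: "u\<^sup>2 = to_ac a + to_ac b * I" using u by (auto simp: gaussian_def)
  have "0 \<le> a\<^sup>2 + b\<^sup>2" by simp
  then obtain r0 where "r0\<^sup>2 = a\<^sup>2 + b\<^sup>2" using nonneg_is_square by blast
  then obtain r where r: "r\<^sup>2 = a\<^sup>2 + b\<^sup>2" "0 \<le> r"
    by (metis abs_ge_zero power2_abs)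
  have "a\<^sup>2 \<le> r\<^sup>2" unfolding r(1) by simp
  then have "\<bar>a\<bar> \<le> r" using r(2) by (simp flip: abs_le_square_iff)
  then have "0 \<le> (r + a) / 2" "0 \<le> (r - a) / 2" by (auto simp: abs_le_iff)
  then obtain c d0 where c: "c\<^sup>2 = (r + a) / 2" and d0: "d0\<^sup>2 = (r - a) / 2"
    using nonneg_is_square by metis
  have "(2 * c * d0)\<^sup>2 = (r + a) * (r - a)"
    unfolding power_mult_distrib c d0 by (simp add: power2_eq_square)
  also have "\<dots> = r\<^sup>2 - a\<^sup>2" by (simp add: algebra_simps power2_eq_square)
  also have "\<dots> = b\<^sup>2" using r by simp
  finally have "2 * c * d0 = b \<or> 2 * c * d0 = - b" by (simp add: power2_eq_iff)
  then obtain d where d: "d\<^sup>2 = (r - a) / 2" "2 * c * d = b"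
    using d0 by (metis mult_minus_right minus_minus power2_minus)
  define v where "v = to_ac c + to_ac d * I"
  have "v\<^sup>2 = to_ac c ^ 2 + to_ac d ^ 2 * I\<^sup>2 + to_ac (2 * c * d) * I"
    unfolding v_def by (simp add: algebra_simps power2_eq_square)
  also have "\<dots> = to_ac (c\<^sup>2 - d\<^sup>2) + to_ac (2 * c * d) * I" using I by simp
  also have "c\<^sup>2 - d\<^sup>2 = a" unfolding c d by (simp add: field_simps)
  finally have "v\<^sup>2 = u\<^sup>2" unfolding ab d .
  then have "u = v \<or> u = 0 - v" by (auto simp: power2_eq_iff)
  moreover have "v \<in> gaussian I" unfolding v_def gaussian_def by blast
  moreover have "0 \<in> gaussian I" using gaussian_to_ac[of 0 I] by simp
  ultimately show ?thesis using gaussian_diff[OF I] by metis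
qed

text \<open>Laplace's argument: if \<open>\<alpha>\<^sub>i\<close> are the roots of a polynomial whose degree has 2-adic valuation
  \<open>k + 1\<close>, the polynomial with roots \<open>(\<alpha>\<^sub>i + t \<alpha>\<^sub>i\<^sup>2) + (\<alpha>\<^sub>j + t \<alpha>\<^sub>j\<^sup>2)\<close>, \<open>i < j\<close>, has degree of
  valuation \<open>k\<close>. Two values of \<open>t\<close> yielding the same pair determine \<open>\<alpha>\<^sub>i\<close> up to square roots.\<close>

lemma has_gaussian_root:
  fixes p :: "'a::real_closed_field poly"
  assumes I: "I\<^sup>2 = -1" and deg: "Polynomial.degree p = 2 ^ k * m" "odd m"
  shows "\<exists>z\<in>gaussian I. poly (lift_poly p) z = 0"
  using deg
proof (induction k arbitrary: p m)
  case 0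
  then have "\<exists>x. (\<Sum>k\<le>Polynomial.degree p. coeff p k * x ^ k) = 0"
    by (intro odd_degree_root) (auto intro!: Nat.gr0I)
  then obtain x where "poly p x = 0" by (auto simp: poly_altdef)
  then show ?case using poly_lift_poly[of p x] gaussian_to_ac[of x I] by auto
next
  case (Suc k)
  define d where "d = Polynomial.degree p"
  have d: "d = 2 * (2 ^ k * m)" using Suc.prems by (simp add: d_def)
  then have "d > 0" using Suc.prems by (auto intro!: Nat.gr0I)
  define p1 where "p1 = smult (inverse (lead_coeff p)) p"
  have lc0: "lead_coeff p \<noteq> 0" using \<open>d > 0\<close> by (auto simp: d_def)
  have p1: "lead_coeff p1 = 1" "Polynomial.degree p1 = d" using lc0 by (auto simp: p1_def d_def)
  obtain \<alpha> where \<alpha>: "lift_poly p1 = (\<Prod>i<d. [:- \<alpha> i, 1:])"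
    using monic_lift_poly_splits[OF p1(1)] p1(2) by metis
  have "\<exists>ij\<in>pairs d. (\<alpha> (fst ij) + \<alpha> (snd ij)) + of_nat t * ((\<alpha> (fst ij))\<^sup>2 + (\<alpha> (snd ij))\<^sup>2) \<in> gaussian I" for t
  proof -
    define s where "s i = \<alpha> i + of_nat t * (\<alpha> i)\<^sup>2" for i
    have s: "poly (lift_poly [:0, 1, of_nat t:]) (\<alpha> i) = s i" for i
      by (simp add: s_def map_poly_pCons algebra_simps power2_eq_square)
    obtain p2 where "lift_poly p2 = (\<Prod>i<d. [:- s i, 1:])"
      using map_roots_lift_poly[OF \<alpha>, of "[:0, 1, of_nat t:]"] unfolding s by (metis imageE)
    from pair_sums_lift_poly[OF this] obtain q where
      q: "(\<Prod>(i, j)\<in>pairs d. [:- (s i + s j), 1:]) = lift_poly q" by (elim imageE)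
    have "Polynomial.degree q = card (pairs d)"
      using arg_cong[OF q, of Polynomial.degree, symmetric]
      by (simp add: degree_lift_poly degree_prod_eq_sum_degree case_prod_unfold)
    moreover have "card (pairs d) = 2 ^ k * (m * (d - 1))"
    proof -
      have "2 * card (pairs d) = d * d - d" using card_pairs[of d] by linarith
      also have "\<dots> = d * (d - 1)" by (simp add: algebra_simps)
      finally show ?thesis using d by simp
    qed
    moreover have "odd (m * (d - 1))" using Suc.prems d \<open>d > 0\<close> by simp
    ultimately obtain z where z: "z \<in> gaussian I" "poly (lift_poly q) z = 0"
      using Suc.IH[of q "m * (d - 1)"] by auto
    then obtain ij where ij: "ij \<in> pairs d" "z - (s (fst ij) + s (snd ij)) = 0"
      unfolding q[symmetric] by (force simp: poly_prod finite_pairs case_prod_unfold algebra_simps)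
    then have "z = s (fst ij) + s (snd ij)" by simp
    then show ?thesis using z ij by (auto simp: s_def algebra_simps)
  qed
  then obtain f where f: "f t \<in> pairs d"
    "(\<alpha> (fst (f t)) + \<alpha> (snd (f t))) + of_nat t * ((\<alpha> (fst (f t)))\<^sup>2 + (\<alpha> (snd (f t)))\<^sup>2) \<in> gaussian I" for t
    by metis
  \<comment> \<open>Pigeonhole: infinitely many \<open>t\<close>, finitely many pairs.\<close>
  have "\<not> inj f"
    using f(1) finite_pairs[of d] by (metis finite_imageD finite_subset image_subsetI infinite_UNIV_nat)
  then obtain t t' where t: "t \<noteq> t'" "f t = f t'" by (auto simp: inj_def)
  define x y where "x = \<alpha> (fst (f t))" and "y = \<alpha> (snd (f t))"
  have 1: "(x + y) + of_nat t * (x\<^sup>2 + y\<^sup>2) \<in> gaussian I" "(x + y) + of_nat t' * (x\<^sup>2 + y\<^sup>2) \<in> gaussian I"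
    using f(2)[of t] f(2)[of t'] t by (simp_all add: x_def y_def)
  have nz: "(of_nat t - of_nat t' :: 'a) \<noteq> 0" using t by simp
  note gm = gaussian_mult[OF I] and gd = gaussian_diff[OF I]
  have "to_ac (inverse (of_nat t - of_nat t')) *
      (((x + y) + of_nat t * (x\<^sup>2 + y\<^sup>2)) - ((x + y) + of_nat t' * (x\<^sup>2 + y\<^sup>2))) \<in> gaussian I"
    by (intro gm gd gaussian_to_ac 1)
  moreover have "to_ac (inverse (of_nat t - of_nat t')) *
      (((x + y) + of_nat t * (x\<^sup>2 + y\<^sup>2)) - ((x + y) + of_nat t' * (x\<^sup>2 + y\<^sup>2))) =
      to_ac (inverse (of_nat t - of_nat t') * (of_nat t - of_nat t')) * (x\<^sup>2 + y\<^sup>2)"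
    unfolding to_ac_mult to_ac_diff to_ac_of_nat by (simp add: algebra_simps)
  ultimately have B: "x\<^sup>2 + y\<^sup>2 \<in> gaussian I"
    unfolding left_inverse[OF nz] to_ac_1 by simp
  have "((x + y) + of_nat t * (x\<^sup>2 + y\<^sup>2)) - to_ac (of_nat t) * (x\<^sup>2 + y\<^sup>2) \<in> gaussian I"
    by (intro gm gd gaussian_to_ac 1 B)
  then have A: "x + y \<in> gaussian I" by simp
  \<comment> \<open>This is (x - y)^2; its square root and x + y together give x.\<close>
  have "to_ac 2 * (x\<^sup>2 + y\<^sup>2) - (x + y) * (x + y) \<in> gaussian I"
    by (intro gm gd gaussian_to_ac A B)
  then have "(x - y)\<^sup>2 \<in> gaussian I" by (simp add: algebra_simps power2_eq_square)
  then have C: "x - y \<in> gaussian I" by (rule gaussian_sqrt[OF I])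
  have "to_ac (1 / 2) * ((x + y) + (x - y)) \<in> gaussian I"
    by (intro gm gaussian_add gaussian_to_ac A C)
  then have "x \<in> gaussian I" by simp
  moreover have "poly (lift_poly p1) x = 0"
    using f(1)[of t] unfolding \<alpha> by (auto simp: poly_prod x_def pairs_def)
  then have "poly (lift_poly p) x = 0" using lc0 by (simp add: p1_def lift_poly_smult)
  ultimately show ?case by blast
qed

text \<open>A root a + b I with b nonzero also kills the remainder v + u X of \<open>p\<close>
  modulo the quadratic. Moving the I-part to the other side and squaring gives (v + a u)^2 + (b u)^2
  = 0 in the ordered field, so the remainder vanishes.\<close>

lemma real_closed_poly_factor:
  fixes p :: "'a::real_closed_field poly"
  assumes "Polynomial.degree p > 0"
  shows "(\<exists>x. poly p x = 0) \<or> (\<exists>a b. b \<noteq> 0 \<and> [:a\<^sup>2 + b\<^sup>2, - 2 * a, 1:] dvd p)"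
proof -
  obtain I :: "'a alg_closure" where "poly [:1, 0, 1:] I = 0"
    using alg_closed_imp_poly_has_root[of "[:1, 0, 1:] :: 'a alg_closure poly"] by auto
  then have I: "I\<^sup>2 = -1" by (simp add: power2_eq_square add_eq_0_iff)
  obtain k m where "Polynomial.degree p = 2 ^ k * m" "odd m"
    using assms by (metis dvd_0_right even_zero multiplicity_decompose' not_gr_zero odd_one two_is_prime_nat prime_elem_nat_iff prime_imp_prime_elem)
  from has_gaussian_root[OF I this] obtain a b where
    z: "poly (lift_poly p) (to_ac a + to_ac b * I) = 0" (is "poly _ ?z = 0") by (auto simp: gaussian_def)
  show ?thesis
  proof (cases "b = 0")
    case True
    then have "poly p a = 0" using z poly_lift_poly[of p a] by simp
    then show ?thesis by blast
  next
    case False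
    define q where "q = [:a\<^sup>2 + b\<^sup>2, - 2 * a, 1:]"
    have "Polynomial.degree (p mod q) < 2"
      using degree_mod_less[of q p] by (auto simp: q_def)
    then obtain u v where uv: "p mod q = [:v, u:]"
      by (metis degree_pCons_eq_if less_2_cases_iff pCons_cases degree_0 degree_eq_zeroE one_neq_zero old.nat.inject One_nat_def pCons_0_0)
    have "poly (lift_poly q) ?z = to_ac b ^ 2 * (1 + I\<^sup>2)"
      by (simp add: q_def map_poly_pCons algebra_simps power2_eq_square)
    then have "poly (lift_poly q) ?z = 0" using I by simp
    moreover have "lift_poly p = lift_poly (p div q) * lift_poly q + lift_poly (p mod q)"
      by (simp flip: lift_poly_add lift_poly_mult)
    ultimately have "to_ac v + ?z * to_ac u = 0" using z uv by (simp add: map_poly_pCons)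
    then have "to_ac (v + a * u) + to_ac (b * u) * I = 0" by (simp add: algebra_simps)
    then have e: "to_ac (v + a * u) = - (to_ac (b * u) * I)" by (simp only: eq_neg_iff_add_eq_0)
    then have "to_ac ((v + a * u)\<^sup>2) = to_ac ((b * u)\<^sup>2) * I\<^sup>2"
      unfolding to_ac_power by (simp add: power_mult_distrib)
    then have "to_ac ((v + a * u)\<^sup>2 + (b * u)\<^sup>2) = 0" using I by simp
    then have "(v + a * u)\<^sup>2 + (b * u)\<^sup>2 = 0" by (subst (asm) to_ac_eq_0_iff)
    then have "v + a * u = 0" "b * u = 0" by (simp_all add: sum_power2_eq_zero_iff)
    then have "p mod q = 0" using uv False by simp
    then show ?thesis using False by (auto simp: q_def mod_eq_0_iff_dvd)
  qed
qed

text \<open>A quadratic factor is positive everywhere, and a linear factor with root outside the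
  interval has the same sign at both ends. Removing either kind of factor keeps the sign change and
  lowers the degree.\<close>

lemma real_closed_IVT_mult:
  fixes p :: "'a::real_closed_field poly"
  assumes "a < b" "poly p a * poly p b < 0"
  shows "\<exists>x. a < x \<and> x < b \<and> poly p x = 0"
  using assms(2)
proof (induction "Polynomial.degree p" arbitrary: p rule: less_induct)
  case less
  have "Polynomial.degree p > 0"
  proof (rule Nat.gr0I)
    assume "Polynomial.degree p = 0"
    then obtain c where "p = [:c:]" by (rule degree_eq_zeroE)
    then show False using less.prems by (simp add: mult_less_0_iff)
  qed
  from real_closed_poly_factor[OF this] show ?case
  proof (elim disjE exE conjE)
    fix r assume r: "poly p r = 0"
    then obtain g where g: "p = [:-r, 1:] * g" by (auto simp: poly_eq_0_iff_dvd elim: dvdE)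
    have "g \<noteq> 0" using less.prems g by auto
    then have deg: "Polynomial.degree g < Polynomial.degree p" unfolding g by (subst degree_mult_eq) auto
    show ?thesis
    proof (cases "a < r \<and> r < b")
      case True
      then show ?thesis using r by blast
    next
      case False
      have "r \<noteq> a" "r \<noteq> b" using less.prems r by auto
      then have "(a - r) * (b - r) > 0" using False assms(1) by (auto simp: zero_less_mult_iff)
      moreover have "poly p a * poly p b = ((a - r) * (b - r)) * (poly g a * poly g b)"
        unfolding g by (simp add: algebra_simps)
      ultimately have "poly g a * poly g b < 0"
        using less.prems by (metis mult_less_cancel_left_pos mult_zero_right)
      then show ?thesis using less.hyps[OF deg] g by auto
    qed
  next
    fix c d :: 'a assume d: "d \<noteq> 0" and "[:c\<^sup>2 + d\<^sup>2, - 2 * c, 1:] dvd p"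
    then obtain g where g: "p = [:c\<^sup>2 + d\<^sup>2, - 2 * c, 1:] * g" by (elim dvdE)
    have "g \<noteq> 0" using less.prems g by auto
    then have deg: "Polynomial.degree g < Polynomial.degree p" unfolding g by (subst degree_mult_eq) auto
    have q: "poly p x = ((x - c)\<^sup>2 + d\<^sup>2) * poly g x" for x
      unfolding g by (simp add: algebra_simps power2_eq_square)
    have pos: "(x - c)\<^sup>2 + d\<^sup>2 > 0" for x using d by (simp add: sum_power2_gt_zero_iff)
    have "poly p a * poly p b = (((a - c)\<^sup>2 + d\<^sup>2) * ((b - c)\<^sup>2 + d\<^sup>2)) * (poly g a * poly g b)"
      unfolding q by (simp only: mult_ac)
    moreover have "((a - c)\<^sup>2 + d\<^sup>2) * ((b - c)\<^sup>2 + d\<^sup>2) > 0" using pos by simp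
    ultimately have "poly g a * poly g b < 0"
      using less.prems by (metis mult_less_cancel_left_pos mult_zero_right)
    then show ?thesis using less.hyps[OF deg] q by auto
  qed
qed

section \<open>Rolle, mean values, roots of positive elements, Taylor expansion\<close>

definition btw :: "'a::linordered_field \<Rightarrow> 'a \<Rightarrow> 'a \<Rightarrow> bool" where
  "btw a x b \<longleftrightarrow> (a < x \<and> x < b) \<or> (b < x \<and> x < a)"

lemma btw_commute: "btw a x b \<longleftrightarrow> btw b x a"
  unfolding btw_def by auto

lemma real_closed_IVT:
  fixes p :: "'a::real_closed_field poly"
  assumes "poly p a * poly p b < 0"
  shows "\<exists>x. btw a x b \<and> poly p x = 0"
proof -
  have "a \<noteq> b" using assms by (auto simp: not_less)
  then consider "a < b" | "b < a" by linarith
  then show ?thesis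
    using real_closed_IVT_mult[of a b p] real_closed_IVT_mult[of b a p] assms
    by cases (auto simp: btw_def mult.commute)
qed

text \<open>Write p = (X - a)^(m+1) (X - b)^(n+1) q. Without roots in between, q has the same sign
  at both ends, whereas the cofactor \<open>s\<close> of (X - a)^m (X - b)^n in p' takes the values
  (m+1)(a - b) q(a) and (n+1)(b - a) q(b), hence changes sign.\<close>

lemma real_closed_Rolle_adjacent:
  fixes p :: "'a::real_closed_field poly"
  assumes "a < b" "poly p a = 0" "poly p b = 0" "\<And>x. a < x \<Longrightarrow> x < b \<Longrightarrow> poly p x \<noteq> 0"
  shows "\<exists>x. a < x \<and> x < b \<and> poly (pderiv p) x = 0"
proof -
  have p0: "p \<noteq> 0" using assms(1) assms(4)[of "(a + b) / 2"] by (auto simp: field_simps)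
  obtain m0 r where r0: "p = [:-a, 1:] ^ m0 * r" "poly r a \<noteq> 0"
    using Polynomial.order_decomp[OF p0, where a = a] unfolding poly_eq_0_iff_dvd by blast
  then obtain m where r: "p = [:-a, 1:] ^ Suc m * r" "poly r a \<noteq> 0"
    using assms(2) by (cases m0) auto
  have "r \<noteq> 0" using r(2) by auto
  have "poly r b = 0" using assms(1,3) unfolding r(1) by simp
  moreover obtain n0 q where "r = [:-b, 1:] ^ n0 * q" "poly q b \<noteq> 0"
    using Polynomial.order_decomp[OF \<open>r \<noteq> 0\<close>, where a = b] unfolding poly_eq_0_iff_dvd by blast
  ultimately obtain n where q: "r = [:-b, 1:] ^ Suc n * q" "poly q b \<noteq> 0"
    by (cases n0) auto
  have qa: "poly q a \<noteq> 0" using r(2) unfolding q(1) by simp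
  have "poly q x \<noteq> 0" if "a < x" "x < b" for x
    using assms(4)[OF that] unfolding r(1) q(1) by simp
  then have "\<not> poly q a * poly q b < 0"
    using real_closed_IVT_mult[OF assms(1), of q] by blast
  then have pos: "poly q a * poly q b > 0" using qa q(2) by (simp add: less_le not_less)
  define A B where "A = [:-a, 1:]" and "B = [:-b, 1:]"
  have dAB: "pderiv A = 1" "pderiv B = 1" by (simp_all add: A_def B_def pderiv_pCons)
  define s where "s = smult (of_nat (Suc m)) (B * q) + smult (of_nat (Suc n)) (A * q) + A * B * pderiv q"
  have "pderiv p = A ^ m * B ^ n * s"
    unfolding r(1) q(1) s_def A_def[symmetric] B_def[symmetric] pderiv_mult pderiv_power_Suc dAB
    by (simp add: algebra_simps smult_add_right del: of_nat_Suc)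
  then have *: "poly s x = 0 \<Longrightarrow> poly (pderiv p) x = 0" for x by simp
  have "poly s a * poly s b = - (of_nat (Suc m) * of_nat (Suc n) * (b - a)\<^sup>2 * (poly q a * poly q b))"
    unfolding s_def A_def B_def by (simp add: algebra_simps power2_eq_square)
  also have "\<dots> < 0" using pos assms(1) by (simp add: zero_less_mult_iff del: of_nat_Suc)
  finally obtain x where "a < x" "x < b" "poly s x = 0"
    using real_closed_IVT_mult[OF assms(1)] by blast
  then show ?thesis using * by blast
qed

lemma real_closed_Rolle:
  fixes p :: "'a::real_closed_field poly"
  assumes "a < b" "poly p a = 0" "poly p b = 0"
  shows "\<exists>x. a < x \<and> x < b \<and> poly (pderiv p) x = 0"
proof (cases "p = 0")
  case True
  then show ?thesis using assms(1) by (auto intro: dense)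
next
  case False
  define Z where "Z = {x. poly p x = 0} \<inter> {x. a < x \<and> x \<le> b}"
  have fin: "finite Z" unfolding Z_def using poly_roots_finite[OF False] by simp
  have "b \<in> Z" using assms by (simp add: Z_def)
  then have m: "Min Z \<in> Z" "Min Z \<le> b" using fin by (auto intro: Min_in)
  have "poly p x \<noteq> 0" if "a < x" "x < Min Z" for x
  proof
    assume "poly p x = 0"
    then have "x \<in> Z" using that m by (simp add: Z_def)
    then show False using that fin by (meson Min_le not_le)
  qed
  then obtain x where "a < x" "x < Min Z" "poly (pderiv p) x = 0"
    using real_closed_Rolle_adjacent[of a "Min Z" p] m assms by (auto simp: Z_def)
  then show ?thesis using m by force
qed

lemma real_closed_MVT:
  fixes p :: "'a::real_closed_field poly"
  assumes "a \<noteq> b"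
  shows "\<exists>x. btw a x b \<and> poly p b - poly p a = poly (pderiv p) x * (b - a)"
proof -
  have *: "\<exists>x. a < x \<and> x < b \<and> poly p b - poly p a = poly (pderiv p) x * (b - a)"
    if ab: "a < b" for a b
  proof -
    define k where "k = (poly p b - poly p a) / (b - a)"
    define q where "q = p - [:poly p a - k * a, k:]"
    have "k * (b - a) = poly p b - poly p a" using ab by (simp add: k_def)
    then have "poly q a = 0" "poly q b = 0" by (simp_all add: q_def algebra_simps)
    from real_closed_Rolle[OF ab this] obtain x where "a < x" "x < b" "poly (pderiv q) x = 0" by blast
    moreover have "poly (pderiv q) x = poly (pderiv p) x - k"
      by (simp add: q_def pderiv_diff pderiv_pCons)
    ultimately show ?thesis using ab by (auto simp: k_def)
  qed
  consider "a < b" | "b < a" using assms by linarith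
  then show ?thesis
  proof cases
    case 1
    then show ?thesis using *[of a b] by (auto simp: btw_def)
  next
    case 2
    from *[OF 2] obtain x where "b < x" "x < a" "poly p a - poly p b = poly (pderiv p) x * (a - b)" by blast
    then show ?thesis by (intro exI[of _ x]) (auto simp: btw_def algebra_simps)
  qed
qed

lemma real_closed_nth_root:
  fixes u :: "'a::real_closed_field"
  assumes "u > 0" "n > 0"
  shows "\<exists>r>0. r ^ n = u"
proof -
  define p where "p = Polynomial.monom 1 n - [:u:]"
  have p: "poly p x = x ^ n - u" for x by (simp add: p_def poly_monom)
  have "u + 1 \<le> (u + 1) ^ n" using assms by (intro self_le_power) auto
  then have "poly p (u + 1) > 0" by (simp add: p)
  moreover have "poly p 0 < 0" using assms by (simp add: p zero_power)
  ultimately have "poly p 0 * poly p (u + 1) < 0" by (simp add: mult_less_0_iff)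
  then obtain r where "0 < r" "poly p r = 0"
    using real_closed_IVT_mult[of 0 "u + 1" p] assms by auto
  then show ?thesis by (auto simp: p)
qed

lemma poly_taylor:
  fixes p :: "'a::field_char_0 poly"
  shows "poly p (c + h) = (\<Sum>k\<le>Polynomial.degree p. poly ((pderiv ^^ k) p) c / fact k * h ^ k)"
proof -
  define q where "q = pcompose p [:c, 1:]"
  have "(pderiv ^^ k) q = pcompose ((pderiv ^^ k) p) [:c, 1:]" for k
    by (induction k) (simp_all add: q_def pderiv_pcompose pderiv_pCons)
  then have "poly ((pderiv ^^ k) p) c = poly ((pderiv ^^ k) q) 0" for k
    by (simp add: poly_pcompose)
  moreover have "poly ((pderiv ^^ k) q) 0 = fact k * coeff q k" for k
    by (simp add: poly_0_coeff_0 coeff_higher_pderiv pochhammer_fact)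
  ultimately have cq: "coeff q k = poly ((pderiv ^^ k) p) c / fact k" for k by simp
  have "Polynomial.degree q = Polynomial.degree p" by (simp add: q_def degree_pcompose)
  then have "poly q h = (\<Sum>k\<le>Polynomial.degree p. poly ((pderiv ^^ k) p) c / fact k * h ^ k)"
    by (simp add: poly_altdef cq)
  moreover have "poly q h = poly p (c + h)" by (simp add: q_def poly_pcompose add.commute)
  ultimately show ?thesis by simp
qed

section \<open>Valuations of polynomial values\<close>

lemma zmult_0 [simp]: "zmult 0 g = 0"
  by (simp add: zmult_def)

lemma zmult_Suc: "zmult (z + 1) g = zmult z g + g"
proof (cases "0 \<le> z")
  case True
  then have "nat (z + 1) = Suc (nat z)" by simp
  then show ?thesis using True by (simp add: zmult_def add.commute)
next
  case False
  then have "nat (- z) = Suc (nat (- (z + 1)))" by simp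
  then show ?thesis using False by (auto simp: zmult_def algebra_simps)
qed

lemma zmult_1 [simp]: "zmult 1 g = g"
  using zmult_Suc[of 0 g] by simp

lemma zmult_pred: "zmult (z - 1) g = zmult z g - g"
  using zmult_Suc[of "z - 1" g] by simp

lemma zmult_add_left: "zmult (y + z) g = zmult y g + zmult z g"
proof (induction z rule: int_induct[where k = 0])
  case (step1 i)
  then show ?case using zmult_Suc[of "y + i" g] zmult_Suc[of i g] by (simp add: add.assoc)
next
  case (step2 i)
  then show ?case using zmult_pred[of "y + i" g] zmult_pred[of i g] by (simp add: add_diff_eq)
qed simp

lemma zmult_add_right: "zmult z (g + h) = zmult z g + zmult z h"
  by (induction z rule: int_induct[where k = 0]) (simp_all add: zmult_Suc zmult_pred algebra_simps)

lemma zmult_minus_left [simp]: "zmult (- z) g = - zmult z g"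
  using zmult_add_left[of z "- z" g] by (simp add: eq_neg_iff_add_eq_0 add.commute)

lemma zmult_0_right [simp]: "zmult z 0 = 0"
  using zmult_add_right[of z 0 0] by simp

lemma zmult_minus_right [simp]: "zmult z (- g) = - zmult z g"
  using zmult_add_right[of z g "- g"] by (simp add: eq_neg_iff_add_eq_0 add.commute)

lemma zmult_diff_right: "zmult z (g - h) = zmult z g - zmult z h"
  using zmult_add_right[of z g "- h"] by simp

lemma zmult_mult: "zmult (y * z) g = zmult y (zmult z g)"
proof (induction y rule: int_induct[where k = 0])
  case (step1 i)
  then show ?case by (simp add: distrib_right zmult_add_left zmult_Suc)
next
  case (step2 i)
  have "zmult (i * z) g = zmult ((i - 1) * z) g + zmult z g"
    by (simp add: left_diff_distrib flip: zmult_add_left)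
  with step2 show ?case by (simp add: zmult_pred eq_diff_eq)
qed simp

lemma zmult_pos:
  fixes g :: "'g::linordered_ab_group_add"
  assumes "0 < z" "0 < g"
  shows "0 < zmult z g"
proof -
  have "0 < zmult (1 + int n) g" for n
  proof (induction n)
    case (Suc n)
    have "1 + int (Suc n) = (1 + int n) + 1" by simp
    then show ?case using Suc assms by (simp only: zmult_Suc add_pos_pos)
  qed (use assms in simp)
  from this[of "nat (z - 1)"] show ?thesis using assms by simp
qed

lemma zmult_pos_iff:
  fixes g :: "'g::linordered_ab_group_add"
  assumes "0 < z"
  shows "0 < zmult z g \<longleftrightarrow> 0 < g"
proof -
  have "g < 0 \<Longrightarrow> zmult z g < 0" using zmult_pos[OF assms, of "- g"] by simp
  then show ?thesis using zmult_pos[OF assms, of g]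
    by (metis less_asym linorder_neqE order.irrefl zmult_0_right)
qed

lemma zmult_less_iff:
  fixes g :: "'g::linordered_ab_group_add"
  assumes "0 < z"
  shows "zmult z g < zmult z h \<longleftrightarrow> g < h"
  using zmult_pos_iff[OF assms, of "h - g"] by (simp add: zmult_diff_right)

lemma zmult_cancel_iff:
  fixes g :: "'g::linordered_ab_group_add"
  assumes "0 < z"
  shows "zmult z g = zmult z h \<longleftrightarrow> g = h"
  using zmult_less_iff[OF assms] by (metis linorder_neqE order.irrefl)

lemma abs_diff_less_imp_same_sign:
  fixes x y :: "'a::linordered_idom"
  assumes "\<bar>x - y\<bar> < \<bar>y\<bar>"
  shows "x * y > 0"
proof (cases "y > 0")
  case True
  then have "x > 0" using assms by (simp add: abs_less_iff)
  then show ?thesis using True by simp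
next
  case False
  then have "x < 0" "y < 0" using assms by (auto simp: abs_less_iff)
  then show ?thesis by (simp add: mult_neg_neg)
qed

locale rcvf = valuation val
  for val :: "'k::real_closed_field \<Rightarrow> 'g::linordered_ab_group_add option" +
  assumes nontriv: "nontrivial_valuation val"
    and convex: "convex_valuation val"
begin

text \<open>The junk value \<open>w 0 = 0\<close> replaces \<open>-\<infinity>\<close>, so \<open>w u\<close> is meaningful only together with \<open>u \<noteq> 0\<close>.\<close>

definition w :: "'k \<Rightarrow> 'g" where
  "w u = (if u = 0 then 0 else the (val u))"

text \<open>Comparison through \<open>val\<close> itself puts 0 at the bottom, which the junk value
  of \<open>w\<close> would not do.\<close>

definition dom :: "'k \<Rightarrow> 'k \<Rightarrow> bool" (infix "\<preceq>" 50) where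
  "a \<preceq> b \<longleftrightarrow> val a \<le> val b"

lemma val_eq_Some: "u \<noteq> 0 \<Longrightarrow> val u = Some (w u)"
  using val_eq_None_iff[of u] by (auto simp: w_def)

lemma w_0 [simp]: "w 0 = 0"
  by (simp add: w_def)

lemma val_0: "val 0 = None"
  by (simp add: val_eq_None_iff)

lemma dom_iff: "a \<preceq> b \<longleftrightarrow> a = 0 \<or> (b \<noteq> 0 \<and> w a \<le> w b)"
  by (cases "a = 0"; cases "b = 0") (simp_all add: dom_def val_0 val_eq_Some)

lemma w_mult: "x \<noteq> 0 \<Longrightarrow> y \<noteq> 0 \<Longrightarrow> w (x * y) = w x + w y"
  using val_mult[of x y] by (simp add: val_eq_Some)

lemma w_1 [simp]: "w 1 = 0"
  using w_mult[of 1 1] by simp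

lemma w_power: "w (x ^ n) = zmult (int n) (w x)"
proof (cases "x = 0")
  case False
  then show ?thesis
    by (induction n) (simp_all add: w_mult zmult_add_left)
qed (simp add: power_0_left)

lemma w_minus [simp]: "w (- x) = w x"
proof -
  have "zmult 2 (w (-1)) = zmult 2 0"
    using w_power[of "-1" 2] by simp
  then have "w (-1) = 0" by (subst (asm) zmult_cancel_iff) simp_all
  then show ?thesis using w_mult[of "-1" x] by (cases "x = 0") simp_all
qed

lemma w_abs [simp]: "w \<bar>x\<bar> = w x"
  by (simp add: abs_if)

lemma w_inverse: "x \<noteq> 0 \<Longrightarrow> w (inverse x) = - w x"
  using w_mult[of x "inverse x"] by (simp add: eq_neg_iff_add_eq_0 add.commute)

lemma dom_refl [simp]: "a \<preceq> a"
  by (simp add: dom_def)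

lemma dom_0 [simp]: "0 \<preceq> a"
  by (simp add: dom_iff)

lemma dom_trans [trans]: "a \<preceq> b \<Longrightarrow> b \<preceq> c \<Longrightarrow> a \<preceq> c"
  by (simp add: dom_def)

lemma dom_linear: "a \<preceq> b \<or> b \<preceq> a"
  by (auto simp: dom_def)

lemma dom_add: "a \<preceq> c \<Longrightarrow> b \<preceq> c \<Longrightarrow> a + b \<preceq> c"
  unfolding dom_def using val_add[of a b] by (meson max.boundedI order.trans)

lemma dom_minus_iff [simp]: "- a \<preceq> b \<longleftrightarrow> a \<preceq> b" "a \<preceq> - b \<longleftrightarrow> a \<preceq> b"
  by (auto simp: dom_iff)

lemma dom_abs_iff [simp]: "\<bar>a\<bar> \<preceq> b \<longleftrightarrow> a \<preceq> b" "a \<preceq> \<bar>b\<bar> \<longleftrightarrow> a \<preceq> b"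
  by (auto simp: dom_iff)

lemma dom_sum: "(\<And>a. a \<in> A \<Longrightarrow> f a \<preceq> c) \<Longrightarrow> sum f A \<preceq> c"
  by (induction A rule: infinite_finite_induct) (auto intro: dom_add)

lemma dom_sum_ex:
  "finite A \<Longrightarrow> sum f A \<noteq> 0 \<Longrightarrow> \<exists>a\<in>A. f a \<noteq> 0 \<and> sum f A \<preceq> f a"
proof (induction A rule: finite_induct)
  case (insert x A)
  consider "f x = 0" | "f x \<noteq> 0" "sum f A \<preceq> f x" | "f x \<preceq> sum f A" "f x \<noteq> 0"
    using dom_linear by blast
  then show ?case
  proof cases
    case 1
    then show ?thesis using insert by auto
  next
    case 2
    then have "sum f (insert x A) \<preceq> f x" using insert.hyps by (auto intro: dom_add)
    then show ?thesis using 2 by blast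
  next
    case 3
    then have "sum f A \<noteq> 0" by (auto simp: dom_iff)
    then obtain a where a: "a \<in> A" "f a \<noteq> 0" "sum f A \<preceq> f a" using insert by blast
    then have "sum f (insert x A) \<preceq> f a" using insert.hyps 3 by (auto intro: dom_add dom_trans)
    then show ?thesis using a by blast
  qed
qed simp

lemma dom_mult: "a \<preceq> b \<Longrightarrow> c \<preceq> d \<Longrightarrow> a * c \<preceq> b * d"
  by (auto simp: dom_iff w_mult add_mono)

text \<open>The place where convexity is used: |a| / |b| lies between 0 and 1, and 1 is in the
  valuation ring.\<close>

lemma abs_le_imp_dom:
  assumes "\<bar>a\<bar> \<le> \<bar>b\<bar>"
  shows "a \<preceq> b"
proof (cases "a = 0")
  case False
  then have b: "b \<noteq> 0" using assms by auto
  define q where "q = \<bar>a\<bar> * inverse \<bar>b\<bar>"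
  have "0 \<le> q" "q \<le> 1" using assms b by (auto simp: q_def field_simps)
  moreover have "1 \<in> valuation_ring val" by (simp add: valuation_ring_def val_eq_Some)
  ultimately have "q \<in> valuation_ring val" using convex unfolding convex_valuation_def by blast
  moreover have "w q = w a - w b" using False b by (simp add: q_def w_mult w_inverse)
  moreover have "q \<noteq> 0" using False b by (simp add: q_def)
  ultimately have "w a - w b \<le> 0" by (simp add: valuation_ring_def val_eq_Some)
  then show ?thesis using b by (simp add: dom_iff)
qed simp

lemma of_nat_dom_1: "of_nat n \<preceq> 1"
  by (induction n) (auto intro: dom_add)

text \<open>The ultrametric inequality bounds the valuation of a positive integer from above by that
  of 1, and convexity from below. So the residue characteristic is 0.\<close>

lemma w_of_nat: "w (of_nat n) = 0"
proof (cases "n = 0")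
  case False
  then have "(1::'k) \<preceq> of_nat n" by (intro abs_le_imp_dom) simp
  then show ?thesis using of_nat_dom_1[of n] False by (auto simp: dom_iff)
qed simp

lemma w_fact [simp]: "w (fact n) = 0"
  using w_of_nat[of "fact n"] by simp

lemma w_numeral [simp]: "w (numeral n) = 0"
  using w_of_nat[of "numeral n"] by simp

lemma dom_divide_fact [simp]: "a / fact n \<preceq> b \<longleftrightarrow> a \<preceq> b" "a \<preceq> b / fact n \<longleftrightarrow> a \<preceq> b"
  by (auto simp: dom_iff divide_inverse w_mult w_inverse)

lemma ex_pos_w: "\<exists>z>0. w z = t"
proof -
  obtain u where u: "val u = Some t" using surj_val by (metis surjD)
  then have "u \<noteq> 0" using val_0 by auto
  then have "\<bar>u\<bar> > 0" "w u = t" using u by (simp_all add: w_def)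
  then have "\<bar>u\<bar> > 0" "w \<bar>u\<bar> = t" by simp_all
  then show ?thesis by blast
qed

text \<open>Divisibility of the value group is inherited from n-th roots of positive field
  elements.\<close>

lemma divisible:
  fixes g :: 'g
  assumes "n > 0"
  shows "\<exists>h. zmult (int n) h = g"
proof -
  obtain z where z: "z > 0" "w z = g" using ex_pos_w by blast
  then obtain r where "r ^ n = z" using real_closed_nth_root assms by blast
  then have "zmult (int n) (w r) = g" using w_power[of r n] z by simp
  then show ?thesis by blast
qed

section \<open>Taylor expansions without cancellation\<close>

lemma no_root_same_sign:
  fixes p :: "'k poly"
  assumes "\<And>x. btw a x b \<Longrightarrow> poly p x \<noteq> 0" "poly p a \<noteq> 0" "poly p b \<noteq> 0"
  shows "poly p a * poly p b > 0"
  using real_closed_IVT[of p a b] assms by (metis linorder_neqE mult_eq_0_iff)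

text \<open>No derivative of \<open>p\<close>, unless identically zero, has a root strictly between \<open>a\<close> and \<open>b\<close>.
  This is the condition under which the valuation of \<open>p\<close> follows from a Taylor expansion.\<close>

definition noroots :: "'k poly \<Rightarrow> 'k \<Rightarrow> 'k \<Rightarrow> bool" where
  "noroots p a b \<longleftrightarrow> (\<forall>k x. btw a x b \<longrightarrow> (pderiv ^^ k) p \<noteq> 0 \<longrightarrow> poly ((pderiv ^^ k) p) x \<noteq> 0)"

lemma noroots_pderiv: "noroots p a b \<Longrightarrow> noroots (pderiv p) a b"
  unfolding noroots_def using funpow_swap1[of pderiv] by (metis funpow.simps(2) o_apply)

text \<open>If \<open>p'(y) z\<close> were not dominated by \<open>p(y)\<close>, the linear term of the Taylor expansion at \<open>y\<close> would
  dominate the higher ones at a small multiple of \<open>z\<close>, by induction, and produce a root.\<close>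

lemma deriv_dom:
  assumes "z > 0" "noroots p (y - z) (y + z)"
  shows "poly ((pderiv ^^ k) p) y * z ^ k \<preceq> poly p y"
  using assms(2)
proof (induction "Polynomial.degree p" arbitrary: p k rule: less_induct)
  case less
  show ?case
  proof (cases "Polynomial.degree p = 0")
    case True
    then have "pderiv p = 0" by (simp add: pderiv_eq_0_iff)
    then have "k \<noteq> 0 \<Longrightarrow> (pderiv ^^ k) p = 0"
      by (cases k) (simp_all del: funpow.simps add: funpow_Suc_right)
    then show ?thesis by (cases "k = 0") auto
  next
    case False
    define n where "n = Polynomial.degree p"
    define b where "b = poly (pderiv p) y * z"
    have "Polynomial.degree (pderiv p) < Polynomial.degree p" using False by (simp add: degree_pderiv)
    from less.hyps[OF this noroots_pderiv[OF less.prems]]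
    have "poly ((pderiv ^^ j) (pderiv p)) y * z ^ j \<preceq> poly (pderiv p) y" for j .
    then have "(poly ((pderiv ^^ j) (pderiv p)) y * z ^ j) * z \<preceq> b" for j
      unfolding b_def by (rule dom_mult) simp
    then have IH: "poly ((pderiv ^^ Suc j) p) y * z ^ Suc j \<preceq> b" for j
      by (simp del: funpow.simps add: funpow_Suc_right mult_ac)
    have "b \<preceq> poly p y"
    proof (cases "b = 0")
      case b0: False
      define c where "c j = poly ((pderiv ^^ j) p) y / fact j * z ^ j" for j
      have cb: "c (Suc j) \<preceq> b" for j
        using IH[of j] unfolding c_def times_divide_eq_left by (simp only: dom_divide_fact)
      define B where "B = (\<Sum>j\<in>{2..n}. \<bar>c j / b\<bar>)"
      have B0: "B \<ge> 0" unfolding B_def by (rule sum_nonneg) simp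
      have "B \<preceq> 1" unfolding B_def
      proof (rule dom_sum)
        fix j assume "j \<in> {2..n}"
        then obtain i where "j = Suc i" by (cases j) auto
        then have "c j / b \<preceq> b / b" unfolding divide_inverse using cb by (intro dom_mult) auto
        then show "\<bar>c j / b\<bar> \<preceq> 1" using b0 by (simp del: abs_divide)
      qed
      then have B1: "4 * (1 + B) \<preceq> 1"
        using dom_mult[of 4 1 "1 + B" 1] by (simp add: dom_add) (simp add: dom_iff dom_add)
      \<comment> \<open>At |u| = \<delta> the terms of degree at least 2 sum to at most \<delta>^2
        |b| B, and \<delta> B \<le> 1/2, so they amount to at most half the linear term. Undoing the
        scaling by 2 / \<delta> = 4 (1 + B) costs nothing, since that number is dominated by
        1.\<close>
      define \<delta> where "\<delta> = 1 / (2 * (1 + B))"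
      have \<delta>: "\<delta> > 0" "\<delta> < 1" "\<delta> * B \<le> 1 / 2" using B0 by (auto simp: \<delta>_def field_simps)
      have exp: "\<bar>poly p (y + u * z) - poly p y - u * b\<bar> \<le> \<delta> * \<bar>b\<bar> / 2" if u: "\<bar>u\<bar> = \<delta>" for u
      proof -
        have "poly p (y + u * z) = (\<Sum>j\<le>n. c j * u ^ j)"
          unfolding poly_taylor n_def[symmetric] c_def by (simp add: power_mult_distrib mult_ac)
        also have "{..n} = insert 0 (insert 1 {2..n})" using False by (auto simp: n_def)
        also have "(\<Sum>j\<in>\<dots>. c j * u ^ j) = c 0 + (c 1 * u + (\<Sum>j\<in>{2..n}. c j * u ^ j))"
          by simp
        finally have "poly p (y + u * z) - poly p y - u * b = (\<Sum>j\<in>{2..n}. c j * u ^ j)"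
          by (simp add: c_def b_def mult_ac)
        also have "\<bar>\<dots>\<bar> \<le> (\<Sum>j\<in>{2..n}. \<bar>c j * u ^ j\<bar>)" by (rule sum_abs)
        also have "\<dots> \<le> (\<Sum>j\<in>{2..n}. \<delta>\<^sup>2 * \<bar>b\<bar> * \<bar>c j / b\<bar>)"
        proof (rule sum_mono)
          fix j assume "j \<in> {2..n}"
          then have "\<delta> ^ j \<le> \<delta>\<^sup>2" using \<delta> by (intro power_decreasing) auto
          then have "\<bar>c j\<bar> * \<delta> ^ j \<le> \<bar>c j\<bar> * \<delta>\<^sup>2" by (rule mult_left_mono) simp
          then show "\<bar>c j * u ^ j\<bar> \<le> \<delta>\<^sup>2 * \<bar>b\<bar> * \<bar>c j / b\<bar>"
            using b0 u by (simp add: abs_mult power_abs mult_ac)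
        qed
        also have "\<dots> = \<delta> * \<bar>b\<bar> * (\<delta> * B)"
          unfolding B_def by (simp add: sum_distrib_left power2_eq_square mult_ac)
        also have "\<dots> \<le> \<delta> * \<bar>b\<bar> * (1 / 2)" using \<delta> by (intro mult_left_mono) auto
        finally show ?thesis by simp
      qed
      have py: "poly p y \<noteq> 0"
      proof -
        have "btw (y - z) y (y + z)" "p \<noteq> 0" using assms(1) False by (auto simp: btw_def)
        then show ?thesis using less.prems unfolding noroots_def by (metis funpow_0)
      qed
      \<comment> \<open>The sign makes the linear term u b oppose \<open>poly p y\<close>. As no
        root is crossed, the sign of \<open>p\<close> survives, so \<open>poly p y\<close> must
        compensate at least half of \<delta> |b|.\<close>
      define u where "u = (if poly p y * b > 0 then - \<delta> else \<delta>)"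
      have u: "\<bar>u\<bar> = \<delta>" using \<delta> by (simp add: u_def)
      have pos: "poly p y * poly p (y + u * z) > 0"
      proof (rule no_root_same_sign)
        define U where "U = u * z"
        have "\<bar>U\<bar> < z" using u \<delta> assms(1) by (simp add: U_def abs_mult)
        then have uz: "- z < U" "U < z" by (simp_all add: abs_less_iff)
        have nz: "poly p x \<noteq> 0" if "btw (y - z) x (y + z)" for x
          using that less.prems False unfolding noroots_def by (metis funpow_0 degree_0)
        show "poly p y \<noteq> 0" by (rule py)
        show "poly p (y + u * z) \<noteq> 0"
          unfolding U_def[symmetric] using uz by (intro nz) (simp add: btw_def)
        show "poly p x \<noteq> 0" if "btw y x (y + u * z)" for x
          using that[folded U_def] uz assms(1) by (intro nz) (auto simp: btw_def)
      qed
      have "u * b = (if poly p y > 0 then - (\<delta> * \<bar>b\<bar>) else \<delta> * \<bar>b\<bar>)"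
        using b0 py by (auto simp: u_def zero_less_mult_iff abs_if)
      then have "\<delta> * \<bar>b\<bar> / 2 \<le> \<bar>poly p y\<bar>"
        using abs_le_D1[OF exp[OF u]] abs_le_D2[OF exp[OF u]] pos
        by (auto simp: zero_less_mult_iff split: if_splits)
      then have "\<delta> * \<bar>b\<bar> / 2 \<preceq> poly p y" using \<delta> by (intro abs_le_imp_dom) simp
      then have "(4 * (1 + B)) * (\<delta> * \<bar>b\<bar> / 2) \<preceq> 1 * poly p y" by (rule dom_mult[OF B1])
      moreover have "(4 * (1 + B)) * (\<delta> * \<bar>b\<bar> / 2) = \<bar>b\<bar>" using B0 by (simp add: \<delta>_def field_simps)
      ultimately have "\<bar>b\<bar> \<preceq> 1 * poly p y" by (simp only:)
      then show ?thesis by simp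
    qed simp
    then show ?thesis using IH by (cases k) (auto intro: dom_trans)
  qed
qed

lemma w_abs_power: "\<bar>h\<bar> = z \<Longrightarrow> a * h ^ k \<preceq> b \<longleftrightarrow> a * z ^ k \<preceq> b"
proof -
  assume "\<bar>h\<bar> = z"
  then have "\<bar>a * h ^ k\<bar> = \<bar>a * z ^ k\<bar>" by (auto simp: abs_mult power_abs)
  then show ?thesis by (metis dom_abs_iff(1))
qed

text \<open>Expand the derivative about \<open>y\<close>: each term, scaled by z^j, is one already
  bounded by \<open>deriv_dom\<close>. In the applications y + h is the centre, so bounds pass from
  \<open>y\<close> to the centre.\<close>

lemma expansion_upper:
  assumes "\<bar>h\<bar> = z" "z > 0" "noroots p (y - z) (y + z)"
  shows "poly ((pderiv ^^ j) p) (y + h) * z ^ j \<preceq> poly p y"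
proof -
  have "poly ((pderiv ^^ j) p) (y + h) * z ^ j =
      (\<Sum>k\<le>Polynomial.degree ((pderiv ^^ j) p). poly ((pderiv ^^ (k + j)) p) y / fact k * h ^ k * z ^ j)"
    unfolding poly_taylor by (simp add: sum_distrib_right funpow_add)
  also have "\<dots> \<preceq> poly p y"
  proof (rule dom_sum)
    fix k
    have *: "poly ((pderiv ^^ (k + j)) p) y * z ^ (k + j) \<preceq> poly p y"
      by (rule deriv_dom[OF assms(2,3)])
    have "(poly ((pderiv ^^ (k + j)) p) y * z ^ j) * h ^ k \<preceq> poly p y"
      unfolding w_abs_power[OF assms(1)] using * by (simp add: power_add mult_ac)
    then have "(poly ((pderiv ^^ (k + j)) p) y * z ^ j) * h ^ k / fact k \<preceq> poly p y"
      by (simp only: dom_divide_fact)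
    then show "poly ((pderiv ^^ (k + j)) p) y / fact k * h ^ k * z ^ j \<preceq> poly p y"
      by (simp add: mult_ac)
  qed
  finally show ?thesis .
qed

text \<open>By the ultrametric inequality a nonzero sum is dominated by one of its nonzero terms;
  with \<open>expansion_upper\<close> this yields the exact maximum.\<close>

lemma expansion_attained:
  assumes "\<bar>h\<bar> = z" "poly p (c + h) \<noteq> 0"
  shows "\<exists>j\<le>Polynomial.degree p. poly ((pderiv ^^ j) p) c \<noteq> 0 \<and>
    poly p (c + h) \<preceq> poly ((pderiv ^^ j) p) c * z ^ j"
proof -
  have "\<exists>j\<in>{..Polynomial.degree p}. poly ((pderiv ^^ j) p) c / fact j * h ^ j \<noteq> 0 \<and>
      poly p (c + h) \<preceq> poly ((pderiv ^^ j) p) c / fact j * h ^ j"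
    using assms(2) unfolding poly_taylor by (intro dom_sum_ex) auto
  then obtain j where j: "j \<le> Polynomial.degree p" "poly ((pderiv ^^ j) p) c / fact j * h ^ j \<noteq> 0"
      "poly p (c + h) \<preceq> poly ((pderiv ^^ j) p) c / fact j * h ^ j" by auto
  have "poly ((pderiv ^^ j) p) c / fact j * h ^ j = (poly ((pderiv ^^ j) p) c * h ^ j) / fact j" by simp
  then have "poly p (c + h) \<preceq> poly ((pderiv ^^ j) p) c * h ^ j" using j(3) by (simp only: dom_divide_fact)
  moreover have "poly ((pderiv ^^ j) p) c * h ^ j \<preceq> poly ((pderiv ^^ j) p) c * z ^ j"
    unfolding w_abs_power[OF assms(1)] by simp
  ultimately show ?thesis using j by (auto intro: dom_trans)
qed

text \<open>Very close to \<open>c\<close> the first nonvanishing Taylor term decides the sign, and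
  without a root on the way the sign persists up to c + h.\<close>

lemma sign_expansion:
  fixes p :: "'k poly"
  assumes "\<And>x. btw c x (c + h) \<Longrightarrow> poly p x \<noteq> 0" "poly p (c + h) \<noteq> 0"
    and "\<And>j. j < k \<Longrightarrow> poly ((pderiv ^^ j) p) c = 0" "poly ((pderiv ^^ k) p) c \<noteq> 0" "h \<noteq> 0"
  shows "poly p (c + h) * (poly ((pderiv ^^ k) p) c * h ^ k) > 0"
proof -
  define n where "n = Polynomial.degree p"
  define a where "a j = poly ((pderiv ^^ j) p) c / fact j * h ^ j" for j
  have "k \<le> n"
  proof (rule ccontr)
    assume "\<not> k \<le> n"
    then have "k \<noteq> 0" "Polynomial.degree ((pderiv ^^ (k - 1)) p) = 0" by (auto simp: degree_higher_pderiv n_def)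
    then have "(pderiv ^^ k) p = 0" by (cases k) (simp_all add: pderiv_eq_0_iff)
    then show False using assms(4) by simp
  qed
  have ak: "a k \<noteq> 0" using assms(4,5) by (simp add: a_def)
  define B where "B = (\<Sum>j\<in>{k<..n}. \<bar>a j\<bar>)"
  have B0: "B \<ge> 0" unfolding B_def by (rule sum_nonneg) simp
  \<comment> \<open>The bound 1 keeps c + u h on the segment up to c + h; the other bound makes the
    tail, at most u^(k+1) B, smaller than the leading term.\<close>
  define u where "u = min 1 (\<bar>a k\<bar> / (2 * (B + 1)))"
  have u: "0 < u" "u \<le> 1" using ak B0 by (auto simp: u_def)
  have "u * B \<le> \<bar>a k\<bar> / (2 * (B + 1)) * B" using B0 by (intro mult_right_mono) (auto simp: u_def)
  also have "\<dots> < \<bar>a k\<bar>"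
  proof -
    have "\<bar>a k\<bar> * B < \<bar>a k\<bar> * (2 * (B + 1))" using ak B0 by (intro mult_strict_left_mono) auto
    then show ?thesis using B0 by (simp add: field_simps)
  qed
  finally have uB: "u * B < \<bar>a k\<bar>" .
  have "poly p (c + u * h) = (\<Sum>j\<le>n. a j * u ^ j)"
    unfolding poly_taylor n_def[symmetric] a_def by (simp add: power_mult_distrib mult_ac)
  also have "\<dots> = (\<Sum>j\<in>insert k {k<..n}. a j * u ^ j)"
    using \<open>k \<le> n\<close> assms(3) by (intro sum.mono_neutral_right) (auto simp: a_def not_less)
  also have "\<dots> = a k * u ^ k + (\<Sum>j\<in>{k<..n}. a j * u ^ j)" by simp
  finally have eq: "poly p (c + u * h) - a k * u ^ k = (\<Sum>j\<in>{k<..n}. a j * u ^ j)" by simp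
  have "\<bar>\<Sum>j\<in>{k<..n}. a j * u ^ j\<bar> \<le> (\<Sum>j\<in>{k<..n}. \<bar>a j * u ^ j\<bar>)" by (rule sum_abs)
  also have "\<dots> \<le> (\<Sum>j\<in>{k<..n}. \<bar>a j\<bar> * u ^ Suc k)"
  proof (rule sum_mono)
    fix j assume "j \<in> {k<..n}"
    then have "u ^ j \<le> u ^ Suc k" using u by (intro power_decreasing) auto
    then show "\<bar>a j * u ^ j\<bar> \<le> \<bar>a j\<bar> * u ^ Suc k" using u by (simp add: abs_mult mult_left_mono)
  qed
  also have "\<dots> = u ^ k * (u * B)" by (simp add: B_def sum_distrib_left sum_distrib_right mult_ac)
  also have "\<dots> < u ^ k * \<bar>a k\<bar>" using u uB by (intro mult_strict_left_mono) auto
  also have "\<dots> = \<bar>a k * u ^ k\<bar>" using u by (simp add: abs_mult)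
  finally have less: "\<bar>poly p (c + u * h) - a k * u ^ k\<bar> < \<bar>a k * u ^ k\<bar>" unfolding eq .
  have "poly p (c + u * h) * (a k * u ^ k) > 0"
    by (rule abs_diff_less_imp_same_sign[OF less])
  then have 1: "poly p (c + u * h) * a k > 0" using u by (simp add: zero_less_mult_iff mult_less_0_iff)
  have 2: "poly p (c + u * h) * poly p (c + h) > 0"
  proof (cases "u = 1")
    case True
    then show ?thesis using 1 assms(2) by (auto simp: zero_less_mult_iff)
  next
    case False
    then have "u < 1" using u by simp
    have bt: "btw c (c + u * h) (c + h)"
      using \<open>u < 1\<close> u assms(5) by (cases "h > 0") (auto simp: btw_def zero_less_mult_iff mult_less_0_iff)
    show ?thesis
    proof (rule no_root_same_sign)
      show "poly p x \<noteq> 0" if "btw (c + u * h) x (c + h)" for x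
        using that bt by (intro assms(1)) (auto simp: btw_def)
      show "poly p (c + u * h) \<noteq> 0" by (rule assms(1)[OF bt])
    qed (rule assms(2))
  qed
  have "poly p (c + h) * a k > 0" using 1 2 by (auto simp: zero_less_mult_iff)
  then have "poly p (c + h) * a k * fact k > 0" by simp
  moreover have "poly p (c + h) * a k * fact k = poly p (c + h) * (poly ((pderiv ^^ k) p) c * h ^ k)"
    by (simp add: a_def)
  ultimately show ?thesis by simp
qed

section \<open>Definable sets and elimination of value group variables\<close>

text \<open>Quantifier-free definable sets of pairs \<open>(x, g)\<close> in the two-sorted language: \<open>\<Phi>\<close> is the set of
  field-valued functions allowed in atoms, \<open>J\<close> the set of available coordinates of \<open>g\<close>.\<close>

inductive_set lin :: "('x \<Rightarrow> 'k) set \<Rightarrow> nat set \<Rightarrow> ('x \<times> (nat \<Rightarrow> 'g) \<Rightarrow> 'g) set"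
  for \<Phi> J where
  lin_const: "(\<lambda>_. c) \<in> lin \<Phi> J"
| lin_var: "j \<in> J \<Longrightarrow> (\<lambda>\<omega>. snd \<omega> j) \<in> lin \<Phi> J"
| lin_w: "f \<in> \<Phi> \<Longrightarrow> (\<lambda>\<omega>. w (f (fst \<omega>))) \<in> lin \<Phi> J"
| lin_add: "l \<in> lin \<Phi> J \<Longrightarrow> l' \<in> lin \<Phi> J \<Longrightarrow> (\<lambda>\<omega>. l \<omega> + l' \<omega>) \<in> lin \<Phi> J"
| lin_uminus: "l \<in> lin \<Phi> J \<Longrightarrow> (\<lambda>\<omega>. - l \<omega>) \<in> lin \<Phi> J"

inductive_set dfn :: "('x \<Rightarrow> 'k) set \<Rightarrow> nat set \<Rightarrow> ('x \<times> (nat \<Rightarrow> 'g)) set set"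
  for \<Phi> J where
  dfn_pos: "f \<in> \<Phi> \<Longrightarrow> {\<omega>. 0 < f (fst \<omega>)} \<in> dfn \<Phi> J"
| dfn_lin: "l \<in> lin \<Phi> J \<Longrightarrow> {\<omega>. 0 < l \<omega>} \<in> dfn \<Phi> J"
| dfn_compl: "A \<in> dfn \<Phi> J \<Longrightarrow> - A \<in> dfn \<Phi> J"
| dfn_Int: "A \<in> dfn \<Phi> J \<Longrightarrow> B \<in> dfn \<Phi> J \<Longrightarrow> A \<inter> B \<in> dfn \<Phi> J"

lemma lin_diff: "l \<in> lin \<Phi> J \<Longrightarrow> l' \<in> lin \<Phi> J \<Longrightarrow> (\<lambda>\<omega>. l \<omega> - l' \<omega>) \<in> lin \<Phi> J"
  using lin_add[OF _ lin_uminus, of l \<Phi> J l'] by simp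

lemma lin_zmult: "l \<in> lin \<Phi> J \<Longrightarrow> (\<lambda>\<omega>. zmult k (l \<omega>)) \<in> lin \<Phi> J"
proof (induction k rule: int_induct[where k = 0])
  case (step1 i)
  then show ?case using lin_add[of "\<lambda>\<omega>. zmult i (l \<omega>)" \<Phi> J l] by (simp add: zmult_Suc)
next
  case (step2 i)
  then show ?case using lin_diff[of "\<lambda>\<omega>. zmult i (l \<omega>)" \<Phi> J l] by (simp add: zmult_pred)
qed (simp add: lin_const)

lemma dfn_False: "{\<omega>. False} \<in> dfn \<Phi> J"
  using dfn_lin[OF lin_const[of 0]] by simp

lemma dfn_not: "{\<omega>. P \<omega>} \<in> dfn \<Phi> J \<Longrightarrow> {\<omega>. \<not> P \<omega>} \<in> dfn \<Phi> J"
  using dfn_compl[of "{\<omega>. P \<omega>}"] by (simp add: Collect_neg_eq)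

lemma dfn_conj: "{\<omega>. P \<omega>} \<in> dfn \<Phi> J \<Longrightarrow> {\<omega>. Q \<omega>} \<in> dfn \<Phi> J \<Longrightarrow> {\<omega>. P \<omega> \<and> Q \<omega>} \<in> dfn \<Phi> J"
  using dfn_Int[of "{\<omega>. P \<omega>}" \<Phi> J "{\<omega>. Q \<omega>}"] by (simp add: Collect_conj_eq)

lemma dfn_disj: "{\<omega>. P \<omega>} \<in> dfn \<Phi> J \<Longrightarrow> {\<omega>. Q \<omega>} \<in> dfn \<Phi> J \<Longrightarrow> {\<omega>. P \<omega> \<or> Q \<omega>} \<in> dfn \<Phi> J"
  using dfn_not[OF dfn_conj[OF dfn_not dfn_not], of P \<Phi> J Q] by simp

lemma dfn_imp: "{\<omega>. P \<omega>} \<in> dfn \<Phi> J \<Longrightarrow> {\<omega>. Q \<omega>} \<in> dfn \<Phi> J \<Longrightarrow> {\<omega>. P \<omega> \<longrightarrow> Q \<omega>} \<in> dfn \<Phi> J"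
  unfolding imp_conv_disj by (intro dfn_disj dfn_not)

lemma dfn_const: "{\<omega>. c} \<in> dfn \<Phi> J"
proof (cases c)
  case True
  then show ?thesis using dfn_not[OF dfn_False] by (simp only: not_False_eq_True)
next
  case False
  then show ?thesis using dfn_False by (simp only:)
qed

lemma dfn_bex:
  assumes "finite I" "\<And>i. i \<in> I \<Longrightarrow> {\<omega>. P i \<omega>} \<in> dfn \<Phi> J"
  shows "{\<omega>. \<exists>i\<in>I. P i \<omega>} \<in> dfn \<Phi> J"
  using assms
proof (induction I rule: finite_induct)
  case empty
  show ?case using dfn_False by (simp only: ball_simps bex_simps simp_thms)
next
  case (insert i I)
  have "{\<omega>. P i \<omega> \<or> (\<exists>i\<in>I. P i \<omega>)} \<in> dfn \<Phi> J"
    by (intro dfn_disj insert.IH insert.prems) simp_all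
  then show ?case by (simp only: bex_simps)
qed

lemma dfn_ball:
  assumes "finite I" "\<And>i. i \<in> I \<Longrightarrow> {\<omega>. P i \<omega>} \<in> dfn \<Phi> J"
  shows "{\<omega>. \<forall>i\<in>I. P i \<omega>} \<in> dfn \<Phi> J"
proof -
  have "{\<omega>. \<not> (\<exists>i\<in>I. \<not> P i \<omega>)} \<in> dfn \<Phi> J" by (intro dfn_not dfn_bex assms)
  then show ?thesis by (simp only: bex_simps not_not)
qed

lemma dfn_mem: "A \<in> dfn \<Phi> J \<Longrightarrow> {\<omega>. \<omega> \<in> A} \<in> dfn \<Phi> J"
  by simp

lemma dfn_lin_less: "l \<in> lin \<Phi> J \<Longrightarrow> l' \<in> lin \<Phi> J \<Longrightarrow> {\<omega>. l \<omega> < l' \<omega>} \<in> dfn \<Phi> J"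
  using dfn_lin[OF lin_diff[of l' \<Phi> J l]] by simp

lemma dfn_lin_le: "l \<in> lin \<Phi> J \<Longrightarrow> l' \<in> lin \<Phi> J \<Longrightarrow> {\<omega>. l \<omega> \<le> l' \<omega>} \<in> dfn \<Phi> J"
  using dfn_not[OF dfn_lin_less[of l' \<Phi> J l]] by (simp add: not_less)

lemma dfn_lin_eq: "l \<in> lin \<Phi> J \<Longrightarrow> l' \<in> lin \<Phi> J \<Longrightarrow> {\<omega>. l \<omega> = l' \<omega>} \<in> dfn \<Phi> J"
  using dfn_conj[OF dfn_lin_le[of l \<Phi> J l'] dfn_lin_le[of l' \<Phi> J l]] by (simp add: eq_iff)

lemma lin_mono: "l \<in> lin \<Phi> J \<Longrightarrow> \<Phi> \<subseteq> \<Phi>' \<Longrightarrow> J \<subseteq> J' \<Longrightarrow> l \<in> lin \<Phi>' J'"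
  by (induction rule: lin.induct) (auto intro: lin.intros)

lemma dfn_mono: "A \<in> dfn \<Phi> J \<Longrightarrow> \<Phi> \<subseteq> \<Phi>' \<Longrightarrow> J \<subseteq> J' \<Longrightarrow> A \<in> dfn \<Phi>' J'"
  by (induction rule: dfn.induct) (auto intro: dfn.intros lin_mono)

lemma lin_finite_support: "l \<in> lin \<Phi> J \<Longrightarrow> \<exists>\<Psi>. finite \<Psi> \<and> \<Psi> \<subseteq> \<Phi> \<and> l \<in> lin \<Psi> J"
proof (induction rule: lin.induct)
  case (lin_w f)
  then show ?case by (intro exI[of _ "{f}"]) (auto intro: lin.intros)
next
  case (lin_add l l')
  then obtain A B where "finite A" "A \<subseteq> \<Phi>" "l \<in> lin A J" "finite B" "B \<subseteq> \<Phi>" "l' \<in> lin B J" by blast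
  then show ?case
    by (intro exI[of _ "A \<union> B"]) (auto intro!: lin.lin_add intro: lin_mono)
qed (auto intro: lin.intros)

text \<open>Elimination works with the roots of a finite family, so the infinite set
  \<open>\<Phi>\<close> has to be cut down to the functions that occur in atoms.\<close>

lemma dfn_finite_support: "A \<in> dfn \<Phi> J \<Longrightarrow> \<exists>\<Psi>. finite \<Psi> \<and> \<Psi> \<subseteq> \<Phi> \<and> A \<in> dfn \<Psi> J"
proof (induction rule: dfn.induct)
  case (dfn_pos f)
  then show ?case by (intro exI[of _ "{f}"]) (auto intro: dfn.intros)
next
  case (dfn_Int A B)
  then obtain C D where "finite C" "C \<subseteq> \<Phi>" "A \<in> dfn C J" "finite D" "D \<subseteq> \<Phi>" "B \<in> dfn D J" by blast
  then show ?case
    by (intro exI[of _ "C \<union> D"]) (auto intro!: dfn.dfn_Int intro: dfn_mono)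
next
  case (dfn_lin l)
  then show ?case using lin_finite_support by (metis dfn.dfn_lin)
qed (auto intro: dfn.intros)

lemma lin_cong:
  "l \<in> lin \<Phi> J \<Longrightarrow> (\<And>f. f \<in> \<Phi> \<Longrightarrow> w (f x) = w (f x')) \<Longrightarrow> (\<And>j. j \<in> J \<Longrightarrow> g j = g' j) \<Longrightarrow>
    l (x, g) = l (x', g')"
  by (induction rule: lin.induct) auto

lemma dfn_cong:
  "A \<in> dfn \<Phi> J \<Longrightarrow> (\<And>f. f \<in> \<Phi> \<Longrightarrow> (0 < f x \<longleftrightarrow> 0 < f x') \<and> w (f x) = w (f x')) \<Longrightarrow>
    (\<And>j. j \<in> J \<Longrightarrow> g j = g' j) \<Longrightarrow> (x, g) \<in> A \<longleftrightarrow> (x', g') \<in> A"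
proof (induction rule: dfn.induct)
  case (dfn_lin l)
  then show ?case using lin_cong[of l \<Phi> J x x' g g'] by auto
qed auto

text \<open>Definability relative to \<open>Z\<close>, where \<open>Z\<close> itself may be an arbitrary set.\<close>

definition dfn_on :: "('x \<Rightarrow> 'k) set \<Rightarrow> nat set \<Rightarrow> ('x \<times> (nat \<Rightarrow> 'g)) set \<Rightarrow> ('x \<times> (nat \<Rightarrow> 'g) \<Rightarrow> bool) \<Rightarrow> bool"
  where "dfn_on \<Phi> J Z P \<longleftrightarrow> (\<exists>B\<in>dfn \<Phi> J. \<forall>\<omega>\<in>Z. P \<omega> \<longleftrightarrow> \<omega> \<in> B)"

lemma dfn_onI: "{\<omega>. Q \<omega>} \<in> dfn \<Phi> J \<Longrightarrow> (\<And>\<omega>. \<omega> \<in> Z \<Longrightarrow> P \<omega> \<longleftrightarrow> Q \<omega>) \<Longrightarrow> dfn_on \<Phi> J Z P"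
  unfolding dfn_on_def by (rule bexI[of _ "{\<omega>. Q \<omega>}"]) auto

lemma dfn_on_imp_dfn: "dfn_on \<Phi> J Z P \<Longrightarrow> Z \<in> dfn \<Phi> J \<Longrightarrow> {\<omega> \<in> Z. P \<omega>} \<in> dfn \<Phi> J"
proof -
  assume "dfn_on \<Phi> J Z P" "Z \<in> dfn \<Phi> J"
  then obtain B where "B \<in> dfn \<Phi> J" "{\<omega> \<in> Z. P \<omega>} = Z \<inter> B" by (auto simp: dfn_on_def)
  then show ?thesis using \<open>Z \<in> dfn \<Phi> J\<close> by (simp add: dfn_Int)
qed

text \<open>Piecewise linear with rational coefficients: forms in \<open>lin\<close> have integer
  coefficients, so each piece carries its own denominator \<open>n\<close>. Denominators arise when
  a bound is solved for the eliminated variable.\<close>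

definition plin :: "('x \<Rightarrow> 'k) set \<Rightarrow> nat set \<Rightarrow> ('x \<times> (nat \<Rightarrow> 'g)) set \<Rightarrow> ('x \<times> (nat \<Rightarrow> 'g) \<Rightarrow> 'g) \<Rightarrow> bool"
  where "plin \<Phi> J Z u \<longleftrightarrow> (\<exists>\<C>. finite \<C> \<and> \<C> \<subseteq> dfn \<Phi> J \<and> Z \<subseteq> \<Union>\<C> \<and>
    (\<forall>C\<in>\<C>. \<exists>n>0. \<exists>l\<in>lin \<Phi> J. \<forall>\<omega>\<in>C \<inter> Z. zmult n (u \<omega>) = l \<omega>))"

lemma plin_scaled:
  assumes "n > 0" "(\<lambda>\<omega>. zmult n (u \<omega>)) \<in> lin \<Phi> J"
  shows "plin \<Phi> J Z u"
  unfolding plin_def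
proof (intro exI[of _ "{UNIV}"] conjI ballI)
  show "{UNIV} \<subseteq> dfn \<Phi> J" using dfn_const[of True \<Phi> J] by simp
  show "\<exists>n>0. \<exists>l\<in>lin \<Phi> J. \<forall>\<omega>\<in>C \<inter> Z. zmult n (u \<omega>) = l \<omega>" for C
    by (rule exI[of _ n], rule conjI[OF assms(1)], rule bexI[OF _ assms(2)]) simp
qed simp_all

lemma plin_lin: "l \<in> lin \<Phi> J \<Longrightarrow> plin \<Phi> J Z l"
  by (rule plin_scaled[of 1]) (simp_all only: zmult_1 zero_less_one)

lemma plin_uminus: "plin \<Phi> J Z u \<Longrightarrow> plin \<Phi> J Z (\<lambda>\<omega>. - u \<omega>)"
  unfolding plin_def
proof (elim exE conjE, intro exI conjI)
  fix \<C> assume *: "\<forall>C\<in>\<C>. \<exists>n>0. \<exists>l\<in>lin \<Phi> J. \<forall>\<omega>\<in>C \<inter> Z. zmult n (u \<omega>) = l \<omega>"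
  show "\<forall>C\<in>\<C>. \<exists>n>0. \<exists>l\<in>lin \<Phi> J. \<forall>\<omega>\<in>C \<inter> Z. zmult n (- u \<omega>) = l \<omega>"
  proof
    fix C assume "C \<in> \<C>"
    then obtain n l where "n > 0" "l \<in> lin \<Phi> J" "\<forall>\<omega>\<in>C \<inter> Z. zmult n (u \<omega>) = l \<omega>" using * by blast
    then show "\<exists>n>0. \<exists>l\<in>lin \<Phi> J. \<forall>\<omega>\<in>C \<inter> Z. zmult n (- u \<omega>) = l \<omega>"
      by (intro exI[of _ n] conjI bexI[OF _ lin_uminus[of l]]) auto
  qed
qed

lemma plin_add:
  assumes "plin \<Phi> J Z u" "plin \<Phi> J Z v"
  shows "plin \<Phi> J Z (\<lambda>\<omega>. u \<omega> + v \<omega>)"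
proof -
  obtain \<C> where C: "finite \<C>" "\<C> \<subseteq> dfn \<Phi> J" "Z \<subseteq> \<Union>\<C>"
    "\<And>C. C \<in> \<C> \<Longrightarrow> \<exists>n>0. \<exists>l\<in>lin \<Phi> J. \<forall>\<omega>\<in>C \<inter> Z. zmult n (u \<omega>) = l \<omega>"
    using assms(1) unfolding plin_def by blast
  obtain \<D> where D: "finite \<D>" "\<D> \<subseteq> dfn \<Phi> J" "Z \<subseteq> \<Union>\<D>"
    "\<And>C. C \<in> \<D> \<Longrightarrow> \<exists>n>0. \<exists>l\<in>lin \<Phi> J. \<forall>\<omega>\<in>C \<inter> Z. zmult n (v \<omega>) = l \<omega>"
    using assms(2) unfolding plin_def by blast
  define \<E> where "\<E> = (\<lambda>(C, D). C \<inter> D) ` (\<C> \<times> \<D>)"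
  have "\<exists>n>0. \<exists>l\<in>lin \<Phi> J. \<forall>\<omega>\<in>E \<inter> Z. zmult n (u \<omega> + v \<omega>) = l \<omega>" if E0: "E \<in> \<E>" for E
  proof -
    obtain C D where E: "E = C \<inter> D" "C \<in> \<C>" "D \<in> \<D>" using E0 by (auto simp: \<E>_def)
    obtain n l where n: "n > 0" "l \<in> lin \<Phi> J" "\<forall>\<omega>\<in>C \<inter> Z. zmult n (u \<omega>) = l \<omega>"
      using C(4)[OF E(2)] by blast
    obtain m k where m: "m > 0" "k \<in> lin \<Phi> J" "\<forall>\<omega>\<in>D \<inter> Z. zmult m (v \<omega>) = k \<omega>"
      using D(4)[OF E(3)] by blast
    have "zmult (n * m) (u \<omega> + v \<omega>) = zmult m (l \<omega>) + zmult n (k \<omega>)" if "\<omega> \<in> E \<inter> Z" for \<omega>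
    proof -
      have "zmult (n * m) (u \<omega> + v \<omega>) = zmult (m * n) (u \<omega>) + zmult (n * m) (v \<omega>)"
        by (simp add: zmult_add_right mult.commute)
      then show ?thesis using that E(1) n(3) m(3) by (simp add: zmult_mult)
    qed
    moreover have "(\<lambda>\<omega>. zmult m (l \<omega>) + zmult n (k \<omega>)) \<in> lin \<Phi> J"
      using n(2) m(2) by (intro lin_add lin_zmult)
    moreover have "n * m > 0" using n(1) m(1) by simp
    ultimately show ?thesis
      by (intro exI[of _ "n * m"] conjI bexI[of _ "\<lambda>\<omega>. zmult m (l \<omega>) + zmult n (k \<omega>)"] ballI)
  qed
  moreover have "finite \<E>" using C(1) D(1) by (simp add: \<E>_def)
  moreover have "\<E> \<subseteq> dfn \<Phi> J" using C(2) D(2) dfn_Int unfolding \<E>_def by fast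
  moreover have "Z \<subseteq> \<Union>\<E>"
  proof
    fix \<omega> assume "\<omega> \<in> Z"
    then obtain C D where "C \<in> \<C>" "\<omega> \<in> C" "D \<in> \<D>" "\<omega> \<in> D" using C(3) D(3) by blast
    then show "\<omega> \<in> \<Union>\<E>" unfolding \<E>_def by (intro UnionI[of "C \<inter> D"]) auto
  qed
  ultimately show ?thesis unfolding plin_def by blast
qed

lemma dfn_on_plin_pos:
  assumes "plin \<Phi> J Z u"
  shows "dfn_on \<Phi> J Z (\<lambda>\<omega>. 0 < u \<omega>)"
proof -
  obtain \<C> where C: "finite \<C>" "\<C> \<subseteq> dfn \<Phi> J" "Z \<subseteq> \<Union>\<C>"
    "\<And>C. C \<in> \<C> \<Longrightarrow> \<exists>n>0. \<exists>l\<in>lin \<Phi> J. \<forall>\<omega>\<in>C \<inter> Z. zmult n (u \<omega>) = l \<omega>"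
    using assms unfolding plin_def by blast
  have "\<exists>l\<in>lin \<Phi> J. \<forall>\<omega>\<in>C \<inter> Z. 0 < u \<omega> \<longleftrightarrow> 0 < l \<omega>" if "C \<in> \<C>" for C
    using C(4)[OF that] zmult_pos_iff by metis
  then obtain l where l: "l C \<in> lin \<Phi> J" "\<forall>\<omega>\<in>C \<inter> Z. 0 < u \<omega> \<longleftrightarrow> 0 < l C \<omega>" if "C \<in> \<C>" for C
    by metis
  show ?thesis
  proof (rule dfn_onI)
    show "{\<omega>. \<exists>C\<in>\<C>. \<omega> \<in> C \<and> 0 < l C \<omega>} \<in> dfn \<Phi> J"
      using C(1,2) l(1) by (intro dfn_bex dfn_conj dfn_mem dfn_lin) auto
    show "0 < u \<omega> \<longleftrightarrow> (\<exists>C\<in>\<C>. \<omega> \<in> C \<and> 0 < l C \<omega>)" if "\<omega> \<in> Z" for \<omega>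
      using that C(3) l(2) by blast
  qed
qed

lemma lin_subst:
  assumes "l \<in> lin \<Phi> J"
    and "\<And>f. f \<in> \<Phi> \<Longrightarrow> plin \<Phi>' J' Z (\<lambda>\<omega>. w (f (fst (\<theta> \<omega>))))"
    and "\<And>j. j \<in> J \<Longrightarrow> plin \<Phi>' J' Z (\<lambda>\<omega>. snd (\<theta> \<omega>) j)"
  shows "plin \<Phi>' J' Z (\<lambda>\<omega>. l (\<theta> \<omega>))"
  using assms(1)
proof (induction rule: lin.induct)
  case (lin_const c)
  show ?case by (rule plin_lin[OF lin.lin_const])
next
  case (lin_add l l')
  then show ?case by (rule_tac plin_add)
next
  case (lin_uminus l)
  then show ?case by (rule_tac plin_uminus)
qed (auto intro: assms)

text \<open>Each elimination below is a substitution followed by this lemma, which reduces it to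
  describing signs and valuations of single functions.\<close>

lemma dfn_subst:
  assumes "A \<in> dfn \<Phi> J"
    and "\<And>f. f \<in> \<Phi> \<Longrightarrow> dfn_on \<Phi>' J' Z (\<lambda>\<omega>. 0 < f (fst (\<theta> \<omega>)))"
    and "\<And>f. f \<in> \<Phi> \<Longrightarrow> plin \<Phi>' J' Z (\<lambda>\<omega>. w (f (fst (\<theta> \<omega>))))"
    and "\<And>j. j \<in> J \<Longrightarrow> plin \<Phi>' J' Z (\<lambda>\<omega>. snd (\<theta> \<omega>) j)"
  shows "dfn_on \<Phi>' J' Z (\<lambda>\<omega>. \<theta> \<omega> \<in> A)"
  using assms(1)
proof (induction rule: dfn.induct)
  case (dfn_pos f)
  then show ?case using assms(2) by simp
next
  case (dfn_lin l)
  then show ?case using dfn_on_plin_pos[OF lin_subst[OF _ assms(3,4)]] by simp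
next
  case (dfn_compl A)
  then obtain B where "B \<in> dfn \<Phi>' J'" "\<forall>\<omega>\<in>Z. \<theta> \<omega> \<in> A \<longleftrightarrow> \<omega> \<in> B" by (auto simp: dfn_on_def)
  then show ?case unfolding dfn_on_def by (intro bexI[of _ "- B"]) (auto intro: dfn.intros)
next
  case (dfn_Int A B)
  then obtain C D where "C \<in> dfn \<Phi>' J'" "\<forall>\<omega>\<in>Z. \<theta> \<omega> \<in> A \<longleftrightarrow> \<omega> \<in> C"
    "D \<in> dfn \<Phi>' J'" "\<forall>\<omega>\<in>Z. \<theta> \<omega> \<in> B \<longleftrightarrow> \<omega> \<in> D" by (auto simp: dfn_on_def)
  then show ?case unfolding dfn_on_def by (intro bexI[of _ "C \<inter> D"]) (auto intro: dfn.intros)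
qed

section \<open>Elimination of a value group variable\<close>

lemma lin_split:
  "l \<in> lin \<Phi> (insert N J) \<Longrightarrow> \<exists>k. \<exists>l'\<in>lin \<Phi> J. \<forall>x g t. l (x, g(N := t)) = zmult k t + l' (x, g)"
proof (induction rule: lin.induct)
  case (lin_const c)
  then show ?case by (intro exI[of _ 0] bexI[OF _ lin.lin_const[of c]]) simp
next
  case (lin_var j)
  show ?case
  proof (cases "j = N")
    case True
    then show ?thesis by (intro exI[of _ 1] bexI[OF _ lin.lin_const[of 0]]) simp
  next
    case False
    then show ?thesis using lin_var by (intro exI[of _ 0] bexI[OF _ lin.lin_var[of j]]) auto
  qed
next
  case (lin_w f)
  then show ?case by (intro exI[of _ 0] bexI[OF _ lin.lin_w[of f]]) auto
next
  case (lin_add l l')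
  then obtain k m k' m' where *: "m \<in> lin \<Phi> J" "m' \<in> lin \<Phi> J"
    "\<forall>x g t. l (x, g(N := t)) = zmult k t + m (x, g)" "\<forall>x g t. l' (x, g(N := t)) = zmult k' t + m' (x, g)"
    by blast
  show ?case
    by (rule exI[of _ "k + k'"], rule bexI[OF _ lin.lin_add[OF *(1,2)]], intro allI)
       (simp only: * zmult_add_left ac_simps)
next
  case (lin_uminus l)
  then obtain k m where *: "m \<in> lin \<Phi> J" "\<forall>x g t. l (x, g(N := t)) = zmult k t + m (x, g)" by blast
  show ?case
    by (rule exI[of _ "- k"], rule bexI[OF _ lin.lin_uminus[OF *(1)]], intro allI)
       (simp only: * zmult_minus_left minus_add_distrib)
qed

text \<open>Linear functions with rational coefficients; the solutions of k t + l' = 0 for t are of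
  this kind.\<close>

definition scaled :: "('x \<Rightarrow> 'k) set \<Rightarrow> nat set \<Rightarrow> ('x \<times> (nat \<Rightarrow> 'g) \<Rightarrow> 'g) set"
  where "scaled \<Phi> J = {\<tau>. \<exists>n>0. (\<lambda>\<omega>. zmult n (\<tau> \<omega>)) \<in> lin \<Phi> J}"

definition same_cut :: "'a::ord set \<Rightarrow> 'a \<Rightarrow> 'a \<Rightarrow> bool"
  where "same_cut S t t' \<longleftrightarrow> (\<forall>s\<in>S. (t < s \<longleftrightarrow> t' < s) \<and> (s < t \<longleftrightarrow> s < t'))"

text \<open>An atom in which t occurs reads 0 < k t + l', and its truth changes only at -l' / k.
  Boolean combinations inherit the union of the breakpoints.\<close>

lemma dfn_breakpoints:
  "A \<in> dfn \<Phi> (insert N J) \<Longrightarrow> \<exists>T. finite T \<and> T \<subseteq> scaled \<Phi> J \<and>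
    (\<forall>x g t t'. same_cut ((\<lambda>\<tau>. \<tau> (x, g)) ` T) t t' \<longrightarrow> ((x, g(N := t)) \<in> A \<longleftrightarrow> (x, g(N := t')) \<in> A))"
proof (induction rule: dfn.induct)
  case (dfn_pos f)
  then show ?case by (intro exI[of _ "{}"]) auto
next
  case (dfn_lin l)
  then obtain k l' where l': "l' \<in> lin \<Phi> J" and l: "\<And>x g t. l (x, g(N := t)) = zmult k t + l' (x, g)"
    using lin_split by blast
  show ?case
  proof (cases "k = 0")
    case True
    then have "(x, g(N := t)) \<in> {\<omega>. 0 < l \<omega>} \<longleftrightarrow> 0 < l' (x, g)" for x g t
      by (simp only: mem_Collect_eq l zmult_0 add_0)
    then show ?thesis
      by (intro exI[of _ "{}"] conjI allI impI) (simp_all only: finite.emptyI empty_subsetI)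
  next
    case False
    then have "nat \<bar>k\<bar> > 0" by simp
    then have "\<forall>\<omega>. \<exists>h. zmult (int (nat \<bar>k\<bar>)) h = (if k > 0 then - l' \<omega> else l' \<omega>)"
      using divisible by blast
    from choice[OF this] obtain \<tau> where \<tau>0:
      "\<forall>\<omega>. zmult (int (nat \<bar>k\<bar>)) (\<tau> \<omega>) = (if k > 0 then - l' \<omega> else l' \<omega>)" by blast
    have \<tau>: "zmult \<bar>k\<bar> (\<tau> \<omega>) = (if k > 0 then - l' \<omega> else l' \<omega>)" for \<omega>
      using \<tau>0[THEN spec, of \<omega>] by simp
    have "(\<lambda>\<omega>. zmult \<bar>k\<bar> (\<tau> \<omega>)) \<in> lin \<Phi> J"
      unfolding \<tau> using l' by (cases "k > 0") (auto intro: lin_uminus)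
    then have "\<tau> \<in> scaled \<Phi> J" using False unfolding scaled_def by (intro CollectI exI[of _ "\<bar>k\<bar>"]) simp
    moreover have "0 < l (x, g(N := t)) \<longleftrightarrow> (if k > 0 then \<tau> (x, g) < t else t < \<tau> (x, g))" for x g t
    proof (cases "k > 0")
      case True
      then have "l' (x, g) = - zmult k (\<tau> (x, g))" using \<tau>[of "(x, g)"] by simp
      then show ?thesis using True zmult_less_iff[OF True] by (simp only: l) simp
    next
      case 2: False
      then have "k = - \<bar>k\<bar>" "\<bar>k\<bar> > 0" using False by auto
      have "l (x, g(N := t)) = zmult \<bar>k\<bar> (\<tau> (x, g)) - zmult \<bar>k\<bar> t"
        using 2 \<tau>[of "(x, g)"] by (subst \<open>k = - \<bar>k\<bar>\<close>, subst l) (simp add: \<open>k = - \<bar>k\<bar>\<close>[symmetric])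
      then show ?thesis using 2 zmult_less_iff[OF \<open>\<bar>k\<bar> > 0\<close>] by simp
    qed
    ultimately have "\<tau> \<in> scaled \<Phi> J"
      "\<And>x g t. (x, g(N := t)) \<in> {\<omega>. 0 < l \<omega>} \<longleftrightarrow> (if k > 0 then \<tau> (x, g) < t else t < \<tau> (x, g))"
      by (simp_all only: mem_Collect_eq)
    then show ?thesis
      by (intro exI[of _ "{\<tau>}"]) (simp only: same_cut_def image_insert image_empty, simp)
  qed
next
  case (dfn_Int A B)
  from dfn_Int.IH(1) obtain T where T: "finite T" "T \<subseteq> scaled \<Phi> J"
    "\<forall>x g t t'. same_cut ((\<lambda>\<tau>. \<tau> (x, g)) ` T) t t' \<longrightarrow> ((x, g(N := t)) \<in> A \<longleftrightarrow> (x, g(N := t')) \<in> A)"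
    by (elim exE conjE)
  from dfn_Int.IH(2) obtain U where U: "finite U" "U \<subseteq> scaled \<Phi> J"
    "\<forall>x g t t'. same_cut ((\<lambda>\<tau>. \<tau> (x, g)) ` U) t t' \<longrightarrow> ((x, g(N := t)) \<in> B \<longleftrightarrow> (x, g(N := t')) \<in> B)"
    by (elim exE conjE)
  show ?case
  proof (intro exI[of _ "T \<union> U"] conjI allI impI)
    fix x g t t' assume "same_cut ((\<lambda>\<tau>. \<tau> (x, g)) ` (T \<union> U)) t t'"
    then have "same_cut ((\<lambda>\<tau>. \<tau> (x, g)) ` T) t t'" "same_cut ((\<lambda>\<tau>. \<tau> (x, g)) ` U) t t'"
      by (simp_all add: same_cut_def)
    then show "(x, g(N := t)) \<in> A \<inter> B \<longleftrightarrow> (x, g(N := t')) \<in> A \<inter> B" using T(3) U(3) by blast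
  qed (use T U in auto)
qed auto

lemma ex_pos_gamma: "\<exists>e::'g. e > 0"
proof -
  obtain g :: 'g where "g \<noteq> 0" using nontriv unfolding nontrivial_valuation_def by blast
  then have "g > 0 \<or> - g > 0" by (cases "g > 0") auto
  then show ?thesis by blast
qed

text \<open>Sample points: the breakpoints, the midpoints between them, and their translates by \<open>e\<close>.\<close>

lemma ex_sample_function:
  fixes T :: "('a \<times> (nat \<Rightarrow> 'g) \<Rightarrow> 'g) set"
  assumes "finite T" "T \<subseteq> scaled \<Phi> J"
  shows "\<exists>T'. finite T' \<and> T' \<subseteq> scaled \<Phi> J \<and>
    (\<forall>\<omega> t. \<exists>\<sigma>\<in>T'. same_cut ((\<lambda>\<tau>. \<tau> \<omega>) ` T) t (\<sigma> \<omega>))"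
proof -
  obtain e :: 'g where e: "e > 0" using ex_pos_gamma by blast
  obtain half :: "'g \<Rightarrow> 'g" where half: "zmult 2 (half g) = g" for g
    using divisible[of 2] by (metis of_nat_numeral zero_less_numeral)
  define mid where "mid \<sigma> \<tau> \<omega> = half (\<sigma> \<omega> + \<tau> \<omega>)" for \<sigma> \<tau> :: "'a \<times> (nat \<Rightarrow> 'g) \<Rightarrow> 'g" and \<omega>
  have mid: "zmult 2 (mid \<sigma> \<tau> \<omega>) = \<sigma> \<omega> + \<tau> \<omega>" for \<sigma> \<tau> \<omega>
    by (simp add: mid_def half)
  \<comment> \<open>The translates serve beyond the extreme breakpoints, where a positive
    \<open>e\<close> exists by nontriviality; the constant 0 serves when \<open>T\<close> is
    empty.\<close>
  define T' where "T' = T \<union> {\<lambda>_. 0} \<union> (\<lambda>(\<sigma>, \<tau>). mid \<sigma> \<tau>) ` (T \<times> T)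
    \<union> (\<lambda>\<sigma> \<omega>. \<sigma> \<omega> + e) ` T \<union> (\<lambda>\<sigma> \<omega>. \<sigma> \<omega> - e) ` T"
  have "finite T'" using assms(1) by (simp add: T'_def)
  moreover have "T' \<subseteq> scaled \<Phi> J"
  proof -
    have "mid \<sigma> \<tau> \<in> scaled \<Phi> J" if st: "\<sigma> \<in> T" "\<tau> \<in> T" for \<sigma> \<tau>
    proof -
      obtain n m where n: "n > 0" "(\<lambda>\<omega>. zmult n (\<sigma> \<omega>)) \<in> lin \<Phi> J"
        and m: "m > 0" "(\<lambda>\<omega>. zmult m (\<tau> \<omega>)) \<in> lin \<Phi> J"
        using st assms(2) unfolding scaled_def by blast
      have "zmult (n * m * 2) (mid \<sigma> \<tau> \<omega>) = zmult m (zmult n (\<sigma> \<omega>)) + zmult n (zmult m (\<tau> \<omega>))" for \<omega>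
        unfolding zmult_mult[of "n * m" 2] mid zmult_add_right zmult_mult[symmetric]
        by (simp add: mult.commute)
      then have "(\<lambda>\<omega>. zmult (n * m * 2) (mid \<sigma> \<tau> \<omega>)) \<in> lin \<Phi> J"
        using lin_add[OF lin_zmult[OF n(2)] lin_zmult[OF m(2)]] by simp
      then show ?thesis unfolding scaled_def using n(1) m(1) by (intro CollectI exI[of _ "n * m * 2"]) simp
    qed
    moreover have "(\<lambda>\<omega>. \<sigma> \<omega> + c) \<in> scaled \<Phi> J" if st: "\<sigma> \<in> T" for \<sigma> c
    proof -
      obtain n where n: "n > 0" "(\<lambda>\<omega>. zmult n (\<sigma> \<omega>)) \<in> lin \<Phi> J"
        using st assms(2) unfolding scaled_def by blast
      have "(\<lambda>\<omega>. zmult n (\<sigma> \<omega> + c)) \<in> lin \<Phi> J"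
        using lin_add[OF n(2) lin_const[of "zmult n c"]] by (simp add: zmult_add_right)
      then show ?thesis unfolding scaled_def using n(1) by blast
    qed
    from this[of _ e] this[of _ "- e"]
    have "(\<lambda>\<omega>. \<sigma> \<omega> + e) \<in> scaled \<Phi> J" "(\<lambda>\<omega>. \<sigma> \<omega> - e) \<in> scaled \<Phi> J" if "\<sigma> \<in> T" for \<sigma>
      using that by simp_all
    moreover have "(\<lambda>_. 0) \<in> scaled \<Phi> J"
      unfolding scaled_def by (intro CollectI exI[of _ 1]) (simp add: lin_const)
    ultimately show ?thesis using assms(2) unfolding T'_def by auto
  qed
  moreover have "\<exists>\<sigma>\<in>T'. same_cut ((\<lambda>\<tau>. \<tau> \<omega>) ` T) t (\<sigma> \<omega>)" for \<omega> t
  proof (cases "\<exists>\<tau>\<in>T. \<tau> \<omega> = t")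
    case True
    then show ?thesis unfolding T'_def same_cut_def by blast
  next
    case False
    define L U where "L = {s \<in> (\<lambda>\<tau>. \<tau> \<omega>) ` T. s < t}" and "U = {s \<in> (\<lambda>\<tau>. \<tau> \<omega>) ` T. t < s}"
    have fin: "finite L" "finite U" using assms(1) by (simp_all add: L_def U_def)
    have LU: "(\<lambda>\<tau>. \<tau> \<omega>) ` T = L \<union> U" using False by (auto simp: L_def U_def)
    have less: "s < t" if "s \<in> L" for s using that by (simp add: L_def)
    have gr: "t < s" if "s \<in> U" for s using that by (simp add: U_def)
    have cutI: "same_cut ((\<lambda>\<tau>. \<tau> \<omega>) ` T) t t'" if "\<forall>s\<in>L. s < t'" "\<forall>s\<in>U. t' < s" for t'
    proof -
      have "(t < s \<longleftrightarrow> t' < s) \<and> (s < t \<longleftrightarrow> s < t')" if "s \<in> L \<union> U" for s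
        using that
      proof
        assume "s \<in> L"
        then have "s < t" "s < t'" using less \<open>\<forall>s\<in>L. s < t'\<close> by blast+
        then show ?thesis by (auto dest: less_asym)
      next
        assume "s \<in> U"
        then have "t < s" "t' < s" using gr \<open>\<forall>s\<in>U. t' < s\<close> by blast+
        then show ?thesis by (auto dest: less_asym)
      qed
      then show ?thesis unfolding LU same_cut_def by blast
    qed
    have maxL: "\<exists>\<tau>\<in>T. \<tau> \<omega> = Max L \<and> (\<forall>s\<in>L. s \<le> \<tau> \<omega>)" if "L \<noteq> {}"
      using Max_in[OF fin(1) that] Max_ge[OF fin(1)] by (auto simp: L_def)
    have minU: "\<exists>\<tau>\<in>T. \<tau> \<omega> = Min U \<and> (\<forall>s\<in>U. \<tau> \<omega> \<le> s)" if "U \<noteq> {}"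
      using Min_in[OF fin(2) that] Min_le[OF fin(2)] by (auto simp: U_def)
    consider "L = {}" "U = {}" | "L \<noteq> {}" "U = {}" | "L = {}" "U \<noteq> {}" | "L \<noteq> {}" "U \<noteq> {}" by blast
    then show ?thesis
    proof cases
      case 1
      then show ?thesis using cutI[of 0] by (intro bexI[of _ "\<lambda>_. 0"]) (auto simp: T'_def)
    next
      case 2
      then obtain \<tau> where "\<tau> \<in> T" "\<forall>s\<in>L. s \<le> \<tau> \<omega>" using maxL by blast
      then show ?thesis using 2 e
        by (intro bexI[of _ "\<lambda>\<omega>. \<tau> \<omega> + e"] cutI) (auto simp: T'_def less_add_same_cancel1 intro: le_less_trans)
    next
      case 3
      then obtain \<tau> where "\<tau> \<in> T" "\<forall>s\<in>U. \<tau> \<omega> \<le> s" using minU by blast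
      then show ?thesis using 3 e
        by (intro bexI[of _ "\<lambda>\<omega>. \<tau> \<omega> - e"] cutI) (auto simp: T'_def diff_less_eq intro: le_less_trans add_strict_increasing2 order.strict_trans1)
    next
      case 4
      obtain \<sigma> where \<sigma>: "\<sigma> \<in> T" "\<sigma> \<omega> = Max L" "\<forall>s\<in>L. s \<le> \<sigma> \<omega>" using maxL[OF 4(1)] by blast
      obtain \<tau> where \<tau>: "\<tau> \<in> T" "\<tau> \<omega> = Min U" "\<forall>s\<in>U. \<tau> \<omega> \<le> s" using minU[OF 4(2)] by blast
      have st: "\<sigma> \<omega> < \<tau> \<omega>"
        using less[OF Max_in[OF fin(1)]] gr[OF Min_in[OF fin(2)]] 4 \<sigma>(2) \<tau>(2) by simp
      have z2: "zmult 2 g = g + g" for g :: 'g using zmult_add_left[of 1 1 g] by simp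
      have "zmult 2 (\<sigma> \<omega>) < \<sigma> \<omega> + \<tau> \<omega>" "\<sigma> \<omega> + \<tau> \<omega> < zmult 2 (\<tau> \<omega>)"
        unfolding z2 using st by simp_all
      then have "\<sigma> \<omega> < mid \<sigma> \<tau> \<omega>" "mid \<sigma> \<tau> \<omega> < \<tau> \<omega>"
        unfolding mid[symmetric] by (simp_all add: zmult_less_iff)
      then have "\<forall>s\<in>L. s < mid \<sigma> \<tau> \<omega>" "\<forall>s\<in>U. mid \<sigma> \<tau> \<omega> < s"
        using \<sigma>(3) \<tau>(3) by (meson le_less_trans less_le_trans)+
      then have "same_cut ((\<lambda>\<tau>. \<tau> \<omega>) ` T) t (mid \<sigma> \<tau> \<omega>)" by (rule cutI)
      moreover have "mid \<sigma> \<tau> \<in> T'" using \<sigma>(1) \<tau>(1) unfolding T'_def by blast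
      ultimately show ?thesis by blast
    qed
  qed
  ultimately show ?thesis by (intro exI[of _ T'] conjI allI)
qed

text \<open>Every t shares its cut with one of finitely many sample functions, so the quantifier
  becomes a finite disjunction of substitutions.\<close>

lemma dfn_elim_gamma:
  assumes "A \<in> dfn \<Phi> (insert N J)"
  shows "{(x, g). \<exists>t. (x, g(N := t)) \<in> A} \<in> dfn \<Phi> J"
proof -
  obtain T where T: "finite T" "T \<subseteq> scaled \<Phi> J"
    "\<And>x g t t'. same_cut ((\<lambda>\<tau>. \<tau> (x, g)) ` T) t t' \<Longrightarrow> ((x, g(N := t)) \<in> A \<longleftrightarrow> (x, g(N := t')) \<in> A)"
    using dfn_breakpoints[OF assms] by blast
  obtain T' where T': "finite T'" "T' \<subseteq> scaled \<Phi> J"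
    "\<And>\<omega> t. \<exists>\<sigma>\<in>T'. same_cut ((\<lambda>\<tau>. \<tau> \<omega>) ` T) t (\<sigma> \<omega>)"
    using ex_sample_function[OF T(1,2)] by blast
  have "{\<omega>. (fst \<omega>, (snd \<omega>)(N := \<sigma> \<omega>)) \<in> A} \<in> dfn \<Phi> J" if st: "\<sigma> \<in> T'" for \<sigma>
  proof -
    obtain n where n: "n > 0" "(\<lambda>\<omega>. zmult n (\<sigma> \<omega>)) \<in> lin \<Phi> J"
      using st T'(2) by (auto simp: scaled_def)
    have "dfn_on \<Phi> J UNIV (\<lambda>\<omega>. (fst \<omega>, (snd \<omega>)(N := \<sigma> \<omega>)) \<in> A)"
    proof (rule dfn_subst[OF assms])
      fix j assume "j \<in> insert N J"
      then show "plin \<Phi> J UNIV (\<lambda>\<omega>. snd (fst \<omega>, (snd \<omega>)(N := \<sigma> \<omega>)) j)"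
        using plin_scaled[OF n] plin_lin[OF lin_var] by (cases "j = N") auto
    qed (auto intro: dfn_onI[OF dfn_pos] plin_lin lin_w)
    then show ?thesis using dfn_on_imp_dfn[of \<Phi> J UNIV] dfn_const[of True \<Phi> J] by simp
  qed
  then have "{\<omega>. \<exists>\<sigma>\<in>T'. (fst \<omega>, (snd \<omega>)(N := \<sigma> \<omega>)) \<in> A} \<in> dfn \<Phi> J"
    using T'(1) by (rule_tac dfn_bex)
  also have "{\<omega>. \<exists>\<sigma>\<in>T'. (fst \<omega>, (snd \<omega>)(N := \<sigma> \<omega>)) \<in> A} = {(x, g). \<exists>t. (x, g(N := t)) \<in> A}"
    using T(3) T'(3) by fastforce
  finally show ?thesis .
qed

end

section \<open>Polynomial functions with parameters\<close>

text \<open>The arguments are sequences rather than tuples, so the coordinates from \<open>m\<close>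
  on are free to hold further variables during elimination.\<close>

inductive_set polyfun :: "nat \<Rightarrow> ((nat \<Rightarrow> 'a::comm_ring_1) \<Rightarrow> 'a) set" for m where
  polyfun_const: "(\<lambda>_. c) \<in> polyfun m"
| polyfun_var: "i < m \<Longrightarrow> (\<lambda>x. x i) \<in> polyfun m"
| polyfun_add: "f \<in> polyfun m \<Longrightarrow> g \<in> polyfun m \<Longrightarrow> (\<lambda>x. f x + g x) \<in> polyfun m"
| polyfun_mult: "f \<in> polyfun m \<Longrightarrow> g \<in> polyfun m \<Longrightarrow> (\<lambda>x. f x * g x) \<in> polyfun m"

lemma polyfun_uminus: "f \<in> polyfun m \<Longrightarrow> (\<lambda>x. - f x) \<in> polyfun m"
  using polyfun_mult[OF polyfun_const[of "-1"], of f m] by simp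

lemma polyfun_diff: "f \<in> polyfun m \<Longrightarrow> g \<in> polyfun m \<Longrightarrow> (\<lambda>x. f x - g x) \<in> polyfun m"
  using polyfun_add[OF _ polyfun_uminus, of f m g] by simp

lemma polyfun_sum: "(\<And>i. i \<in> I \<Longrightarrow> f i \<in> polyfun m) \<Longrightarrow> (\<lambda>x. \<Sum>i\<in>I. f i x) \<in> polyfun m"
  by (induction I rule: infinite_finite_induct) (simp_all add: polyfun_const polyfun_add)

lemma polyfun_prod: "(\<And>i. i \<in> I \<Longrightarrow> f i \<in> polyfun m) \<Longrightarrow> (\<lambda>x. \<Prod>i\<in>I. f i x) \<in> polyfun m"
  by (induction I rule: infinite_finite_induct) (simp_all add: polyfun_const polyfun_mult)

lemma polyfun_power: "f \<in> polyfun m \<Longrightarrow> (\<lambda>x. f x ^ n) \<in> polyfun m"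
  by (induction n) (simp_all add: polyfun_const polyfun_mult)

lemma polyfun_mono: "f \<in> polyfun m \<Longrightarrow> m \<le> m' \<Longrightarrow> f \<in> polyfun m'"
  by (induction rule: polyfun.induct) (auto intro: polyfun.intros)

lemma polyfun_cong: "f \<in> polyfun m \<Longrightarrow> (\<And>i. i < m \<Longrightarrow> x i = x' i) \<Longrightarrow> f x = f x'"
  by (induction rule: polyfun.induct) auto

text \<open>Polynomials in one variable whose coefficients are polynomial functions of \<open>x\<^sub>0, \<dots>, x\<^sub>m\<^sub>-\<^sub>1\<close>;
  the degree may drop at special parameters \<open>x\<close>.\<close>

definition fam :: "nat \<Rightarrow> ((nat \<Rightarrow> 'a::comm_ring_1) \<Rightarrow> 'a poly) set" where
  "fam m = {P. (\<exists>d. \<forall>x. Polynomial.degree (P x) \<le> d) \<and> (\<forall>i. (\<lambda>x. coeff (P x) i) \<in> polyfun m)}"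

lemma famI:
  "(\<And>x. Polynomial.degree (P x) \<le> d) \<Longrightarrow> (\<And>i. (\<lambda>x. coeff (P x) i) \<in> polyfun m) \<Longrightarrow> P \<in> fam m"
  unfolding fam_def by blast

lemma fam_coeff: "P \<in> fam m \<Longrightarrow> (\<lambda>x. coeff (P x) i) \<in> polyfun m"
  unfolding fam_def by blast

lemma fam_degree:
  assumes "P \<in> fam m"
  obtains d where "\<And>x. Polynomial.degree (P x) \<le> d"
  using assms unfolding fam_def by blast

lemma fam_mono: "P \<in> fam m \<Longrightarrow> m \<le> m' \<Longrightarrow> P \<in> fam m'"
  unfolding fam_def using polyfun_mono by blast

lemma fam_cong: "P \<in> fam m \<Longrightarrow> (\<And>i. i < m \<Longrightarrow> x i = x' i) \<Longrightarrow> P x = P x'"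
  by (rule poly_eqI) (rule polyfun_cong[OF fam_coeff])

lemma fam_pCons:
  assumes "f \<in> polyfun m" "P \<in> fam m"
  shows "(\<lambda>x. pCons (f x) (P x)) \<in> fam m"
proof -
  obtain d where d: "\<And>x. Polynomial.degree (P x) \<le> d" using fam_degree[OF assms(2)] by blast
  show ?thesis
  proof (rule famI[of _ "Suc d"])
    show "Polynomial.degree (pCons (f x) (P x)) \<le> Suc d" for x
      using degree_pCons_le[of "f x" "P x"] d[of x] by linarith
    show "(\<lambda>x. coeff (pCons (f x) (P x)) i) \<in> polyfun m" for i
      by (cases i) (simp_all add: assms(1) fam_coeff[OF assms(2)])
  qed
qed

lemma fam_0: "(\<lambda>_. 0) \<in> fam m"
  by (rule famI[of _ 0]) (simp_all add: polyfun_const)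

lemma fam_const: "f \<in> polyfun m \<Longrightarrow> (\<lambda>x. [:f x:]) \<in> fam m"
  by (intro fam_pCons fam_0)

lemma fam_add:
  assumes "P \<in> fam m" "Q \<in> fam m"
  shows "(\<lambda>x. P x + Q x) \<in> fam m"
proof -
  obtain d e where "\<And>x. Polynomial.degree (P x) \<le> d" "\<And>x. Polynomial.degree (Q x) \<le> e"
    using fam_degree[OF assms(1)] fam_degree[OF assms(2)] by metis
  then show ?thesis
    by (intro famI[of _ "max d e"])
       (auto intro!: degree_add_le polyfun_add fam_coeff assms intro: le_max_iff_disj[THEN iffD2])
qed

lemma fam_mult:
  assumes "P \<in> fam m" "Q \<in> fam m"
  shows "(\<lambda>x. P x * Q x) \<in> fam m"
proof -
  obtain d e where "\<And>x. Polynomial.degree (P x) \<le> d" "\<And>x. Polynomial.degree (Q x) \<le> e"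
    using fam_degree[OF assms(1)] fam_degree[OF assms(2)] by metis
  then have "Polynomial.degree (P x * Q x) \<le> d + e" for x
    by (rule order.trans[OF degree_mult_le add_mono])
  then show ?thesis
    by (rule famI) (simp add: coeff_mult, intro polyfun_sum polyfun_mult fam_coeff assms)
qed

lemma fam_smult: "f \<in> polyfun m \<Longrightarrow> P \<in> fam m \<Longrightarrow> (\<lambda>x. smult (f x) (P x)) \<in> fam m"
  using fam_mult[OF fam_const, of f m P] by simp

lemma fam_monom: "f \<in> polyfun m \<Longrightarrow> (\<lambda>x. Polynomial.monom (f x) n) \<in> fam m"
proof (rule famI[of _ n])
  show "(\<lambda>x. coeff (Polynomial.monom (f x) n) i) \<in> polyfun m" if "f \<in> polyfun m" for i
    using that by (cases "n = i") (simp_all add: polyfun_const)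
qed (simp_all add: degree_monom_le)

lemma fam_diff: "P \<in> fam m \<Longrightarrow> Q \<in> fam m \<Longrightarrow> (\<lambda>x. P x - Q x) \<in> fam m"
  using fam_add[OF _ fam_smult[OF polyfun_const[of "-1"]], of P m Q] by simp

lemma fam_pderiv:
  fixes P :: "(nat \<Rightarrow> 'a::{comm_ring_1,semiring_no_zero_divisors}) \<Rightarrow> 'a poly"
  assumes "P \<in> fam m"
  shows "(\<lambda>x. pderiv (P x)) \<in> fam m"
proof -
  obtain d where d: "\<And>x. Polynomial.degree (P x) \<le> d" using fam_degree[OF assms] by blast
  show ?thesis
  proof (rule famI[of _ d])
    show "Polynomial.degree (pderiv (P x)) \<le> d" for x
      by (rule degree_le) (use d[of x] in \<open>auto simp: coeff_pderiv coeff_eq_0\<close>)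
    show "(\<lambda>x. coeff (pderiv (P x)) i) \<in> polyfun m" for i
      unfolding coeff_pderiv by (intro polyfun_mult polyfun_const fam_coeff assms)
  qed
qed

lemma fam_higher_pderiv:
  fixes P :: "(nat \<Rightarrow> 'a::{comm_ring_1,semiring_no_zero_divisors}) \<Rightarrow> 'a poly"
  shows "P \<in> fam m \<Longrightarrow> (\<lambda>x. (pderiv ^^ k) (P x)) \<in> fam m"
  by (induction k) (simp_all add: fam_pderiv)

lemma poly_eq_sum_le:
  fixes p :: "'a::comm_ring_1 poly"
  assumes "Polynomial.degree p \<le> d"
  shows "poly p y = (\<Sum>i\<le>d. coeff p i * y ^ i)"
  unfolding poly_altdef by (intro sum.mono_neutral_left) (use assms in \<open>auto simp: coeff_eq_0\<close>)

lemma fam_eval: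
  assumes "P \<in> fam m" "m \<le> m'" "f \<in> polyfun m'"
  shows "(\<lambda>x. poly (P x) (f x)) \<in> polyfun m'"
proof -
  obtain d where d: "\<And>x. Polynomial.degree (P x) \<le> d" using fam_degree[OF assms(1)] by blast
  show ?thesis unfolding poly_eq_sum_le[OF d]
    by (intro polyfun_sum polyfun_mult polyfun_power assms(3) polyfun_mono[OF fam_coeff[OF assms(1)] assms(2)])
qed

lemma polyfun_Suc_eq_fam:
  "f \<in> polyfun (Suc m) \<Longrightarrow> \<exists>P\<in>fam m. \<forall>x. f x = poly (P x) (x m)"
proof (induction rule: polyfun.induct)
  case (polyfun_const c)
  show ?case by (rule bexI[OF _ fam_const[OF polyfun.polyfun_const[of c]]]) simp
next
  case (polyfun_var i)
  show ?case
  proof (cases "i = m")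
    case True
    have "(\<lambda>x. [:0, 1:]) \<in> fam m" by (intro fam_pCons fam_0 polyfun.polyfun_const)
    then show ?thesis by (rule bexI[rotated]) (simp add: True)
  next
    case False
    then have "(\<lambda>x. [:x i:]) \<in> fam m" using polyfun_var by (intro fam_const polyfun.polyfun_var) simp
    then show ?thesis by (rule bexI[rotated]) simp
  qed
next
  case (polyfun_add f g)
  from polyfun_add.IH obtain P Q where
    PQ: "P \<in> fam m" "\<forall>x. f x = poly (P x) (x m)" "Q \<in> fam m" "\<forall>x. g x = poly (Q x) (x m)"
    by (elim bexE)
  show ?case by (rule bexI[OF _ fam_add[OF PQ(1,3)]]) (simp add: PQ(2,4))
next
  case (polyfun_mult f g)
  from polyfun_mult.IH obtain P Q where
    PQ: "P \<in> fam m" "\<forall>x. f x = poly (P x) (x m)" "Q \<in> fam m" "\<forall>x. g x = poly (Q x) (x m)"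
    by (elim bexE)
  show ?case by (rule bexI[OF _ fam_mult[OF PQ(1,3)]]) (simp add: PQ(2,4))
qed

text \<open>Pseudo-division keeps the coefficients polynomial in the parameters. Each step
  multiplies by the square of the formal leading coefficient instead of the coefficient itself: the
  accumulated factor \<open>q\<close> is then positive and preserves signs.\<close>

lemma fam_pseudo_mod:
  fixes P Q :: "(nat \<Rightarrow> 'a::linordered_field) \<Rightarrow> 'a poly"
  assumes Q: "Q \<in> fam m" "\<And>x. Polynomial.degree (Q x) \<le> d" "d > 0" and P: "P \<in> fam m"
  shows "\<exists>R\<in>fam m. \<exists>q\<in>polyfun m. (\<forall>x. Polynomial.degree (R x) < d) \<and>
    (\<forall>x. coeff (Q x) d \<noteq> 0 \<longrightarrow> 0 < q x) \<and>
    (\<forall>x y. poly (Q x) y = 0 \<longrightarrow> poly (R x) y = q x * poly (P x) y)"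
proof -
  obtain n where "\<And>x. Polynomial.degree (P x) \<le> n" using fam_degree[OF P] by blast
  then show ?thesis using P
  proof (induction n arbitrary: P rule: less_induct)
    case (less n)
    show ?case
    proof (cases "n < d")
      case True
      then have "\<forall>x. Polynomial.degree (P x) < d" using less.prems(1) le_less_trans by blast
      then show ?thesis using less.prems(2)
        by (intro bexI[OF _ less.prems(2)] bexI[OF _ polyfun_const[of 1]]) simp
    next
      case False
      define c where "c x = coeff (Q x) d" for x
      define p where "p x = coeff (P x) n" for x
      have cp: "c \<in> polyfun m" "p \<in> polyfun m"
        unfolding c_def p_def by (intro fam_coeff Q less.prems)+
      define P1 where "P1 x = smult (c x * c x) (P x) - Polynomial.monom (c x * p x) (n - d) * Q x" for x
      have P1: "P1 \<in> fam m"
        unfolding P1_def by (intro fam_diff fam_smult fam_mult fam_monom polyfun_mult cp Q less.prems)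
      have deg: "Polynomial.degree (P1 x) \<le> n - 1" for x
      proof (rule degree_le, intro allI impI)
        fix i assume "n - 1 < i"
        then consider "i = n" | "i > n" by linarith
        then show "coeff (P1 x) i = 0"
        proof cases
          case 1
          have "coeff (Polynomial.monom (c x * p x) (n - d) * Q x) n = c x * p x * c x"
            using False by (simp add: coeff_monom_mult c_def)
          then show ?thesis using 1 by (simp add: P1_def p_def)
        next
          case 2
          then have "coeff (P x) i = 0" using less.prems(1)[of x] by (simp add: coeff_eq_0)
          moreover have "coeff (Polynomial.monom (c x * p x) (n - d) * Q x) i = 0"
            using 2 False Q(2)[of x] by (simp add: coeff_monom_mult coeff_eq_0)
          ultimately show ?thesis by (simp add: P1_def)
        qed
      qed
      have "n - 1 < n" using False Q(3) by simp
      from less.IH[OF this deg P1] obtain R q where R: "R \<in> fam m" "q \<in> polyfun m"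
        "\<forall>x. Polynomial.degree (R x) < d" "\<forall>x. coeff (Q x) d \<noteq> 0 \<longrightarrow> 0 < q x"
        "\<forall>x y. poly (Q x) y = 0 \<longrightarrow> poly (R x) y = q x * poly (P1 x) y" by blast
      show ?thesis
      proof (intro bexI[OF _ R(1)] bexI[of _ "\<lambda>x. q x * (c x * c x)"] conjI allI impI)
        show "(\<lambda>x. q x * (c x * c x)) \<in> polyfun m" by (intro polyfun_mult R cp)
        show "Polynomial.degree (R x) < d" for x using R(3) by blast
        show "0 < q x * (c x * c x)" if "coeff (Q x) d \<noteq> 0" for x
          using that R(4) by (intro mult_pos_pos[of "q x"]) (auto simp: c_def zero_less_mult_iff linorder_neq_iff)
        show "poly (R x) y = q x * (c x * c x) * poly (P x) y" if "poly (Q x) y = 0" for x y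
          using that R(5) by (simp add: P1_def)
      qed
    qed
  qed
qed

context rcvf begin

lemma dfn_pf_less: "f \<in> polyfun m \<Longrightarrow> g \<in> polyfun m \<Longrightarrow> {\<omega>. f (fst \<omega>) < g (fst \<omega>)} \<in> dfn (polyfun m) J"
  using dfn_pos[OF polyfun_diff[of g m f]] by simp

lemma dfn_pf_eq: "f \<in> polyfun m \<Longrightarrow> g \<in> polyfun m \<Longrightarrow> {\<omega>. f (fst \<omega>) = g (fst \<omega>)} \<in> dfn (polyfun m) J"
  using dfn_conj[OF dfn_not[OF dfn_pf_less[of f m g]] dfn_not[OF dfn_pf_less[of g m f]]]
  by (simp add: not_less order_eq_iff conj_commute)

lemma dfn_pf_neq: "f \<in> polyfun m \<Longrightarrow> g \<in> polyfun m \<Longrightarrow> {\<omega>. f (fst \<omega>) \<noteq> g (fst \<omega>)} \<in> dfn (polyfun m) J"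
  using dfn_not[OF dfn_pf_eq] .

lemma dfn_pf_le: "f \<in> polyfun m \<Longrightarrow> g \<in> polyfun m \<Longrightarrow> {\<omega>. f (fst \<omega>) \<le> g (fst \<omega>)} \<in> dfn (polyfun m) J"
  using dfn_not[OF dfn_pf_less[of g m f]] by (simp add: not_less)

lemma dfn_polyfun_cong:
  assumes "A \<in> dfn (polyfun m) J" "\<And>i. i < m \<Longrightarrow> x i = x' i" "\<And>j. j \<in> J \<Longrightarrow> g j = g' j"
  shows "(x, g) \<in> A \<longleftrightarrow> (x', g') \<in> A"
proof (rule dfn_cong[OF assms(1)])
  fix f :: "(nat \<Rightarrow> 'k) \<Rightarrow> 'k" assume "f \<in> polyfun m"
  then have "f x = f x'" using assms(2) by (rule polyfun_cong)
  then show "(0 < f x \<longleftrightarrow> 0 < f x') \<and> w (f x) = w (f x')" by simp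
qed (rule assms(3))

section \<open>Definable signs and valuations of substituted terms\<close>

lemma plin_pieces:
  assumes "finite I" "\<And>i. i \<in> I \<Longrightarrow> {\<omega>. P i \<omega>} \<in> dfn \<Phi> J" "\<And>i. i \<in> I \<Longrightarrow> l i \<in> lin \<Phi> J"
    and "\<And>\<omega>. \<omega> \<in> Z \<Longrightarrow> \<exists>i\<in>I. P i \<omega>" "\<And>i \<omega>. i \<in> I \<Longrightarrow> \<omega> \<in> Z \<Longrightarrow> P i \<omega> \<Longrightarrow> u \<omega> = l i \<omega>"
  shows "plin \<Phi> J Z u"
  unfolding plin_def
proof (intro exI[of _ "(\<lambda>i. {\<omega>. P i \<omega>}) ` I"] conjI)
  show "\<forall>C\<in>(\<lambda>i. {\<omega>. P i \<omega>}) ` I. \<exists>n>0. \<exists>l\<in>lin \<Phi> J. \<forall>\<omega>\<in>C \<inter> Z. zmult n (u \<omega>) = l \<omega>"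
  proof
    fix C assume "C \<in> (\<lambda>i. {\<omega>. P i \<omega>}) ` I"
    then obtain i where "i \<in> I" "C = {\<omega>. P i \<omega>}" by blast
    then show "\<exists>n>0. \<exists>l\<in>lin \<Phi> J. \<forall>\<omega>\<in>C \<inter> Z. zmult n (u \<omega>) = l \<omega>"
      using assms(5)[of i] by (intro exI[of _ 1] conjI bexI[OF _ assms(3)[of i]]) auto
  qed
qed (use assms(1,2,4) in auto)

lemma plin_if:
  assumes "dfn_on \<Phi> J Z P" "plin \<Phi> J Z u" "plin \<Phi> J Z v"
  shows "plin \<Phi> J Z (\<lambda>\<omega>. if P \<omega> then u \<omega> else v \<omega>)"
proof -
  obtain B where B: "B \<in> dfn \<Phi> J" "\<forall>\<omega>\<in>Z. P \<omega> \<longleftrightarrow> \<omega> \<in> B" using assms(1) by (auto simp: dfn_on_def)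
  obtain \<C> where C: "finite \<C>" "\<C> \<subseteq> dfn \<Phi> J" "Z \<subseteq> \<Union>\<C>"
    "\<And>C. C \<in> \<C> \<Longrightarrow> \<exists>n>0. \<exists>l\<in>lin \<Phi> J. \<forall>\<omega>\<in>C \<inter> Z. zmult n (u \<omega>) = l \<omega>"
    using assms(2) unfolding plin_def by blast
  obtain \<D> where D: "finite \<D>" "\<D> \<subseteq> dfn \<Phi> J" "Z \<subseteq> \<Union>\<D>"
    "\<And>C. C \<in> \<D> \<Longrightarrow> \<exists>n>0. \<exists>l\<in>lin \<Phi> J. \<forall>\<omega>\<in>C \<inter> Z. zmult n (v \<omega>) = l \<omega>"
    using assms(3) unfolding plin_def by blast
  define \<E> where "\<E> = (\<lambda>C. C \<inter> B) ` \<C> \<union> (\<lambda>C. C \<inter> - B) ` \<D>"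
  show ?thesis unfolding plin_def
  proof (intro exI[of _ \<E>] conjI ballI)
    show "finite \<E>" using C(1) D(1) by (simp add: \<E>_def)
    show "\<E> \<subseteq> dfn \<Phi> J" using C(2) D(2) B(1) unfolding \<E>_def by (auto intro!: dfn_Int dfn_compl)
    show "Z \<subseteq> \<Union>\<E>"
    proof
      fix \<omega> assume "\<omega> \<in> Z"
      obtain C where C: "C \<in> \<C>" "\<omega> \<in> C" using C(3) \<open>\<omega> \<in> Z\<close> by (elim subsetD[elim_format] UnionE)
      obtain D where D: "D \<in> \<D>" "\<omega> \<in> D" using D(3) \<open>\<omega> \<in> Z\<close> by (elim subsetD[elim_format] UnionE)
      have "C \<inter> B \<in> \<E>" "D \<inter> - B \<in> \<E>" unfolding \<E>_def using C D by simp_all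
      then show "\<omega> \<in> \<Union>\<E>" using C D by (cases "\<omega> \<in> B") (blast intro: UnionI)+
    qed
    fix E assume "E \<in> \<E>"
    then consider C where "C \<in> \<C>" "E = C \<inter> B" | D where "D \<in> \<D>" "E = D \<inter> - B"
      unfolding \<E>_def by blast
    then show "\<exists>n>0. \<exists>l\<in>lin \<Phi> J. \<forall>\<omega>\<in>E \<inter> Z. zmult n (if P \<omega> then u \<omega> else v \<omega>) = l \<omega>"
    proof cases
      case 1
      obtain n l where "n > 0" "l \<in> lin \<Phi> J" "\<forall>\<omega>\<in>C \<inter> Z. zmult n (u \<omega>) = l \<omega>" using C(4)[OF 1(1)] by blast
      then show ?thesis using 1 B(2) by (intro exI[of _ n] conjI bexI[of _ l]) auto
    next
      case 2
      obtain n l where "n > 0" "l \<in> lin \<Phi> J" "\<forall>\<omega>\<in>D \<inter> Z. zmult n (v \<omega>) = l \<omega>" using D(4)[OF 2(1)] by blast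
      then show ?thesis using 2 B(2) by (intro exI[of _ n] conjI bexI[of _ l]) auto
    qed
  qed
qed

text \<open>The zero test is listed separately because \<open>w 0 = 0\<close> hides zeros;
  \<open>tame_scale\<close> relies on it when dividing out a factor.\<close>

definition tame :: "('x \<Rightarrow> 'k) set \<Rightarrow> nat set \<Rightarrow> ('x \<times> (nat \<Rightarrow> 'g)) set \<Rightarrow> ('x \<times> (nat \<Rightarrow> 'g) \<Rightarrow> 'k) \<Rightarrow> bool"
  where "tame \<Phi> J Z u \<longleftrightarrow> dfn_on \<Phi> J Z (\<lambda>\<omega>. 0 < u \<omega>) \<and> dfn_on \<Phi> J Z (\<lambda>\<omega>. u \<omega> = 0) \<and> plin \<Phi> J Z (\<lambda>\<omega>. w (u \<omega>))"

lemma tame_polyfun: "f \<in> polyfun m \<Longrightarrow> tame (polyfun m) J Z (\<lambda>\<omega>. f (fst \<omega>))"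
  unfolding tame_def
proof (intro conjI)
  assume f: "f \<in> polyfun m"
  show "dfn_on (polyfun m) J Z (\<lambda>\<omega>. 0 < f (fst \<omega>))" by (rule dfn_onI[OF dfn_pos[OF f]]) (rule refl)
  show "dfn_on (polyfun m) J Z (\<lambda>\<omega>. f (fst \<omega>) = 0)"
    by (rule dfn_onI[OF dfn_pf_eq[OF f polyfun_const]]) (rule refl)
  show "plin (polyfun m) J Z (\<lambda>\<omega>. w (f (fst \<omega>)))" by (rule plin_lin[OF lin_w[OF f]])
qed

text \<open>Undoes the factor brought in by pseudo-division: it changes no sign and shifts the
  valuation by \<open>w\<close> of the factor, except at zeros.\<close>

lemma tame_scale:
  assumes "tame \<Phi> J Z u" "q \<in> \<Phi>" "\<And>\<omega>. \<omega> \<in> Z \<Longrightarrow> 0 < q (fst \<omega>)" "\<And>\<omega>. \<omega> \<in> Z \<Longrightarrow> u \<omega> = q (fst \<omega>) * v \<omega>"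
  shows "tame \<Phi> J Z v"
proof -
  have dfn_on_cong: "dfn_on \<Phi> J Z P \<Longrightarrow> (\<And>\<omega>. \<omega> \<in> Z \<Longrightarrow> P \<omega> \<longleftrightarrow> Q \<omega>) \<Longrightarrow> dfn_on \<Phi> J Z Q" for P Q
    unfolding dfn_on_def by auto
  have plin_cong: "plin \<Phi> J Z a \<Longrightarrow> (\<And>\<omega>. \<omega> \<in> Z \<Longrightarrow> a \<omega> = b \<omega>) \<Longrightarrow> plin \<Phi> J Z b" for a b
    unfolding plin_def by auto
  have u: "dfn_on \<Phi> J Z (\<lambda>\<omega>. 0 < u \<omega>)" "dfn_on \<Phi> J Z (\<lambda>\<omega>. u \<omega> = 0)" "plin \<Phi> J Z (\<lambda>\<omega>. w (u \<omega>))"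
    using assms(1) by (auto simp: tame_def)
  have "plin \<Phi> J Z (\<lambda>\<omega>. if u \<omega> = 0 then 0 else w (u \<omega>) + - w (q (fst \<omega>)))"
    by (intro plin_if u plin_add plin_lin[OF lin_const] plin_lin[OF lin_uminus[OF lin_w]] assms(2))
  then have "plin \<Phi> J Z (\<lambda>\<omega>. w (v \<omega>))"
  proof (rule plin_cong)
    fix \<omega> assume "\<omega> \<in> Z"
    then show "(if u \<omega> = 0 then 0 else w (u \<omega>) + - w (q (fst \<omega>))) = w (v \<omega>)"
      using assms(3,4)[of \<omega>] by (auto simp: w_mult)
  qed
  moreover have "dfn_on \<Phi> J Z (\<lambda>\<omega>. 0 < v \<omega>)"
    by (rule dfn_on_cong[OF u(1)]) (use assms(3,4) in \<open>auto simp: zero_less_mult_iff dest: less_asym\<close>)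
  moreover have "dfn_on \<Phi> J Z (\<lambda>\<omega>. v \<omega> = 0)"
    by (rule dfn_on_cong[OF u(2)]) (use assms(3,4) in fastforce)
  ultimately show ?thesis by (simp add: tame_def)
qed

text \<open>Although \<open>y\<close> is no polynomial function of the parameters, everything about
  the value at \<open>y\<close> is read off data at the centre \<open>f\<close>: the Taylor
  coefficients \<open>r k\<close>, which are polynomial functions, the side \<open>E\<close> and the
  valuation \<open>l\<close> of the distance.\<close>

lemma tame_expansion:
  fixes R :: "(nat \<Rightarrow> 'k) \<Rightarrow> 'k poly"
  assumes R: "R \<in> fam m" "m \<le> M" and f: "f \<in> polyfun M"
    and l: "l \<in> lin (polyfun M) J" and E: "E \<in> dfn (polyfun M) J"
    and h: "\<And>\<omega>. \<omega> \<in> Z \<Longrightarrow> y \<omega> \<noteq> f (fst \<omega>)" "\<And>\<omega>. \<omega> \<in> Z \<Longrightarrow> w (y \<omega> - f (fst \<omega>)) = l \<omega>"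
      "\<And>\<omega>. \<omega> \<in> Z \<Longrightarrow> f (fst \<omega>) < y \<omega> \<longleftrightarrow> \<omega> \<in> E"
    and nr: "\<And>\<omega>. \<omega> \<in> Z \<Longrightarrow> noroots (R (fst \<omega>)) (y \<omega> - \<bar>y \<omega> - f (fst \<omega>)\<bar>) (y \<omega> + \<bar>y \<omega> - f (fst \<omega>)\<bar>)"
  shows "tame (polyfun M) J Z (\<lambda>\<omega>. poly (R (fst \<omega>)) (y \<omega>))"
proof -
  obtain d where d: "\<And>x. Polynomial.degree (R x) \<le> d" using fam_degree[OF R(1)] by blast
  define r where "r k x = poly ((pderiv ^^ k) (R x)) (f x)" for k x
  have r: "r k \<in> polyfun M" for k
    unfolding r_def by (rule fam_eval[OF fam_higher_pderiv[OF R(1)] R(2) f])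
  define u where "u \<omega> = poly (R (fst \<omega>)) (y \<omega>)" for \<omega>
  define H where "H \<omega> = y \<omega> - f (fst \<omega>)" for \<omega>
  have y: "y \<omega> = f (fst \<omega>) + H \<omega>" for \<omega> by (simp add: H_def)
  have H0: "H \<omega> \<noteq> 0" if "\<omega> \<in> Z" for \<omega> using h(1)[OF that] by (simp add: H_def)
  have R0: "R (fst \<omega>) = 0 \<Longrightarrow> r k (fst \<omega>) = 0" for k \<omega> by (simp add: r_def)
  have u0: "u \<omega> \<noteq> 0" if "\<omega> \<in> Z" "R (fst \<omega>) \<noteq> 0" for \<omega>
  proof -
    have "btw (y \<omega> - \<bar>y \<omega> - f (fst \<omega>)\<bar>) (y \<omega>) (y \<omega> + \<bar>y \<omega> - f (fst \<omega>)\<bar>)"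
      using h(1)[OF that(1)] by (simp add: btw_def)
    then show ?thesis using nr[OF that(1)] that(2) unfolding noroots_def u_def by (metis funpow_0)
  qed
  have nob: "poly (R (fst \<omega>)) c \<noteq> 0"
    if "\<omega> \<in> Z" "R (fst \<omega>) \<noteq> 0" "btw (f (fst \<omega>)) c (f (fst \<omega>) + H \<omega>)" for \<omega> c
  proof -
    have "btw (y \<omega> - \<bar>y \<omega> - f (fst \<omega>)\<bar>) c (y \<omega> + \<bar>y \<omega> - f (fst \<omega>)\<bar>)"
      using that(3) unfolding H_def btw_def by (auto simp: abs_if)
    then show ?thesis using nr[OF that(1)] that(2) unfolding noroots_def by (metis funpow_0)
  qed
  have sgn: "0 < u \<omega> * (r k (fst \<omega>) * H \<omega> ^ k)"
    if "\<omega> \<in> Z" "r k (fst \<omega>) \<noteq> 0" "\<And>j. j < k \<Longrightarrow> r j (fst \<omega>) = 0" for \<omega> k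
  proof -
    have "R (fst \<omega>) \<noteq> 0" using that(2) R0 by blast
    then show ?thesis unfolding u_def r_def y using that u0[OF that(1)] nob[OF that(1)] H0
      by (intro sign_expansion) (auto simp: r_def u_def y)
  qed
  have attained: "\<exists>j\<le>d. r j (fst \<omega>) \<noteq> 0 \<and> u \<omega> \<preceq> r j (fst \<omega>) * \<bar>H \<omega>\<bar> ^ j" if "u \<omega> \<noteq> 0" for \<omega>
    using expansion_attained[of "H \<omega>" "\<bar>H \<omega>\<bar>" "R (fst \<omega>)" "f (fst \<omega>)"] that d[of "fst \<omega>"]
    unfolding u_def r_def y by (auto intro: le_trans)
  \<comment> \<open>The expansion runs from \<open>y\<close> back to the centre, hence the
    displacement - H.\<close>
  have upper: "r j (fst \<omega>) * \<bar>H \<omega>\<bar> ^ j \<preceq> u \<omega>" if "\<omega> \<in> Z" for \<omega> j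
    using expansion_upper[of "- H \<omega>" "\<bar>H \<omega>\<bar>" "R (fst \<omega>)" "y \<omega>" j] nr[OF that] H0[OF that]
    unfolding u_def r_def by (simp add: H_def)
  have zero_iff: "u \<omega> = 0 \<longleftrightarrow> (\<forall>k\<in>{..d}. r k (fst \<omega>) = 0)" if "\<omega> \<in> Z" for \<omega>
  proof
    assume "u \<omega> = 0"
    then show "\<forall>k\<in>{..d}. r k (fst \<omega>) = 0" using u0[OF that] R0 by blast
  next
    assume "\<forall>k\<in>{..d}. r k (fst \<omega>) = 0"
    then show "u \<omega> = 0" using attained[of \<omega>] by auto
  qed
  have pos_iff: "0 < u \<omega> \<longleftrightarrow> (\<exists>k\<in>{..d}. (\<forall>j\<in>{..<k}. r j (fst \<omega>) = 0) \<and>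
      ((\<omega> \<in> E \<or> even k) \<and> 0 < r k (fst \<omega>) \<or> (\<not> \<omega> \<in> E \<and> odd k) \<and> r k (fst \<omega>) < 0))"
    if "\<omega> \<in> Z" for \<omega>
  proof -
    have HE: "0 < H \<omega> \<longleftrightarrow> \<omega> \<in> E" using h(3)[OF that] by (simp add: H_def)
    have *: "0 < r k (fst \<omega>) * H \<omega> ^ k \<longleftrightarrow>
      (\<omega> \<in> E \<or> even k) \<and> 0 < r k (fst \<omega>) \<or> (\<not> \<omega> \<in> E \<and> odd k) \<and> r k (fst \<omega>) < 0" for k
      using H0[OF that] unfolding HE[symmetric]
      by (auto simp: zero_less_mult_iff zero_less_power_eq power_less_zero_eq)
    show ?thesis unfolding *[symmetric]
    proof
      assume u: "0 < u \<omega>"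
      define k where "k = (LEAST j. r j (fst \<omega>) \<noteq> 0)"
      obtain j where j: "j \<le> d" "r j (fst \<omega>) \<noteq> 0" using attained[of \<omega>] u by auto
      have k: "r k (fst \<omega>) \<noteq> 0" unfolding k_def using j(2) by (rule LeastI)
      have "k \<le> j" unfolding k_def using j(2) by (rule Least_le)
      then have kd: "k \<le> d" using j(1) by simp
      have k': "r i (fst \<omega>) = 0" if "i < k" for i
        using not_less_Least[of i "\<lambda>j. r j (fst \<omega>) \<noteq> 0"] that unfolding k_def by blast
      have "0 < r k (fst \<omega>) * H \<omega> ^ k"
        using sgn[OF that k k'] u by (simp add: zero_less_mult_iff)
      then show "\<exists>k\<in>{..d}. (\<forall>j\<in>{..<k}. r j (fst \<omega>) = 0) \<and> 0 < r k (fst \<omega>) * H \<omega> ^ k"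
        using kd k' by (intro bexI[of _ k]) auto
    next
      assume "\<exists>k\<in>{..d}. (\<forall>j\<in>{..<k}. r j (fst \<omega>) = 0) \<and> 0 < r k (fst \<omega>) * H \<omega> ^ k"
      then obtain k where k: "\<And>j. j < k \<Longrightarrow> r j (fst \<omega>) = 0" "0 < r k (fst \<omega>) * H \<omega> ^ k" by auto
      then have "r k (fst \<omega>) \<noteq> 0" by auto
      from sgn[OF that this k(1)] k(2) show "0 < u \<omega>" by (simp add: zero_less_mult_iff)
    qed
  qed
  have wr: "w (r j (fst \<omega>) * \<bar>H \<omega>\<bar> ^ j) = w (r j (fst \<omega>)) + zmult (int j) (l \<omega>)"
    if "\<omega> \<in> Z" "r j (fst \<omega>) \<noteq> 0" for \<omega> j
    using that H0[OF that(1)] h(2)[OF that(1)] by (simp add: w_mult w_power H_def)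
  define S where "S k \<omega> \<longleftrightarrow> r k (fst \<omega>) \<noteq> 0 \<and> (\<forall>j\<in>{..d}. r j (fst \<omega>) \<noteq> 0 \<longrightarrow>
      w (r j (fst \<omega>)) + zmult (int j) (l \<omega>) \<le> w (r k (fst \<omega>)) + zmult (int k) (l \<omega>))" for k \<omega>
  \<comment> \<open>The pieces with k \<le> d are those where term \<open>k\<close> attains the
    maximum. The extra index \<open>Suc d\<close> is the piece where all coefficients vanish; there
    the value is 0 and \<open>w\<close> takes its junk value 0.\<close>
  define P where "P k \<omega> \<longleftrightarrow> (if k \<le> d then S k \<omega> else \<forall>k\<in>{..d}. r k (fst \<omega>) = 0)" for k \<omega>
  define L where "L k = (if k \<le> d then (\<lambda>\<omega>. w (r k (fst \<omega>)) + zmult (int k) (l \<omega>)) else (\<lambda>_. 0))" for k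
  have lin_r: "(\<lambda>\<omega>. w (r k (fst \<omega>)) + zmult (int k) (l \<omega>)) \<in> lin (polyfun M) J" for k
    by (intro lin_add lin_w r lin_zmult l)
  have zero_dfn: "{\<omega>. r k (fst \<omega>) = 0} \<in> dfn (polyfun M) J" for k
    by (rule dfn_pf_eq[OF r polyfun_const])
  have all_zero_dfn: "{\<omega>. \<forall>k\<in>{..d}. r k (fst \<omega>) = 0} \<in> dfn (polyfun M) J"
    by (intro dfn_ball zero_dfn) simp
  have "plin (polyfun M) J Z (\<lambda>\<omega>. w (u \<omega>))"
  proof (rule plin_pieces[where I = "{..Suc d}" and P = P and l = L])
    show "{\<omega>. P k \<omega>} \<in> dfn (polyfun M) J" for k
    proof (cases "k \<le> d")
      case True
      have "{\<omega>. S k \<omega>} \<in> dfn (polyfun M) J"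
        unfolding S_def by (intro dfn_conj dfn_ball dfn_imp dfn_not zero_dfn dfn_lin_le lin_r) simp
      then show ?thesis using True by (simp add: P_def)
    next
      case False
      then show ?thesis using all_zero_dfn by (simp add: P_def)
    qed
    show "L k \<in> lin (polyfun M) J" for k
      unfolding L_def by (cases "k \<le> d") (simp_all add: lin_r lin_const)
    show "\<exists>k\<in>{..Suc d}. P k \<omega>" if "\<omega> \<in> Z" for \<omega>
    proof (cases "u \<omega> = 0")
      case True
      then have "P (Suc d) \<omega>" using zero_iff[OF that] by (simp add: P_def)
      then show ?thesis by blast
    next
      case False
      obtain k where k: "k \<le> d" "r k (fst \<omega>) \<noteq> 0" "u \<omega> \<preceq> r k (fst \<omega>) * \<bar>H \<omega>\<bar> ^ k"
        using attained[OF False] by blast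
      have "w (r j (fst \<omega>)) + zmult (int j) (l \<omega>) \<le> w (r k (fst \<omega>)) + zmult (int k) (l \<omega>)"
        if "r j (fst \<omega>) \<noteq> 0" for j
      proof -
        have "r j (fst \<omega>) * \<bar>H \<omega>\<bar> ^ j \<preceq> r k (fst \<omega>) * \<bar>H \<omega>\<bar> ^ k"
          using upper[OF \<open>\<omega> \<in> Z\<close>] k(3) by (rule dom_trans)
        then show ?thesis
          using that k(2) H0[OF \<open>\<omega> \<in> Z\<close>] wr[OF \<open>\<omega> \<in> Z\<close>] by (simp add: dom_iff)
      qed
      then have "P k \<omega>" using k by (simp add: P_def S_def)
      then show ?thesis using k by auto
    qed
    show "w (u \<omega>) = L k \<omega>" if "\<omega> \<in> Z" "P k \<omega>" for k \<omega>
    proof (cases "k \<le> d")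
      case True
      then have S: "S k \<omega>" using that(2) by (simp add: P_def)
      then have rk: "r k (fst \<omega>) \<noteq> 0" by (simp add: S_def)
      then have u: "u \<omega> \<noteq> 0" using zero_iff[OF that(1)] True by auto
      obtain j where j: "j \<le> d" "r j (fst \<omega>) \<noteq> 0" "u \<omega> \<preceq> r j (fst \<omega>) * \<bar>H \<omega>\<bar> ^ j"
        using attained[OF u] by blast
      have "w (u \<omega>) \<le> w (r j (fst \<omega>)) + zmult (int j) (l \<omega>)"
        using j(3) u wr[OF that(1) j(2)] by (simp add: dom_iff)
      also have "\<dots> \<le> w (r k (fst \<omega>)) + zmult (int k) (l \<omega>)" using S j by (simp add: S_def)
      finally have "w (u \<omega>) \<le> w (r k (fst \<omega>)) + zmult (int k) (l \<omega>)" .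
      moreover have "w (r k (fst \<omega>)) + zmult (int k) (l \<omega>) \<le> w (u \<omega>)"
        using upper[OF that(1), of k] rk H0[OF that(1)] wr[OF that(1) rk] by (simp add: dom_iff)
      ultimately show ?thesis using True by (simp add: L_def)
    next
      case False
      then have "u \<omega> = 0" using that zero_iff by (simp add: P_def)
      then show ?thesis using False by (simp add: L_def)
    qed
  qed simp
  moreover have "dfn_on (polyfun M) J Z (\<lambda>\<omega>. u \<omega> = 0)"
    by (rule dfn_onI[OF all_zero_dfn zero_iff])
  moreover have "dfn_on (polyfun M) J Z (\<lambda>\<omega>. 0 < u \<omega>)"
  proof (rule dfn_onI[OF _ pos_iff])
    show "{\<omega>. \<exists>k\<in>{..d}. (\<forall>j\<in>{..<k}. r j (fst \<omega>) = 0) \<and>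
      ((\<omega> \<in> E \<or> even k) \<and> 0 < r k (fst \<omega>) \<or> (\<not> \<omega> \<in> E \<and> odd k) \<and> r k (fst \<omega>) < 0)} \<in> dfn (polyfun M) J"
      by (intro dfn_bex dfn_conj dfn_disj dfn_ball dfn_not dfn_mem dfn_const zero_dfn
          dfn_pf_less[OF polyfun_const r] dfn_pf_less[OF r polyfun_const] E finite_atMost finite_lessThan)
  qed
  ultimately show ?thesis by (simp add: tame_def u_def)
qed

lemma dfn_subst_top:
  assumes "A \<in> dfn \<Psi> J" "J \<subseteq> J'" "\<And>f. f \<in> \<Psi> \<Longrightarrow> tame (polyfun M) J' Z (\<lambda>\<omega>. f ((fst \<omega>)(m := y \<omega>)))"
  shows "dfn_on (polyfun M) J' Z (\<lambda>\<omega>. ((fst \<omega>)(m := y \<omega>), snd \<omega>) \<in> A)"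
proof (rule dfn_subst[OF assms(1), where \<theta> = "\<lambda>\<omega>. ((fst \<omega>)(m := y \<omega>), snd \<omega>)", unfolded fst_conv snd_conv])
  show "plin (polyfun M) J' Z (\<lambda>\<omega>. snd \<omega> j)" if "j \<in> J" for j
    using that assms(2) by (intro plin_lin lin_var) auto
qed (use assms(3) in \<open>auto simp: tame_def\<close>)

lemma ex_fam_representatives:
  assumes "\<Psi> \<subseteq> polyfun (Suc m)"
  shows "\<exists>F. \<forall>f\<in>\<Psi>. F f \<in> fam m \<and> (\<forall>x y. f (x(m := y)) = poly (F f x) y)"
proof (rule bchoice, intro ballI)
  fix f assume "f \<in> \<Psi>"
  then have "f \<in> polyfun (Suc m)" using assms by blast
  from polyfun_Suc_eq_fam[OF this] obtain P where P: "P \<in> fam m" "\<forall>x. f x = poly (P x) (x m)"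
    by (elim bexE)
  have "f (x(m := y)) = poly (P x) y" for x y
    using P(2) fam_cong[OF P(1), of "x(m := y)" x] by simp
  then show "\<exists>P. P \<in> fam m \<and> (\<forall>x y. f (x(m := y)) = poly (P x) y)"
    using P(1) by (intro exI[of _ P] conjI allI)
qed

text \<open>The family \<open>\<R>\<close> is fixed before \<open>y\<close> and \<open>Z\<close>
  because the domains to which this is applied are built from the roots of that very family.\<close>

lemma dfn_subst_generic:
  assumes "A \<in> dfn (polyfun (Suc m)) J"
  shows "\<exists>\<R>. finite \<R> \<and> \<R> \<subseteq> fam m \<and> (\<forall>M J' Z y. J \<subseteq> J' \<longrightarrow>
    (\<forall>R\<in>\<R>. tame (polyfun M) J' Z (\<lambda>\<omega>. poly (R (fst \<omega>)) (y \<omega>))) \<longrightarrow>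
    dfn_on (polyfun M) J' Z (\<lambda>\<omega>. ((fst \<omega>)(m := y \<omega>), snd \<omega>) \<in> A))"
proof -
  obtain \<Psi> where \<Psi>: "finite \<Psi>" "\<Psi> \<subseteq> polyfun (Suc m)" "A \<in> dfn \<Psi> J"
    using dfn_finite_support[OF assms] by blast
  obtain F where F: "\<And>f. f \<in> \<Psi> \<Longrightarrow> F f \<in> fam m" "\<And>f x y. f \<in> \<Psi> \<Longrightarrow> f (x(m := y)) = poly (F f x) y"
    using ex_fam_representatives[OF \<Psi>(2)] by blast
  show ?thesis
  proof (intro exI[of _ "F ` \<Psi>"] conjI allI impI)
    show "finite (F ` \<Psi>)" "F ` \<Psi> \<subseteq> fam m" using \<Psi>(1) F(1) by auto
    fix M J' Z and y :: "(nat \<Rightarrow> 'k) \<times> (nat \<Rightarrow> 'g) \<Rightarrow> 'k"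
    assume "J \<subseteq> J'" and tame: "\<forall>R\<in>F ` \<Psi>. tame (polyfun M) J' Z (\<lambda>\<omega>. poly (R (fst \<omega>)) (y \<omega>))"
    show "dfn_on (polyfun M) J' Z (\<lambda>\<omega>. ((fst \<omega>)(m := y \<omega>), snd \<omega>) \<in> A)"
    proof (rule dfn_subst_top[OF \<Psi>(3) \<open>J \<subseteq> J'\<close>])
      fix f assume f: "f \<in> \<Psi>"
      show "tame (polyfun M) J' Z (\<lambda>\<omega>. f ((fst \<omega>)(m := y \<omega>)))"
        unfolding F(2)[OF f] using tame f by blast
    qed
  qed
qed

text \<open>At a root of \<open>Q\<close> the atoms may be replaced by pseudo-remainders. Their
  degrees are below \<open>d\<close>, which puts the roots of the family within reach of the
  induction on the degree.\<close>

lemma dfn_subst_root: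
  assumes A: "A \<in> dfn (polyfun (Suc m)) J"
    and Q: "Q \<in> fam m" "\<And>x. Polynomial.degree (Q x) \<le> d" "d > 0"
  shows "\<exists>\<R>. finite \<R> \<and> \<R> \<subseteq> fam m \<and> (\<forall>R\<in>\<R>. \<forall>x. Polynomial.degree (R x) < d) \<and>
    (\<forall>M J' Z y. m \<le> M \<longrightarrow> J \<subseteq> J' \<longrightarrow>
    (\<forall>\<omega>\<in>Z. coeff (Q (fst \<omega>)) d \<noteq> 0 \<and> poly (Q (fst \<omega>)) (y \<omega>) = 0) \<longrightarrow>
    (\<forall>R\<in>\<R>. tame (polyfun M) J' Z (\<lambda>\<omega>. poly (R (fst \<omega>)) (y \<omega>))) \<longrightarrow>
    dfn_on (polyfun M) J' Z (\<lambda>\<omega>. ((fst \<omega>)(m := y \<omega>), snd \<omega>) \<in> A))"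
proof -
  obtain \<Psi> where \<Psi>: "finite \<Psi>" "\<Psi> \<subseteq> polyfun (Suc m)" "A \<in> dfn \<Psi> J"
    using dfn_finite_support[OF A] by blast
  obtain F where F: "\<And>f. f \<in> \<Psi> \<Longrightarrow> F f \<in> fam m" "\<And>f x y. f \<in> \<Psi> \<Longrightarrow> f (x(m := y)) = poly (F f x) y"
    using ex_fam_representatives[OF \<Psi>(2)] by blast
  have "\<forall>f\<in>\<Psi>. \<exists>R q. R \<in> fam m \<and> q \<in> polyfun m \<and> (\<forall>x. Polynomial.degree (R x) < d) \<and>
    (\<forall>x. coeff (Q x) d \<noteq> 0 \<longrightarrow> 0 < q x) \<and>
    (\<forall>x y. poly (Q x) y = 0 \<longrightarrow> poly (R x) y = q x * poly (F f x) y)"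
    using fam_pseudo_mod[OF Q F(1)] by blast
  then obtain R where "\<forall>f\<in>\<Psi>. \<exists>q. R f \<in> fam m \<and> q \<in> polyfun m \<and> (\<forall>x. Polynomial.degree (R f x) < d) \<and>
    (\<forall>x. coeff (Q x) d \<noteq> 0 \<longrightarrow> 0 < q x) \<and>
    (\<forall>x y. poly (Q x) y = 0 \<longrightarrow> poly (R f x) y = q x * poly (F f x) y)"
    by (rule bchoice[elim_format]) blast
  then obtain q where Rq: "\<forall>f\<in>\<Psi>. R f \<in> fam m \<and> q f \<in> polyfun m \<and> (\<forall>x. Polynomial.degree (R f x) < d) \<and>
    (\<forall>x. coeff (Q x) d \<noteq> 0 \<longrightarrow> 0 < q f x) \<and>
    (\<forall>x y. poly (Q x) y = 0 \<longrightarrow> poly (R f x) y = q f x * poly (F f x) y)"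
    by (rule bchoice[elim_format]) blast
  show ?thesis
  proof (intro exI[of _ "R ` \<Psi>"] conjI allI impI)
    show "finite (R ` \<Psi>)" "R ` \<Psi> \<subseteq> fam m" using \<Psi>(1) Rq by auto
    show "\<forall>P\<in>R ` \<Psi>. \<forall>x. Polynomial.degree (P x) < d" using Rq by auto
    fix M J' Z and y :: "(nat \<Rightarrow> 'k) \<times> (nat \<Rightarrow> 'g) \<Rightarrow> 'k"
    assume "m \<le> M" "J \<subseteq> J'" and Z: "\<forall>\<omega>\<in>Z. coeff (Q (fst \<omega>)) d \<noteq> 0 \<and> poly (Q (fst \<omega>)) (y \<omega>) = 0"
      and tame: "\<forall>P\<in>R ` \<Psi>. tame (polyfun M) J' Z (\<lambda>\<omega>. poly (P (fst \<omega>)) (y \<omega>))"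
    show "dfn_on (polyfun M) J' Z (\<lambda>\<omega>. ((fst \<omega>)(m := y \<omega>), snd \<omega>) \<in> A)"
    proof (rule dfn_subst_top[OF \<Psi>(3) \<open>J \<subseteq> J'\<close>])
      fix f assume f: "f \<in> \<Psi>"
      have "tame (polyfun M) J' Z (\<lambda>\<omega>. poly (F f (fst \<omega>)) (y \<omega>))"
      proof (rule tame_scale)
        show "tame (polyfun M) J' Z (\<lambda>\<omega>. poly (R f (fst \<omega>)) (y \<omega>))" using tame f by blast
        show "q f \<in> polyfun M" using Rq f polyfun_mono[OF _ \<open>m \<le> M\<close>] by blast
      qed (use Rq f Z in auto)
      then show "tame (polyfun M) J' Z (\<lambda>\<omega>. f ((fst \<omega>)(m := y \<omega>)))"
        unfolding F(2)[OF f] .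
    qed
  qed
qed

section \<open>Roots in a gap between adjacent centres\<close>

definition near :: "'k \<Rightarrow> 'k \<Rightarrow> 'k \<Rightarrow> bool" where
  "near a b y \<longleftrightarrow> btw a y b \<and> \<bar>y - a\<bar> \<le> \<bar>b - a\<bar> / 2"

text \<open>\<open>slope d q a t\<close> says that \<open>t\<close> solves the tropical equation
  \<open>val (q a) = max\<^sub>k (val (q\<^sup>(\<^sup>k\<^sup>) a) + k t)\<close>, \<open>1 \<le> k \<le> d\<close>. The valuation of \<open>y - a\<close> solves it if \<open>y\<close> is a root
  of \<open>q\<close> near \<open>a\<close>, by the Taylor expansion of \<open>q - q a\<close> at \<open>a\<close>.\<close>

definition slope :: "nat \<Rightarrow> 'k poly \<Rightarrow> 'k \<Rightarrow> 'g \<Rightarrow> bool" where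
  "slope d q a t \<longleftrightarrow>
    (\<exists>k\<in>{1..d}. poly ((pderiv ^^ k) q) a \<noteq> 0 \<and> w (poly q a) = w (poly ((pderiv ^^ k) q) a) + zmult (int k) t) \<and>
    (\<forall>k\<in>{1..d}. poly ((pderiv ^^ k) q) a \<noteq> 0 \<longrightarrow> w (poly ((pderiv ^^ k) q) a) + zmult (int k) t \<le> w (poly q a))"

text \<open>The reason for the bound |b - a| / 2 in \<open>near\<close>: reflecting \<open>a\<close>
  at \<open>y\<close> does not lead past \<open>b\<close>.\<close>

lemma near_btw: "near a b y \<Longrightarrow> btw (y - \<bar>y - a\<bar>) x (y + \<bar>y - a\<bar>) \<Longrightarrow> btw a x b"
  unfolding near_def btw_def by (auto simp: abs_if field_simps split: if_splits)

lemma noroots_mono: "noroots p a b \<Longrightarrow> (\<And>x. btw c x d \<Longrightarrow> btw a x b) \<Longrightarrow> noroots p c d"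
  unfolding noroots_def by blast

lemma deriv_no_root:
  "noroots (pderiv q) a b \<Longrightarrow> pderiv q \<noteq> 0 \<Longrightarrow> btw a x b \<Longrightarrow> poly (pderiv q) x \<noteq> 0"
  unfolding noroots_def by (metis funpow_0)

lemma poly_inj_between:
  assumes "noroots (pderiv q) a b" "pderiv q \<noteq> 0" "poly q u = poly q v"
    and "u = a \<or> btw a u b" "v = a \<or> btw a v b"
  shows "u = v"
proof (rule ccontr)
  assume "u \<noteq> v"
  from real_closed_MVT[OF this, of q] obtain x where x: "btw u x v" "poly (pderiv q) x * (v - u) = 0"
    using assms(3) by auto
  then have "poly (pderiv q) x = 0" using \<open>u \<noteq> v\<close> by simp
  moreover have "btw a x b" using x(1) assms(4,5) by (auto simp: btw_def)
  ultimately show False using deriv_no_root[OF assms(1,2)] by blast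
qed

lemma slope_root:
  assumes nr: "noroots (pderiv q) a b" "pderiv q \<noteq> 0" and y: "near a b y" "poly q y = 0"
    and d: "Polynomial.degree q \<le> d"
  shows "slope d q a (w (y - a))" "poly q a \<noteq> 0"
proof -
  have btw: "btw a y b" using y(1) by (simp add: near_def)
  then have "y \<noteq> a" by (auto simp: btw_def)
  then have H: "\<bar>y - a\<bar> > 0" "y - a \<noteq> 0" by auto
  show qa: "poly q a \<noteq> 0" using poly_inj_between[OF nr, of a y] y(2) btw \<open>y \<noteq> a\<close> by auto
  \<comment> \<open>\<open>q\<close> vanishes at \<open>y\<close>, so the expansion cannot be used
    for \<open>q\<close> itself. \<open>P\<close> has the same derivatives, no root in the gap by
    injectivity of \<open>q\<close> there, and the value - q(a) at \<open>y\<close>.\<close>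
  define P where "P = q - [:poly q a:]"
  have Pk: "(pderiv ^^ k) P = (pderiv ^^ k) q" if k1: "k \<ge> 1" for k
  proof -
    obtain j where "k = Suc j" using k1 by (cases k) auto
    then show ?thesis
      by (simp del: funpow.simps add: funpow_Suc_right P_def pderiv_diff pderiv_pCons)
  qed
  have Pa: "poly P a = 0" by (simp add: P_def)
  have Py: "poly P y = - poly q a" by (simp add: P_def y(2))
  have dP: "Polynomial.degree P \<le> d" unfolding P_def using d by (intro degree_diff_le) auto
  have "noroots P (y - \<bar>y - a\<bar>) (y + \<bar>y - a\<bar>)"
    unfolding noroots_def
  proof (intro allI impI)
    fix k x assume *: "btw (y - \<bar>y - a\<bar>) x (y + \<bar>y - a\<bar>)" "(pderiv ^^ k) P \<noteq> 0"
    have x: "btw a x b" by (rule near_btw[OF y(1) *(1)])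
    show "poly ((pderiv ^^ k) P) x \<noteq> 0"
    proof (cases k)
      case 0
      have "poly q x \<noteq> poly q a"
        using poly_inj_between[OF nr, of x a] x by (auto simp: btw_def)
      then show ?thesis using 0 by (simp add: P_def)
    next
      case (Suc j)
      then have "(pderiv ^^ k) P = (pderiv ^^ j) (pderiv q)"
        using Pk[of k] by (simp del: funpow.simps add: funpow_Suc_right)
      then show ?thesis using nr(1) x *(2) unfolding noroots_def by metis
    qed
  qed
  from expansion_upper[OF abs_minus_commute H(1) this]
  have up: "poly ((pderiv ^^ k) P) a * \<bar>y - a\<bar> ^ k \<preceq> poly q a" for k
    using Py by (simp only: add_diff_cancel_left' dom_minus_iff) (simp add: Py)
  obtain j where j: "j \<le> d" "poly ((pderiv ^^ j) P) a \<noteq> 0" "poly q a \<preceq> poly ((pderiv ^^ j) P) a * \<bar>y - a\<bar> ^ j"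
    using expansion_attained[of "y - a" "\<bar>y - a\<bar>" P a] Py qa dP by (auto intro: le_trans)
  have "j \<noteq> 0" using j(2) Pa by (cases j) auto
  have wk: "w (poly ((pderiv ^^ k) P) a * \<bar>y - a\<bar> ^ k) = w (poly ((pderiv ^^ k) P) a) + zmult (int k) (w (y - a))"
    if "poly ((pderiv ^^ k) P) a \<noteq> 0" for k
    using that H by (simp add: w_mult w_power)
  have le: "w (poly ((pderiv ^^ k) P) a) + zmult (int k) (w (y - a)) \<le> w (poly q a)"
    if "poly ((pderiv ^^ k) P) a \<noteq> 0" for k
    using up[of k] wk[OF that] that H by (simp add: dom_iff)
  moreover have "w (poly q a) \<le> w (poly ((pderiv ^^ j) P) a) + zmult (int j) (w (y - a))"
    using j(3) wk[OF j(2)] qa by (simp add: dom_iff)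
  ultimately have "w (poly q a) = w (poly ((pderiv ^^ j) P) a) + zmult (int j) (w (y - a))"
    using j(2) by (meson antisym)
  then have eq: "w (poly q a) = w (poly ((pderiv ^^ j) q) a) + zmult (int j) (w (y - a))"
    using Pk[of j] \<open>j \<noteq> 0\<close> by simp
  have le': "w (poly ((pderiv ^^ k) q) a) + zmult (int k) (w (y - a)) \<le> w (poly q a)"
    if "k \<in> {1..d}" "poly ((pderiv ^^ k) q) a \<noteq> 0" for k
    using le[of k] Pk[of k] that by simp
  have "j \<in> {1..d}" "poly ((pderiv ^^ j) q) a \<noteq> 0" using j Pk[of j] \<open>j \<noteq> 0\<close> by auto
  then show "slope d q a (w (y - a))"
    unfolding slope_def using eq le' by blast
qed

text \<open>Every term with k \<ge> 1 increases strictly with t, hence so does the maximum; the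
  equation contains no constant term.\<close>

lemma slope_unique:
  assumes "slope d q a t" "slope d q a t'"
  shows "t = t'"
proof -
  have "\<not> t < t'" if s: "slope d q a t" "slope d q a t'" for t t'
  proof
    assume "t < t'"
    obtain k where k: "k \<in> {1..d}" "poly ((pderiv ^^ k) q) a \<noteq> 0"
      "w (poly q a) = w (poly ((pderiv ^^ k) q) a) + zmult (int k) t"
      using s(1) unfolding slope_def by blast
    have "zmult (int k) t < zmult (int k) t'" using k(1) \<open>t < t'\<close> by (simp add: zmult_less_iff)
    then have "w (poly q a) < w (poly ((pderiv ^^ k) q) a) + zmult (int k) t'" using k(3) by simp
    then show False using s(2) k(1,2) unfolding slope_def by (meson not_le)
  qed
  then show ?thesis using assms by (meson linorder_neqE)
qed

text \<open>By mean values and the constant sign of q', \<open>q\<close> is strictly monotone in the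
  gap; a root in the half adjacent to \<open>a\<close> therefore prevents equal signs at
  \<open>a\<close> and at the midpoint.\<close>

lemma near_root_sign:
  assumes nr: "noroots (pderiv q) a b" "pderiv q \<noteq> 0" and y: "near a b y" "poly q y = 0"
  shows "poly q a * poly q ((a + b) / 2) \<le> 0"
proof (rule ccontr)
  define c where "c = (a + b) / 2"
  assume "\<not> ?thesis"
  then have pos: "poly q a * poly q c > 0" by (simp add: c_def)
  have yb: "btw a y b" using y(1) by (simp add: near_def)
  have c: "y = c \<or> btw a y c" "btw a c b"
    using y(1) unfolding near_def btw_def c_def by (auto simp: abs_if field_simps split: if_splits)
  have "y \<noteq> c" "y \<noteq> a" using pos y(2) by auto
  then have yc: "btw a y c" using c by blast
  obtain u where u: "btw y u a" "poly q a - poly q y = poly (pderiv q) u * (a - y)"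
    using real_closed_MVT[OF \<open>y \<noteq> a\<close>] by blast
  obtain v where v: "btw y v c" "poly q c - poly q y = poly (pderiv q) v * (c - y)"
    using real_closed_MVT[OF \<open>y \<noteq> c\<close>] by blast
  have uv: "btw a u b" "btw a v b" using u(1) v(1) yc c(2) by (auto simp: btw_def)
  have "poly (pderiv q) u * poly (pderiv q) v > 0"
  proof (rule no_root_same_sign)
    show "poly (pderiv q) x \<noteq> 0" if "btw u x v" for x
      using that uv by (intro deriv_no_root[OF nr]) (auto simp: btw_def)
  qed (use deriv_no_root[OF nr] uv in auto)
  moreover have "(a - y) * (c - y) < 0" using yc by (auto simp: btw_def mult_less_0_iff)
  ultimately have "(poly (pderiv q) u * poly (pderiv q) v) * ((a - y) * (c - y)) < 0"
    by (simp add: mult_pos_neg)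
  moreover have "poly q a * poly q c = (poly (pderiv q) u * poly (pderiv q) v) * ((a - y) * (c - y))"
    using u(2) v(2) y(2) by simp
  ultimately show False using pos by simp
qed

text \<open>Converse of \<open>near_root_sign\<close>; a zero at the midpoint itself still counts as
  near.\<close>

lemma near_root_exists:
  assumes "a \<noteq> b" "poly q a \<noteq> 0" "poly q a * poly q ((a + b) / 2) \<le> 0"
  shows "\<exists>y. near a b y \<and> poly q y = 0"
proof -
  define c where "c = (a + b) / 2"
  have c: "near a b c" using assms(1)
    unfolding near_def btw_def c_def by (auto simp: abs_if field_simps)
  show ?thesis
  proof (cases "poly q c = 0")
    case True
    then show ?thesis using c by blast
  next
    case False
    then have "poly q a * poly q c < 0" using assms(2,3) by (simp add: c_def less_le)
    then obtain y where y: "btw a y c" "poly q y = 0" using real_closed_IVT by blast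
    have "near a b y" using y(1) c unfolding near_def btw_def by (auto simp: abs_if split: if_splits)
    then show ?thesis using y(2) by blast
  qed
qed

lemma ex_adjacent_near:
  assumes "finite S" "y \<notin> S" "\<exists>s\<in>S. s < y" "\<exists>s\<in>S. y < s"
  shows "\<exists>a\<in>S. \<exists>b\<in>S. near a b y \<and> (\<forall>c\<in>S. \<not> btw a c b)"
proof -
  define L U where "L = {s \<in> S. s < y}" and "U = {s \<in> S. y < s}"
  have fin: "finite L" "finite U" "L \<noteq> {}" "U \<noteq> {}" using assms by (auto simp: L_def U_def)
  define a b where "a = Max L" and "b = Min U"
  have ab: "a \<in> L" "b \<in> U" using fin by (simp_all add: a_def b_def)
  have "\<not> btw a c b" if "c \<in> S" for c
  proof
    assume "btw a c b"
    then have c: "a < c" "c < b" using ab by (auto simp: btw_def L_def U_def)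
    have "c \<noteq> y" using that assms(2) by auto
    then have "c \<in> L \<or> c \<in> U" using that by (auto simp: L_def U_def)
    then show False using c fin unfolding a_def b_def by (meson Max_ge Min_le not_le)
  qed
  then have adj: "\<forall>c\<in>S. \<not> btw a c b" by blast
  have S: "a \<in> S" "b \<in> S" "a < y" "y < b" using ab by (auto simp: L_def U_def)
  show ?thesis
  proof (cases "y - a \<le> b - y")
    case True
    then have "near a b y" using S unfolding near_def btw_def by (simp add: abs_if field_simps)
    then show ?thesis using S adj by blast
  next
    case False
    then have "near b a y" using S unfolding near_def btw_def by (simp add: abs_if field_simps)
    then show ?thesis using S adj btw_commute[of a _ b] by blast
  qed
qed

section \<open>Elimination of field variables\<close>

text \<open>Members vanishing identically at the parameter are left out to keep the set
  finite.\<close>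

definition rts :: "((nat \<Rightarrow> 'k) \<Rightarrow> 'k poly) set \<Rightarrow> (nat \<Rightarrow> 'k) \<Rightarrow> 'k set" where
  "rts \<R> x = {c. \<exists>R\<in>\<R>. R x \<noteq> 0 \<and> poly (R x) c = 0}"

lemma finite_rts: "finite \<R> \<Longrightarrow> finite (rts \<R> x)"
proof -
  assume "finite \<R>"
  moreover have "rts \<R> x = (\<Union>R\<in>{R \<in> \<R>. R x \<noteq> 0}. {c. poly (R x) c = 0})" by (auto simp: rts_def)
  ultimately show ?thesis by (auto intro: poly_roots_finite)
qed

lemma rts_cong: "\<R> \<subseteq> fam m \<Longrightarrow> (\<And>i. i < m \<Longrightarrow> x i = x' i) \<Longrightarrow> rts \<R> x = rts \<R> x'"
  unfolding rts_def using fam_cong[of _ m x x'] by (metis (no_types, lifting) subsetD)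

definition derivs :: "nat \<Rightarrow> ((nat \<Rightarrow> 'k) \<Rightarrow> 'k poly) set \<Rightarrow> ((nat \<Rightarrow> 'k) \<Rightarrow> 'k poly) set" where
  "derivs d \<R> = (\<lambda>(k, R) x. (pderiv ^^ k) (R x)) ` ({..d} \<times> \<R>)"

lemma finite_derivs: "finite \<R> \<Longrightarrow> finite (derivs d \<R>)"
  by (simp add: derivs_def)

lemma derivs_fam: "\<R> \<subseteq> fam m \<Longrightarrow> derivs d \<R> \<subseteq> fam m"
  unfolding derivs_def using fam_higher_pderiv by fastforce

lemma derivs_degree:
  assumes "\<forall>R\<in>\<R>. \<forall>x. Polynomial.degree (R x) \<le> e"
  shows "\<forall>R\<in>derivs d \<R>. \<forall>x. Polynomial.degree (R x) \<le> e"
proof (intro ballI allI)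
  fix R x assume "R \<in> derivs d \<R>"
  then obtain k R' where R': "R' \<in> \<R>" "R = (\<lambda>x. (pderiv ^^ k) (R' x))" by (auto simp: derivs_def)
  then have "Polynomial.degree (R' x) \<le> e" using assms by blast
  then show "Polynomial.degree (R x) \<le> e" by (simp add: R' degree_higher_pderiv)
qed

lemma higher_pderiv_eq_0:
  fixes p :: "'k poly"
  assumes "Polynomial.degree p < k"
  shows "(pderiv ^^ k) p = 0"
  by (rule poly_eqI) (use assms in \<open>simp add: coeff_higher_pderiv coeff_eq_0\<close>)

lemma noroots_derivs:
  assumes "R \<in> \<R>" "Polynomial.degree (R x) \<le> d" "\<And>c. c \<in> rts (derivs d \<R>) x \<Longrightarrow> \<not> btw a c b"
  shows "noroots (R x) a b"
  unfolding noroots_def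
proof (intro allI impI notI)
  fix k c assume *: "btw a c b" "(pderiv ^^ k) (R x) \<noteq> 0" "poly ((pderiv ^^ k) (R x)) c = 0"
  then have "k \<le> d" using higher_pderiv_eq_0[of "R x" k] assms(2) by (meson le_trans not_le)
  then have "(\<lambda>x. (pderiv ^^ k) (R x)) \<in> derivs d \<R>"
    unfolding derivs_def using assms(1) by (intro image_eqI[of _ _ "(k, R)"]) auto
  then have "c \<in> rts (derivs d \<R>) x" unfolding rts_def using * by (intro CollectI bexI) auto
  then show False using assms(3) *(1) by blast
qed

lemma rts_derivs_mono: "\<R> \<subseteq> \<S> \<Longrightarrow> rts \<R> x \<subseteq> rts (derivs d \<S>) x"
proof -
  assume "\<R> \<subseteq> \<S>"
  moreover have "R \<in> derivs d \<S>" if "R \<in> \<S>" for R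
    unfolding derivs_def using that by (intro image_eqI[of _ _ "(0, R)"]) auto
  ultimately show ?thesis unfolding rts_def by blast
qed

section \<open>Elimination of a variable bound by an equation\<close>

definition root_elim :: "nat \<Rightarrow> bool" where
  "root_elim d \<longleftrightarrow> (\<forall>m J Q A. Q \<in> fam m \<longrightarrow> (\<forall>x. Polynomial.degree (Q x) \<le> d) \<longrightarrow> finite J \<longrightarrow>
    A \<in> dfn (polyfun (Suc m)) J \<longrightarrow>
    {(x, g). \<exists>y. Q x \<noteq> 0 \<and> poly (Q x) y = 0 \<and> (x(m := y), g) \<in> A} \<in> dfn (polyfun m) J)"

text \<open>The form in which the induction hypothesis is applied. The eliminated coordinate
  \<open>m\<close> may lie beyond the parameters of the family, so several roots of the same family
  can be held in consecutive coordinates; this is why \<open>root_elim\<close> ranges over all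
  \<open>m\<close>.\<close>

lemma dfn_ex_rts:
  assumes re: "root_elim d" and R: "finite \<R>" "\<R> \<subseteq> fam m'" "m' \<le> m"
    and deg: "\<forall>R\<in>\<R>. \<forall>x. Polynomial.degree (R x) \<le> d"
    and A: "A \<in> dfn (polyfun (Suc m)) J" "finite J"
  shows "{(x, g). \<exists>y\<in>rts \<R> x. (x(m := y), g) \<in> A} \<in> dfn (polyfun m) J"
proof -
  have "{\<omega>. \<exists>R\<in>\<R>. \<omega> \<in> {(x, g). \<exists>y. R x \<noteq> 0 \<and> poly (R x) y = 0 \<and> (x(m := y), g) \<in> A}} \<in> dfn (polyfun m) J"
  proof (rule dfn_bex[OF R(1)], rule dfn_mem)
    fix R assume "R \<in> \<R>"
    then have "R \<in> fam m" "\<forall>x. Polynomial.degree (R x) \<le> d" using R(2,3) deg fam_mono by blast+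
    then show "{(x, g). \<exists>y. R x \<noteq> 0 \<and> poly (R x) y = 0 \<and> (x(m := y), g) \<in> A} \<in> dfn (polyfun m) J"
      using re A unfolding root_elim_def by blast
  qed
  moreover have "{\<omega>. \<exists>R\<in>\<R>. \<omega> \<in> {(x, g). \<exists>y. R x \<noteq> 0 \<and> poly (R x) y = 0 \<and> (x(m := y), g) \<in> A}}
      = {(x, g). \<exists>y\<in>rts \<R> x. (x(m := y), g) \<in> A}"
    unfolding rts_def by blast
  ultimately show ?thesis by simp
qed

text \<open>Cauchy's bound in a form polynomial in the coefficients: |c| |p_i| is replaced by the
  larger c^2 + p_i^2, and the extra c^2 covers |y| \<le> 1. It places every root strictly between
  two roots of linear polynomials with polynomial coefficients.\<close>

lemma cauchy_bound:
  fixes p :: "'k poly"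
  assumes "Polynomial.degree p \<le> d" "coeff p d \<noteq> 0" "0 < d" "poly p y = 0"
  shows "(coeff p d)\<^sup>2 * \<bar>y\<bar> < (coeff p d)\<^sup>2 + (\<Sum>i<d. (coeff p d)\<^sup>2 + (coeff p i)\<^sup>2)"
proof -
  define c where "c = coeff p d"
  have c: "c\<^sup>2 > 0" using assms(2) by (simp add: c_def)
  show ?thesis unfolding c_def[symmetric]
  proof (cases "\<bar>y\<bar> \<le> 1")
    case True
    have "c\<^sup>2 * \<bar>y\<bar> \<le> c\<^sup>2" using True c by (simp add: mult_left_le)
    moreover have "0 < (\<Sum>i<d. c\<^sup>2 + (coeff p i)\<^sup>2)"
      using assms(3) c by (intro sum_pos) (auto intro: add_pos_nonneg)
    ultimately show "c\<^sup>2 * \<bar>y\<bar> < c\<^sup>2 + (\<Sum>i<d. c\<^sup>2 + (coeff p i)\<^sup>2)" by linarith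
  next
    case False
    have "{..d} = insert d {..<d}" by auto
    then have "c * y ^ d + (\<Sum>i<d. coeff p i * y ^ i) = 0"
      using assms(4) unfolding poly_eq_sum_le[OF assms(1)] by (simp add: c_def)
    then have "\<bar>c * y ^ d\<bar> = \<bar>\<Sum>i<d. coeff p i * y ^ i\<bar>" by (simp add: eq_neg_iff_add_eq_0[symmetric])
    also have "\<dots> \<le> (\<Sum>i<d. \<bar>coeff p i\<bar> * \<bar>y\<bar> ^ (d - 1))"
    proof (rule order.trans[OF sum_abs sum_mono])
      fix i assume "i \<in> {..<d}"
      then have "\<bar>y\<bar> ^ i \<le> \<bar>y\<bar> ^ (d - 1)" using False by (intro power_increasing) auto
      then show "\<bar>coeff p i * y ^ i\<bar> \<le> \<bar>coeff p i\<bar> * \<bar>y\<bar> ^ (d - 1)"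
        by (simp add: abs_mult power_abs mult_left_mono)
    qed
    also have "\<dots> = (\<Sum>i<d. \<bar>coeff p i\<bar>) * \<bar>y\<bar> ^ (d - 1)" by (simp add: sum_distrib_right)
    finally have "(\<bar>c\<bar> * \<bar>y\<bar>) * \<bar>y\<bar> ^ (d - 1) \<le> (\<Sum>i<d. \<bar>coeff p i\<bar>) * \<bar>y\<bar> ^ (d - 1)"
      using assms(3) by (cases d) (simp_all add: abs_mult power_abs mult_ac)
    then have "\<bar>c\<bar> * \<bar>y\<bar> \<le> (\<Sum>i<d. \<bar>coeff p i\<bar>)" using False by (auto simp: mult_le_cancel_right)
    then have "\<bar>c\<bar> * (\<bar>c\<bar> * \<bar>y\<bar>) \<le> \<bar>c\<bar> * (\<Sum>i<d. \<bar>coeff p i\<bar>)" by (rule mult_left_mono) simp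
    then have "c\<^sup>2 * \<bar>y\<bar> \<le> (\<Sum>i<d. \<bar>c\<bar> * \<bar>coeff p i\<bar>)"
      by (simp add: sum_distrib_left power2_eq_square mult.assoc[symmetric])
    also have "\<dots> \<le> (\<Sum>i<d. c\<^sup>2 + (coeff p i)\<^sup>2)"
    proof (rule sum_mono)
      fix i
      have "0 \<le> (\<bar>c\<bar> - \<bar>coeff p i\<bar>)\<^sup>2" by simp
      then have "2 * (\<bar>c\<bar> * \<bar>coeff p i\<bar>) \<le> c\<^sup>2 + (coeff p i)\<^sup>2" by (simp add: power2_diff mult.assoc)
      moreover have "0 \<le> \<bar>c\<bar> * \<bar>coeff p i\<bar>" by simp
      ultimately show "\<bar>c\<bar> * \<bar>coeff p i\<bar> \<le> c\<^sup>2 + (coeff p i)\<^sup>2" by linarith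
    qed
    finally show "c\<^sup>2 * \<bar>y\<bar> < c\<^sup>2 + (\<Sum>i<d. c\<^sup>2 + (coeff p i)\<^sup>2)" using c by linarith
  qed
qed

text \<open>Separate from \<open>root_elim_leading\<close>, where the linear bounding polynomials
  must have degree at most d. Modulo a linear polynomial the remainders are constant in
  \<open>y\<close>, so their values are polynomial functions of the parameters.\<close>

lemma root_elim_linear:
  assumes Q: "Q \<in> fam m" "\<And>x. Polynomial.degree (Q x) \<le> 1" and A: "A \<in> dfn (polyfun (Suc m)) J"
  shows "{(x, g). coeff (Q x) 1 \<noteq> 0 \<and> (\<exists>y. poly (Q x) y = 0 \<and> (x(m := y), g) \<in> A)} \<in> dfn (polyfun m) J"
proof -
  define Z where "Z = {\<omega> :: (nat \<Rightarrow> 'k) \<times> (nat \<Rightarrow> 'g). coeff (Q (fst \<omega>)) 1 \<noteq> 0}"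
  define y where "y \<omega> = - coeff (Q (fst \<omega>)) 0 / coeff (Q (fst \<omega>)) 1" for \<omega> :: "(nat \<Rightarrow> 'k) \<times> (nat \<Rightarrow> 'g)"
  have Z: "Z \<in> dfn (polyfun m) J" unfolding Z_def by (rule dfn_pf_neq[OF fam_coeff[OF Q(1)] polyfun_const])
  have eval: "poly (Q x) z = coeff (Q x) 0 + coeff (Q x) 1 * z" for x z
    unfolding poly_eq_sum_le[OF Q(2)] by simp
  have root: "poly (Q (fst \<omega>)) z = 0 \<longleftrightarrow> z = y \<omega>" if "\<omega> \<in> Z" for \<omega> z
    using that unfolding eval Z_def y_def by (auto simp: field_simps add_eq_0_iff)
  obtain \<R> where \<R>: "\<R> \<subseteq> fam m" "\<forall>R\<in>\<R>. \<forall>x. Polynomial.degree (R x) < 1"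
    and sub: "\<And>M J' Z y. m \<le> M \<Longrightarrow> J \<subseteq> J' \<Longrightarrow>
      \<forall>\<omega>\<in>Z. coeff (Q (fst \<omega>)) 1 \<noteq> 0 \<and> poly (Q (fst \<omega>)) (y \<omega>) = 0 \<Longrightarrow>
      \<forall>R\<in>\<R>. tame (polyfun M) J' Z (\<lambda>\<omega>. poly (R (fst \<omega>)) (y \<omega>)) \<Longrightarrow>
      dfn_on (polyfun M) J' Z (\<lambda>\<omega>. ((fst \<omega>)(m := y \<omega>), snd \<omega>) \<in> A)"
    using dfn_subst_root[OF A Q zero_less_one] by blast
  have "dfn_on (polyfun m) J Z (\<lambda>\<omega>. ((fst \<omega>)(m := y \<omega>), snd \<omega>) \<in> A)"
  proof (rule sub)
    show "\<forall>\<omega>\<in>Z. coeff (Q (fst \<omega>)) 1 \<noteq> 0 \<and> poly (Q (fst \<omega>)) (y \<omega>) = 0"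
      using root by (auto simp: Z_def)
    show "\<forall>R\<in>\<R>. tame (polyfun m) J Z (\<lambda>\<omega>. poly (R (fst \<omega>)) (y \<omega>))"
    proof
      fix R assume R: "R \<in> \<R>"
      then have "poly (R x) z = coeff (R x) 0" for x z
        using \<R>(2) poly_eq_sum_le[of "R x" 0 z] by simp
      then show "tame (polyfun m) J Z (\<lambda>\<omega>. poly (R (fst \<omega>)) (y \<omega>))"
        using tame_polyfun[OF fam_coeff[of R m 0]] R \<R>(1) by auto
    qed
  qed simp_all
  from dfn_on_imp_dfn[OF this Z]
  have "{\<omega> \<in> Z. ((fst \<omega>)(m := y \<omega>), snd \<omega>) \<in> A} \<in> dfn (polyfun m) J" .
  moreover have "{\<omega> \<in> Z. ((fst \<omega>)(m := y \<omega>), snd \<omega>) \<in> A} =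
      {(x, g). coeff (Q x) 1 \<noteq> 0 \<and> (\<exists>y. poly (Q x) y = 0 \<and> (x(m := y), g) \<in> A)}"
  proof (intro equalityI subsetI)
    fix \<omega> assume "\<omega> \<in> {\<omega> \<in> Z. ((fst \<omega>)(m := y \<omega>), snd \<omega>) \<in> A}"
    then show "\<omega> \<in> {(x, g). coeff (Q x) 1 \<noteq> 0 \<and> (\<exists>y. poly (Q x) y = 0 \<and> (x(m := y), g) \<in> A)}"
      using root[of \<omega>] by (auto simp: Z_def split_beta)
  next
    fix \<omega> assume *: "\<omega> \<in> {(x, g). coeff (Q x) 1 \<noteq> 0 \<and> (\<exists>y. poly (Q x) y = 0 \<and> (x(m := y), g) \<in> A)}"
    then have "\<omega> \<in> Z" by (auto simp: Z_def)
    then show "\<omega> \<in> {\<omega> \<in> Z. ((fst \<omega>)(m := y \<omega>), snd \<omega>) \<in> A}" using * root[of \<omega>] by auto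
  qed
  ultimately show ?thesis by simp
qed

lemma dfn_slope:
  assumes Q: "Q \<in> fam m" "m \<le> M" "i < M" "N \<in> J"
  shows "{\<omega>. slope d (Q (fst \<omega>)) (fst \<omega> i) (snd \<omega> N)} \<in> dfn (polyfun M) J"
proof -
  have ev: "(\<lambda>x. poly ((pderiv ^^ k) (Q x)) (x i)) \<in> polyfun M" for k
    using fam_eval[OF fam_higher_pderiv[OF Q(1)] Q(2) polyfun_var[OF Q(3)]] .
  have ev0: "(\<lambda>x. poly (Q x) (x i)) \<in> polyfun M"
    using fam_eval[OF Q(1,2) polyfun_var[OF Q(3)]] .
  show ?thesis unfolding slope_def
    by (intro dfn_conj dfn_bex dfn_ball dfn_imp dfn_pf_neq[OF ev polyfun_const] dfn_lin_eq dfn_lin_le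
        lin_add lin_zmult lin_var lin_w[OF ev] lin_w[OF ev0] Q(4) finite_atLeastAtMost)
qed

lemma dfn_no_rts_between:
  assumes re: "root_elim d" and R: "finite \<R>" "\<R> \<subseteq> fam m" "Suc m < M"
    and deg: "\<forall>R\<in>\<R>. \<forall>x. Polynomial.degree (R x) \<le> d" and "finite J"
  shows "{\<omega>. \<forall>c\<in>rts \<R> (fst \<omega>). \<not> btw (fst \<omega> m) c (fst \<omega> (Suc m))} \<in> dfn (polyfun M) J"
proof -
  have v: "(\<lambda>x. x i) \<in> polyfun (Suc M)" if "i \<le> M" for i using that by (intro polyfun_var) simp
  have "{\<omega>. btw (fst \<omega> m) (fst \<omega> M) (fst \<omega> (Suc m))} \<in> dfn (polyfun (Suc M)) J"
    unfolding btw_def using R(3) by (intro dfn_disj dfn_conj dfn_pf_less v) auto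
  from dfn_ex_rts[OF re R(1,2) less_imp_le[OF Suc_lessD[OF R(3)]] deg this \<open>finite J\<close>]
  have "{(x, g). \<exists>y\<in>rts \<R> x. (x(M := y), g) \<in> {\<omega>. btw (fst \<omega> m) (fst \<omega> M) (fst \<omega> (Suc m))}} \<in> dfn (polyfun M) J" .
  from dfn_compl[OF this]
  show ?thesis by (rule back_subst[of "\<lambda>A. A \<in> _"]) (use R(3) in auto)
qed

text \<open>A root \<open>y\<close> of \<open>Q\<close> that is not a root of any polynomial of the family is located by the nearest
  root \<open>a\<close> of the family and the adjacent root \<open>b\<close> on the side of \<open>y\<close>: the sign of \<open>Q\<close> at the
  midpoint tells that \<open>y\<close> is closer to \<open>a\<close>, and the valuation \<open>t\<close> of \<open>y - a\<close> is the solution of a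
  tropical equation. In \<open>Zt\<close> the candidate \<open>y\<close> is held in the spare coordinate \<open>m + 2\<close>.\<close>

lemma root_elim_leading:
  assumes re: "root_elim d" and Q: "Q \<in> fam m" "\<And>x. Polynomial.degree (Q x) \<le> Suc d" and d: "d > 0"
    and A: "A \<in> dfn (polyfun (Suc m)) J" and J: "finite J"
  shows "{(x, g). coeff (Q x) (Suc d) \<noteq> 0 \<and> (\<exists>y. poly (Q x) y = 0 \<and> (x(m := y), g) \<in> A)} \<in> dfn (polyfun m) J"
proof -
  obtain N where N: "N \<notin> J" using ex_new_if_finite[OF infinite_UNIV_nat J] by blast
  obtain \<R>0 where \<R>0: "finite \<R>0" "\<R>0 \<subseteq> fam m" "\<forall>R\<in>\<R>0. \<forall>x. Polynomial.degree (R x) < Suc d"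
    and sub: "\<And>M J' Z y. m \<le> M \<Longrightarrow> J \<subseteq> J' \<Longrightarrow>
      \<forall>\<omega>\<in>Z. coeff (Q (fst \<omega>)) (Suc d) \<noteq> 0 \<and> poly (Q (fst \<omega>)) (y \<omega>) = 0 \<Longrightarrow>
      \<forall>R\<in>\<R>0. tame (polyfun M) J' Z (\<lambda>\<omega>. poly (R (fst \<omega>)) (y \<omega>)) \<Longrightarrow>
      dfn_on (polyfun M) J' Z (\<lambda>\<omega>. ((fst \<omega>)(m := y \<omega>), snd \<omega>) \<in> A)"
    using dfn_subst_root[OF A Q zero_less_Suc] by blast
  define c where "c x = (coeff (Q x) (Suc d))\<^sup>2" for x
  define s where "s x = c x + (\<Sum>i<Suc d. c x + (coeff (Q x) i)\<^sup>2)" for x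
  have cs: "c \<in> polyfun m" "s \<in> polyfun m"
    unfolding s_def c_def by (intro polyfun_add polyfun_sum polyfun_power fam_coeff Q(1))+
  \<comment> \<open>Q' makes \<open>Q\<close> monotone in every gap. The linear polynomials have the
    roots s / c and - s / c, which enclose all roots of \<open>Q\<close>, so each root of
    \<open>Q\<close> outside the family lies in a gap.\<close>
  define \<R> where "\<R> = \<R>0 \<union> {\<lambda>x. pderiv (Q x), \<lambda>x. [:- s x, c x:], \<lambda>x. [:s x, c x:]}"
  have \<R>: "finite \<R>" "\<R> \<subseteq> fam m"
    using \<R>0(1,2) fam_pderiv[OF Q(1)] cs unfolding \<R>_def
    by (auto intro!: fam_pCons fam_0 polyfun_uminus)
  have \<R>deg: "\<forall>R\<in>\<R>. \<forall>x. Polynomial.degree (R x) \<le> d"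
  proof (intro ballI allI)
    fix R x assume "R \<in> \<R>"
    then show "Polynomial.degree (R x) \<le> d"
      using \<R>0(3) Q(2)[of x] d unfolding \<R>_def by (auto simp: degree_pderiv less_Suc_eq_le)
  qed
  define \<D> where "\<D> = derivs d \<R>"
  have \<D>: "finite \<D>" "\<D> \<subseteq> fam m" "\<forall>R\<in>\<D>. \<forall>x. Polynomial.degree (R x) \<le> d"
    unfolding \<D>_def using finite_derivs[OF \<R>(1)] derivs_fam[OF \<R>(2)] derivs_degree[OF \<R>deg] by auto
  have nr: "noroots (R x) a b" if "R \<in> \<R>" "\<forall>c\<in>rts \<D> x. \<not> btw a c b" for R x a b
    using noroots_derivs[OF that(1), of x d] \<R>deg that unfolding \<D>_def by blast
  have nr': "noroots (pderiv (Q x)) a b" if "\<forall>c\<in>rts \<D> x. \<not> btw a c b" for x a b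
    using nr[of "\<lambda>x. pderiv (Q x)" x a b] that by (simp add: \<R>_def)
  have pd0: "pderiv (Q x) \<noteq> 0" if "coeff (Q x) (Suc d) \<noteq> 0" for x
    using that Q(2)[of x] le_degree[OF that] by (simp add: pderiv_eq_0_iff)
  let ?J = "insert N J"
  let ?M = "Suc (Suc m)"
  have v: "(\<lambda>x. x i) \<in> polyfun ?M" if "i < ?M" for i using that by (rule polyfun_var)
  define Zt where "Zt = {\<omega> :: (nat \<Rightarrow> 'k) \<times> (nat \<Rightarrow> 'g). coeff (Q (fst \<omega>)) (Suc d) \<noteq> 0 \<and>
    near (fst \<omega> m) (fst \<omega> (Suc m)) (fst \<omega> ?M) \<and> poly (Q (fst \<omega>)) (fst \<omega> ?M) = 0 \<and>
    (\<forall>c\<in>rts \<D> (fst \<omega>). \<not> btw (fst \<omega> m) c (fst \<omega> (Suc m))) \<and> w (fst \<omega> ?M - fst \<omega> m) = snd \<omega> N}"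
  have "dfn_on (polyfun ?M) ?J Zt (\<lambda>\<omega>. ((fst \<omega>)(m := fst \<omega> ?M), snd \<omega>) \<in> A)"
  proof (rule sub)
    show "\<forall>R\<in>\<R>0. tame (polyfun ?M) ?J Zt (\<lambda>\<omega>. poly (R (fst \<omega>)) (fst \<omega> ?M))"
    proof
      fix R assume R: "R \<in> \<R>0"
      then have "R \<in> fam m" "R \<in> \<R>" using \<R>0(2) by (auto simp: \<R>_def)
      show "tame (polyfun ?M) ?J Zt (\<lambda>\<omega>. poly (R (fst \<omega>)) (fst \<omega> ?M))"
      proof (rule tame_expansion[where f = "\<lambda>x. x m" and l = "\<lambda>\<omega>. snd \<omega> N" and
            E = "{\<omega>. fst \<omega> m < fst \<omega> (Suc m)}", OF \<open>R \<in> fam m\<close>])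
        show "(\<lambda>x. x m) \<in> polyfun ?M" by (rule v) simp
        show "(\<lambda>\<omega>. snd \<omega> N) \<in> lin (polyfun ?M) ?J" by (rule lin_var) simp
        show "{\<omega>. fst \<omega> m < fst \<omega> (Suc m)} \<in> dfn (polyfun ?M) ?J" by (rule dfn_pf_less; rule v) simp_all
        fix \<omega> assume \<omega>: "\<omega> \<in> Zt"
        then have n: "near (fst \<omega> m) (fst \<omega> (Suc m)) (fst \<omega> ?M)" by (simp add: Zt_def)
        then have b: "btw (fst \<omega> m) (fst \<omega> ?M) (fst \<omega> (Suc m))" by (simp add: near_def)
        show "fst \<omega> ?M \<noteq> fst \<omega> m" using b by (auto simp: btw_def)
        show "w (fst \<omega> ?M - fst \<omega> m) = snd \<omega> N" using \<omega> by (simp add: Zt_def)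
        show "fst \<omega> m < fst \<omega> ?M \<longleftrightarrow> \<omega> \<in> {\<omega>. fst \<omega> m < fst \<omega> (Suc m)}" using b by (auto simp: btw_def)
        have "noroots (R (fst \<omega>)) (fst \<omega> m) (fst \<omega> (Suc m))"
          using \<omega> by (intro nr \<open>R \<in> \<R>\<close>) (simp add: Zt_def)
        then show "noroots (R (fst \<omega>)) (fst \<omega> ?M - \<bar>fst \<omega> ?M - fst \<omega> m\<bar>) (fst \<omega> ?M + \<bar>fst \<omega> ?M - fst \<omega> m\<bar>)"
          by (rule noroots_mono) (rule near_btw[OF n])
      qed simp
    qed
  qed (auto simp: Zt_def)
  \<comment> \<open>Functions in \<open>polyfun ?M\<close> do not see coordinate \<open>?M\<close>.
    So on \<open>Zt\<close> the set \<open>B\<close> decides membership of \<open>y\<close> in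
    \<open>A\<close> from a, b and t alone.\<close>
  then obtain B where B: "B \<in> dfn (polyfun ?M) ?J"
    "\<And>\<omega>. \<omega> \<in> Zt \<Longrightarrow> ((fst \<omega>)(m := fst \<omega> ?M), snd \<omega>) \<in> A \<longleftrightarrow> \<omega> \<in> B"
    unfolding dfn_on_def by blast
  \<comment> \<open>The projection of \<open>Zt\<close> along \<open>y\<close>: existence of a root
    near \<open>a\<close> is a sign condition at the midpoint, and the valuation of its distance is
    the unique slope.\<close>
  define Zd where "Zd = {\<omega> :: (nat \<Rightarrow> 'k) \<times> (nat \<Rightarrow> 'g). coeff (Q (fst \<omega>)) (Suc d) \<noteq> 0 \<and>
    fst \<omega> m \<noteq> fst \<omega> (Suc m) \<and> (\<forall>c\<in>rts \<D> (fst \<omega>). \<not> btw (fst \<omega> m) c (fst \<omega> (Suc m))) \<and>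
    poly (Q (fst \<omega>)) (fst \<omega> m) \<noteq> 0 \<and>
    poly (Q (fst \<omega>)) (fst \<omega> m) * poly (Q (fst \<omega>)) ((fst \<omega> m + fst \<omega> (Suc m)) / 2) \<le> 0 \<and>
    slope (Suc d) (Q (fst \<omega>)) (fst \<omega> m) (snd \<omega> N)}"
  have vm: "(\<lambda>x. x m) \<in> polyfun ?M" by (rule v) simp
  have mid: "(\<lambda>x :: nat \<Rightarrow> 'k. (x m + x (Suc m)) / 2) \<in> polyfun ?M"
    using polyfun_mult[OF polyfun_add[OF vm v[of "Suc m"]] polyfun_const[of "1 / 2 :: 'k"]] by simp
  have mM: "m \<le> ?M" by simp
  note Qm = fam_eval[OF Q(1) mM vm] and Qc = fam_eval[OF Q(1) mM mid]
  have Zd: "Zd \<in> dfn (polyfun ?M) ?J"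
    unfolding Zd_def
    by (intro dfn_conj dfn_pf_neq[OF polyfun_mono[OF fam_coeff[OF Q(1)] mM] polyfun_const]
        dfn_pf_neq[OF vm v] dfn_pf_neq[OF Qm polyfun_const]
        dfn_pf_le[OF polyfun_mult[OF Qm Qc] polyfun_const] dfn_slope[OF Q(1) mM]
        dfn_no_rts_between[OF re \<D>(1,2) _ \<D>(3)]) (simp_all add: J)
  define W where "W = Zd \<inter> B"
  have W: "W \<in> dfn (polyfun ?M) ?J" unfolding W_def by (rule dfn_Int[OF Zd B(1)])
  \<comment> \<open>Now eliminate t, then \<open>b\<close>, then \<open>a\<close>; the last two are
    roots of a family of degree at most \<open>d\<close>.\<close>
  define W1 where "W1 = {(x, g). \<exists>t. (x, g(N := t)) \<in> W}"
  have W1: "W1 \<in> dfn (polyfun ?M) J" unfolding W1_def by (rule dfn_elim_gamma[OF W])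
  define W2 where "W2 = {(x, g). \<exists>b\<in>rts \<D> x. (x(Suc m := b), g) \<in> W1}"
  have W2: "W2 \<in> dfn (polyfun (Suc m)) J"
    unfolding W2_def by (rule dfn_ex_rts[OF re \<D>(1,2) _ \<D>(3) W1 J]) simp
  define W3 where "W3 = {(x, g). \<exists>a\<in>rts \<D> x. (x(m := a), g) \<in> W2}"
  have W3: "W3 \<in> dfn (polyfun m) J"
    unfolding W3_def by (rule dfn_ex_rts[OF re \<D>(1,2) _ \<D>(3) W2 J]) simp
  have A': "A \<inter> {\<omega>. poly (Q (fst \<omega>)) (fst \<omega> m) = 0} \<in> dfn (polyfun (Suc m)) J"
    by (intro dfn_Int A dfn_pf_eq[OF fam_eval[OF Q(1)] polyfun_const] polyfun_var) simp_all
  \<comment> \<open>The roots of \<open>Q\<close> that are themselves roots of the family.\<close>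
  define W0 where "W0 = {(x, g). \<exists>y\<in>rts \<D> x. (x(m := y), g) \<in> A \<inter> {\<omega>. poly (Q (fst \<omega>)) (fst \<omega> m) = 0}}"
  have W0: "W0 \<in> dfn (polyfun m) J"
    unfolding W0_def by (rule dfn_ex_rts[OF re \<D>(1,2) _ \<D>(3) A' J]) simp
  have Qcong: "Q (x(i := y)) = Q x" if "m \<le> i" for x i y
    by (rule fam_cong[OF Q(1)]) (use that in auto)
  have rcong: "rts \<D> (x(i := y)) = rts \<D> x" if "m \<le> i" for x i y
    by (rule rts_cong[OF \<D>(2)]) (use that in auto)
  have Bcong: "(x(?M := y), g) \<in> B \<longleftrightarrow> (x, g) \<in> B" for x y g
    by (rule dfn_polyfun_cong[OF B(1)]) auto
  have Acong: "(x(m := a, Suc m := b, ?M := y, m := y'), g(N := t)) \<in> A \<longleftrightarrow> (x(m := y'), g) \<in> A" for x a b y y' g t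
    by (rule dfn_polyfun_cong[OF A]) (use N in auto)
  have key: "(x(m := y), g) \<in> A \<longleftrightarrow> (x(m := a, Suc m := b), g(N := t)) \<in> B"
    if c: "coeff (Q x) (Suc d) \<noteq> 0" and y: "near a b y" "poly (Q x) y = 0"
      and nb: "\<forall>c\<in>rts \<D> x. \<not> btw a c b" and t: "w (y - a) = t" for x g y a b t
  proof -
    let ?x = "x(m := a, Suc m := b, ?M := y)"
    have "(?x, g(N := t)) \<in> Zt"
      unfolding Zt_def mem_Collect_eq fst_conv snd_conv using c y nb t by (simp add: Qcong rcong)
    from B(2)[OF this] have "(?x(m := y), g(N := t)) \<in> A \<longleftrightarrow> (?x, g(N := t)) \<in> B"
      unfolding fst_conv snd_conv by simp
    then show ?thesis unfolding Acong Bcong .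
  qed
  have eq: "(coeff (Q x) (Suc d) \<noteq> 0 \<and> (\<exists>y. poly (Q x) y = 0 \<and> (x(m := y), g) \<in> A)) \<longleftrightarrow>
      coeff (Q x) (Suc d) \<noteq> 0 \<and> ((x, g) \<in> W0 \<or> (x, g) \<in> W3)" (is "?L \<longleftrightarrow> ?R") for x g
  proof
    assume L: ?L
    then have c0: "coeff (Q x) (Suc d) \<noteq> 0" by blast
    obtain y where y: "poly (Q x) y = 0" "(x(m := y), g) \<in> A" using L by blast
    have "(x, g) \<in> W0 \<or> (x, g) \<in> W3"
    proof (cases "y \<in> rts \<D> x")
      case True
      have "(x(m := y), g) \<in> A \<inter> {\<omega>. poly (Q (fst \<omega>)) (fst \<omega> m) = 0}"
        using y by (simp add: Qcong)
      then show ?thesis unfolding W0_def using True by blast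
    next
      case False
      have c: "c x > 0" using c0 by (simp add: c_def)
      have bound: "c x * \<bar>y\<bar> < s x"
        unfolding c_def s_def by (rule cauchy_bound[OF Q(2) c0 zero_less_Suc y(1)])
      have mem: "R \<in> \<R> \<Longrightarrow> R x \<noteq> 0 \<Longrightarrow> poly (R x) z = 0 \<Longrightarrow> z \<in> rts \<D> x" for R z
        using rts_derivs_mono[of \<R> \<R> x d] unfolding \<D>_def rts_def by blast
      have "s x / c x \<in> rts \<D> x" "- (s x / c x) \<in> rts \<D> x"
        using mem[of "\<lambda>x. [:- s x, c x:]" "s x / c x"] mem[of "\<lambda>x. [:s x, c x:]" "- (s x / c x)"] c
        by (simp_all add: \<R>_def)
      moreover have "y < s x / c x" "- (s x / c x) < y"
      proof -
        have "c x * y \<le> c x * \<bar>y\<bar>" "c x * (- y) \<le> c x * \<bar>y\<bar>"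
          using c by (intro mult_left_mono; simp)+
        then have "c x * y < s x" "- (c x * y) < s x" using bound by simp_all
        then show "y < s x / c x" "- (s x / c x) < y" using c by (simp_all add: field_simps)
      qed
      ultimately obtain a b where ab: "a \<in> rts \<D> x" "b \<in> rts \<D> x" "near a b y" "\<forall>c\<in>rts \<D> x. \<not> btw a c b"
        using ex_adjacent_near[OF finite_rts[OF \<D>(1)] False] by blast
      define t where "t = w (y - a)"
      have B': "(x(m := a, Suc m := b), g(N := t)) \<in> B"
        using key[OF c0 ab(3) y(1) ab(4)] y(2) by (simp add: t_def)
      have "a \<noteq> b" using ab(3) by (auto simp: near_def btw_def)
      then have "(x(m := a, Suc m := b), g(N := t)) \<in> Zd"
        unfolding Zd_def mem_Collect_eq fst_conv snd_conv t_def
        using c0 ab(4) slope_root[OF nr'[OF ab(4)] pd0[OF c0] ab(3) y(1) Q(2)]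
          near_root_sign[OF nr'[OF ab(4)] pd0[OF c0] ab(3) y(1)]
        by (simp add: Qcong rcong)
      then have "(x(m := a, Suc m := b), g) \<in> W1" unfolding W1_def W_def using B' by blast
      then have "(x(m := a), g) \<in> W2" unfolding W2_def using ab(2) rcong[of m x a] by auto
      then show ?thesis unfolding W3_def using ab(1) by blast
    qed
    then show ?R using c0 by blast
  next
    assume R: ?R
    then have c0: "coeff (Q x) (Suc d) \<noteq> 0" by blast
    consider "(x, g) \<in> W0" | "(x, g) \<in> W3" using R by blast
    then have "\<exists>y. poly (Q x) y = 0 \<and> (x(m := y), g) \<in> A"
    proof cases
      case 1
      then show ?thesis unfolding W0_def by (auto simp: Qcong)
    next
      case 2
      then obtain a b t where W: "(x(m := a, Suc m := b), g(N := t)) \<in> W"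
        unfolding W3_def W2_def W1_def by blast
      then have B': "(x(m := a, Suc m := b), g(N := t)) \<in> B" unfolding W_def by blast
      have "(x(m := a, Suc m := b), g(N := t)) \<in> Zd" using W unfolding W_def by blast
      then have Z: "a \<noteq> b" "\<forall>c\<in>rts \<D> x. \<not> btw a c b" "poly (Q x) a \<noteq> 0"
        "poly (Q x) a * poly (Q x) ((a + b) / 2) \<le> 0" "slope (Suc d) (Q x) a t"
        unfolding Zd_def mem_Collect_eq fst_conv snd_conv by (simp_all add: Qcong rcong)
      obtain y where y: "near a b y" "poly (Q x) y = 0" using near_root_exists[OF Z(1,3,4)] by blast
      have "w (y - a) = t"
        using slope_unique[OF slope_root(1)[OF nr'[OF Z(2)] pd0[OF c0] y Q(2)] Z(5)] .
      from key[OF c0 y Z(2) this] show ?thesis using B' y(2) by blast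
    qed
    then show ?L using c0 by blast
  qed
  have "{\<omega>. coeff (Q (fst \<omega>)) (Suc d) \<noteq> 0 \<and> (\<omega> \<in> W0 \<or> \<omega> \<in> W3)} \<in> dfn (polyfun m) J"
    by (intro dfn_conj dfn_disj dfn_mem W0 W3 dfn_pf_neq[OF fam_coeff[OF Q(1)] polyfun_const])
  then show ?thesis by (rule back_subst[of "\<lambda>A. A \<in> _"]) (use eq in auto)
qed

lemma root_elim: "root_elim d"
proof (induction d)
  case 0
  show ?case unfolding root_elim_def
  proof (intro allI impI)
    fix m J and A :: "((nat \<Rightarrow> 'k) \<times> (nat \<Rightarrow> 'g)) set" and Q :: "(nat \<Rightarrow> 'k) \<Rightarrow> 'k poly"
    assume "\<forall>x. Polynomial.degree (Q x) \<le> 0"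
    then have "\<not> (Q x \<noteq> 0 \<and> poly (Q x) y = 0)" for x y
      by (metis degree_eq_zeroE le_zero_eq pCons_0_0 poly_const_conv)
    then have "{(x, g). \<exists>y. Q x \<noteq> 0 \<and> poly (Q x) y = 0 \<and> (x(m := y), g) \<in> A} = {\<omega>. False}" by blast
    show "{(x, g). \<exists>y. Q x \<noteq> 0 \<and> poly (Q x) y = 0 \<and> (x(m := y), g) \<in> A} \<in> dfn (polyfun m) J"
      unfolding \<open>_ = {\<omega>. False}\<close> by (rule dfn_False)
  qed
next
  case (Suc d)
  show ?case unfolding root_elim_def
  proof (intro allI impI)
    fix m J A and Q :: "(nat \<Rightarrow> 'k) \<Rightarrow> 'k poly"
    assume Q: "Q \<in> fam m" "\<forall>x. Polynomial.degree (Q x) \<le> Suc d" and J: "finite J"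
      and A: "A \<in> dfn (polyfun (Suc m)) J"
    have deg: "Polynomial.degree (Q x) \<le> Suc d" for x using Q(2) by blast
    \<comment> \<open>Where the formal leading coefficient vanishes, \<open>Q\<close> agrees with
      \<open>Q0\<close>, whose degree is at most \<open>d\<close> for all parameters, as the
      induction hypothesis demands.\<close>
    define Q0 where "Q0 x = Q x - Polynomial.monom (coeff (Q x) (Suc d)) (Suc d)" for x
    have Q0: "Q0 \<in> fam m" unfolding Q0_def by (intro fam_diff fam_monom fam_coeff Q(1))
    have "\<forall>x. Polynomial.degree (Q0 x) \<le> d"
      by (intro allI degree_le impI) (auto simp: Q0_def coeff_eq_0 less_Suc_eq_le le_less_trans[OF deg])
    then have 1: "{(x, g). \<exists>y. Q0 x \<noteq> 0 \<and> poly (Q0 x) y = 0 \<and> (x(m := y), g) \<in> A} \<in> dfn (polyfun m) J" (is "?S \<in> _")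
      using Suc Q0 J A unfolding root_elim_def by blast
    have 2: "{(x, g). coeff (Q x) (Suc d) \<noteq> 0 \<and> (\<exists>y. poly (Q x) y = 0 \<and> (x(m := y), g) \<in> A)} \<in> dfn (polyfun m) J" (is "?T \<in> _")
    proof (cases "d = 0")
      case True
      then show ?thesis using root_elim_linear[OF Q(1) _ A] deg by simp
    next
      case False
      then show ?thesis using root_elim_leading[OF Suc Q(1) deg _ A J] by simp
    qed
    have main: "{\<omega>. coeff (Q (fst \<omega>)) (Suc d) = 0 \<and> \<omega> \<in> ?S \<or> \<omega> \<in> ?T} \<in> dfn (polyfun m) J"
      by (intro dfn_disj dfn_conj dfn_mem 1 2 dfn_pf_eq[OF fam_coeff[OF Q(1)] polyfun_const])
    have iff: "\<omega> \<in> {(x, g). \<exists>y. Q x \<noteq> 0 \<and> poly (Q x) y = 0 \<and> (x(m := y), g) \<in> A} \<longleftrightarrow>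
        coeff (Q (fst \<omega>)) (Suc d) = 0 \<and> \<omega> \<in> ?S \<or> \<omega> \<in> ?T" for \<omega>
    proof (cases "coeff (Q (fst \<omega>)) (Suc d) = 0")
      case True
      then show ?thesis by (auto simp: Q0_def split_beta)
    next
      case False
      then have "Q (fst \<omega>) \<noteq> 0" by auto
      then show ?thesis using False by (auto simp: split_beta)
    qed
    show "{(x, g). \<exists>y. Q x \<noteq> 0 \<and> poly (Q x) y = 0 \<and> (x(m := y), g) \<in> A} \<in> dfn (polyfun m) J"
      by (rule back_subst[of "\<lambda>A. A \<in> _", OF main], rule Set.set_eqI, subst iff, rule mem_Collect_eq)
  qed
qed

section \<open>Elimination of an unconstrained field variable\<close>

lemma ex_point_at_distance:
  assumes "finite S" "\<And>c. c \<in> S \<Longrightarrow> a < c \<Longrightarrow> t \<le> w (c - a)"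
  shows "\<exists>y>a. w (y - a) = t \<and> (\<forall>c\<in>S. \<not> btw a c (2 * y - a))"
proof -
  obtain z where z: "z > 0" "w z = t" using ex_pos_w by blast
  define U where "U = {c \<in> S. a < c}"
  have fin: "finite U" using assms(1) by (simp add: U_def)
  show ?thesis
  proof (cases "U = {}")
    case True
    then have "\<forall>c\<in>S. \<not> btw a c (2 * (a + z) - a)" using z(1) by (auto simp: U_def btw_def)
    then show ?thesis using z by (intro exI[of _ "a + z"]) simp
  next
    case False
    define m where "m = Min U"
    have m: "m \<in> S" "a < m" "\<And>c. c \<in> S \<Longrightarrow> a < c \<Longrightarrow> m \<le> c"
      using Min_in[OF fin False] Min_le[OF fin] by (auto simp: U_def m_def)
    \<comment> \<open>Half the distance to the next root \<open>m\<close> keeps the mirror image of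
      \<open>a\<close> from passing \<open>m\<close>. Cutting \<open>z\<close> down to it can only
      happen when m - a itself has valuation t, so the valuation of \<open>h\<close> is still
      t.\<close>
    define h where "h = min z ((m - a) / 2)"
    have "h > 0" using z(1) m(2) by (simp add: h_def)
    moreover have "h \<le> (m - a) / 2" unfolding h_def by (rule min.cobounded2)
    ultimately have h: "h > 0" "h \<le> (m - a) / 2" by blast+
    have "w h = t"
    proof (cases "z \<le> (m - a) / 2")
      case True
      then show ?thesis using z(2) by (simp add: h_def)
    next
      case False
      then have h_eq: "h = (m - a) / 2" by (simp add: h_def)
      have "w (e / 2) = w e" if "e > 0" for e using w_mult[of "e / 2" 2] that by simp
      then have w2: "w ((m - a) / 2) = w (m - a)" using m(2) by simp
      have "\<bar>h\<bar> \<le> \<bar>z\<bar>" using h(1) z(1) by (simp add: h_def)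
      then have "(m - a) / 2 \<preceq> z" unfolding h_eq by (rule abs_le_imp_dom)
      then have "w (m - a) \<le> t" using z m(2) w2 by (simp add: dom_iff)
      then show ?thesis using assms(2)[OF m(1,2)] w2 unfolding h_eq by (simp only: order_antisym)
    qed
    moreover have "\<not> btw a c (2 * (a + h) - a)" if "c \<in> S" for c
    proof -
      have "2 * h \<le> m - a" using h(2) by (simp add: le_divide_eq mult.commute)
      then show ?thesis using m(3)[OF that] h(1) unfolding btw_def by auto
    qed
    ultimately show ?thesis using h(1) by (intro exI[of _ "a + h"] conjI ballI) simp_all
  qed
qed

text \<open>The sign \<open>s\<close> encodes the side of \<open>a\<close>; the left side is the
  reflected right side.\<close>

lemma ex_point_at_distance_dir:
  fixes s :: 'k
  assumes "finite S" "s\<^sup>2 = 1" "\<And>c. c \<in> S \<Longrightarrow> s * a < s * c \<Longrightarrow> t \<le> w (c - a)"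
  shows "\<exists>y. s * a < s * y \<and> w (y - a) = t \<and> (\<forall>c\<in>S. \<not> btw a c (2 * y - a))"
proof -
  have s: "s = 1 \<or> s = -1" using assms(2) by (simp add: power2_eq_1_iff)
  then show ?thesis
  proof
    assume "s = 1"
    then show ?thesis using ex_point_at_distance[OF assms(1), of a t] assms(3) by simp
  next
    assume s: "s = -1"
    have "\<exists>y>- a. w (y - - a) = t \<and> (\<forall>c\<in>uminus ` S. \<not> btw (- a) c (2 * y - - a))"
    proof (rule ex_point_at_distance)
      fix c assume "c \<in> uminus ` S" "- a < c"
      then obtain b where b: "b \<in> S" "c = - b" "b < a" by auto
      then have "t \<le> w (b - a)" using assms(3)[of b] s by simp
      also have "w (b - a) = w (c - - a)" using w_minus[of "b - a"] b(2) by simp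
      finally show "t \<le> w (c - - a)" .
    qed (simp add: assms(1))
    then obtain y where y: "- a < y" "w (y - - a) = t" "\<forall>c\<in>S. \<not> btw (- a) (- c) (2 * y - - a)" by auto
    have "w (- y - a) = t" using y(2) w_minus[of "y - - a"] by simp
    moreover have "\<forall>c\<in>S. \<not> btw a c (2 * (- y) - a)"
      using y(3) unfolding btw_def by auto
    ultimately show ?thesis using y(1) s by (intro exI[of _ "- y"]) auto
  qed
qed

lemma ex_nearest:
  fixes y :: 'k
  assumes "finite S" "S \<noteq> {}"
  obtains a where "a \<in> S" "\<And>c. c \<in> S \<Longrightarrow> \<bar>y - a\<bar> \<le> \<bar>y - c\<bar>"
proof -
  have "Min ((\<lambda>c. \<bar>y - c\<bar>) ` S) \<in> (\<lambda>c. \<bar>y - c\<bar>) ` S" using assms by (intro Min_in) auto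
  then obtain a where "a \<in> S" "\<bar>y - a\<bar> = Min ((\<lambda>c. \<bar>y - c\<bar>) ` S)" by auto
  then show ?thesis using that[of a] assms(1) by simp
qed

text \<open>Points \<open>y\<close> off the roots of the family: the signs and valuations at \<open>y\<close> only depend on the
  nearest root \<open>a\<close>, the side \<open>s\<close> of \<open>a\<close> on which \<open>y\<close> lies, and the valuation \<open>t\<close> of \<open>y - a\<close>.\<close>

lemma dfn_elim:
  assumes A: "A \<in> dfn (polyfun (Suc m)) J" and J: "finite J"
  shows "{(x, g). \<exists>y. (x(m := y), g) \<in> A} \<in> dfn (polyfun m) J"
proof -
  obtain N where N: "N \<notin> J" using ex_new_if_finite[OF infinite_UNIV_nat J] by blast
  obtain \<R>0 where \<R>0: "finite \<R>0" "\<R>0 \<subseteq> fam m"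
    and sub: "\<And>M J' Z y. J \<subseteq> J' \<Longrightarrow>
      \<forall>R\<in>\<R>0. tame (polyfun M) J' Z (\<lambda>\<omega>. poly (R (fst \<omega>)) (y \<omega>)) \<Longrightarrow>
      dfn_on (polyfun M) J' Z (\<lambda>\<omega>. ((fst \<omega>)(m := y \<omega>), snd \<omega>) \<in> A)"
    using dfn_subst_generic[OF A] by blast
  \<comment> \<open>The added polynomial has the root 0, so the family always has a root and a
    nearest one exists.\<close>
  define \<R> where "\<R> = insert (\<lambda>_. [:0, 1:]) \<R>0"
  have \<R>: "finite \<R>" "\<R> \<subseteq> fam m"
    using \<R>0 unfolding \<R>_def by (auto intro!: fam_pCons fam_0 polyfun_const)
  have "\<forall>R\<in>\<R>. \<exists>d. \<forall>x. Polynomial.degree (R x) \<le> d" using \<R>(2) unfolding fam_def by blast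
  then obtain D where D: "\<forall>R\<in>\<R>. \<forall>x. Polynomial.degree (R x) \<le> D R" by (rule bchoice[elim_format]) blast
  define d where "d = Max (D ` \<R>)"
  have \<R>deg: "\<forall>R\<in>\<R>. \<forall>x. Polynomial.degree (R x) \<le> d"
  proof (intro ballI allI)
    fix R x assume "R \<in> \<R>"
    then have "D R \<le> d" unfolding d_def using \<R>(1) by simp
    then show "Polynomial.degree (R x) \<le> d" using D \<open>R \<in> \<R>\<close> le_trans by blast
  qed
  define \<D> where "\<D> = derivs d \<R>"
  have \<D>: "finite \<D>" "\<D> \<subseteq> fam m" "\<forall>R\<in>\<D>. \<forall>x. Polynomial.degree (R x) \<le> d"
    unfolding \<D>_def using finite_derivs[OF \<R>(1)] derivs_fam[OF \<R>(2)] derivs_degree[OF \<R>deg] by auto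
  have nr: "noroots (R x) a b" if "R \<in> \<R>" "\<forall>c\<in>rts \<D> x. \<not> btw a c b" for R x a b
    using noroots_derivs[OF that(1), of x d] \<R>deg that unfolding \<D>_def by blast
  have "0 \<in> rts \<R> x" for x unfolding rts_def \<R>_def by simp
  then have ne: "rts \<D> x \<noteq> {}" for x
    using rts_derivs_mono[of \<R> \<R> x d] unfolding \<D>_def by blast
  let ?J = "insert N J"
  let ?M = "Suc m"
  have vm: "(\<lambda>x. x m) \<in> polyfun ?M" by (rule polyfun_var) simp
  have Acong: "(x(m := a, ?M := y, m := y'), g(N := t)) \<in> A \<longleftrightarrow> (x(m := y'), g) \<in> A" for x a y y' g t
    by (rule dfn_polyfun_cong[OF A]) (use N in auto)
  have rcong: "rts \<D> (x(i := y)) = rts \<D> x" if "m \<le> i" for x i y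
    by (rule rts_cong[OF \<D>(2)]) (use that in auto)
  \<comment> \<open>2 y - a is the mirror image of \<open>a\<close> at \<open>y\<close>. The
    condition on it holds for a nearest root \<open>a\<close>, and it leaves the interval about
    \<open>y\<close> with endpoint \<open>a\<close> free of roots.\<close>
  have side: "\<exists>W\<in>dfn (polyfun m) J. \<forall>x g. (x, g) \<in> W \<longleftrightarrow>
      (\<exists>a\<in>rts \<D> x. \<exists>y. (\<forall>c\<in>rts \<D> x. \<not> btw a c (2 * y - a)) \<and> s * a < s * y \<and> (x(m := y), g) \<in> A)"
    if s: "s\<^sup>2 = 1" for s :: 'k
  proof -
    define Zt where "Zt = {\<omega> :: (nat \<Rightarrow> 'k) \<times> (nat \<Rightarrow> 'g). s * fst \<omega> m < s * fst \<omega> ?M \<and>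
      w (fst \<omega> ?M - fst \<omega> m) = snd \<omega> N \<and> (\<forall>c\<in>rts \<D> (fst \<omega>). \<not> btw (fst \<omega> m) c (2 * fst \<omega> ?M - fst \<omega> m))}"
    have s1: "s = 1 \<or> s = -1" using s by (simp add: power2_eq_1_iff)
    have "dfn_on (polyfun ?M) ?J Zt (\<lambda>\<omega>. ((fst \<omega>)(m := fst \<omega> ?M), snd \<omega>) \<in> A)"
    proof (rule sub)
      show "\<forall>R\<in>\<R>0. tame (polyfun ?M) ?J Zt (\<lambda>\<omega>. poly (R (fst \<omega>)) (fst \<omega> ?M))"
      proof
        fix R assume R: "R \<in> \<R>0"
        then have "R \<in> fam m" "R \<in> \<R>" using \<R>0(2) by (auto simp: \<R>_def)
        show "tame (polyfun ?M) ?J Zt (\<lambda>\<omega>. poly (R (fst \<omega>)) (fst \<omega> ?M))"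
        proof (rule tame_expansion[where f = "\<lambda>x. x m" and l = "\<lambda>\<omega>. snd \<omega> N" and
              E = "{\<omega>. s = 1}", OF \<open>R \<in> fam m\<close>])
          show "(\<lambda>x. x m) \<in> polyfun ?M" by (rule vm)
          show "(\<lambda>\<omega>. snd \<omega> N) \<in> lin (polyfun ?M) ?J" by (rule lin_var) simp
          show "{\<omega>. s = 1} \<in> dfn (polyfun ?M) ?J" by (rule dfn_const)
          fix \<omega> assume \<omega>: "\<omega> \<in> Zt"
          then have b: "s * fst \<omega> m < s * fst \<omega> ?M" by (simp add: Zt_def)
          then show "fst \<omega> ?M \<noteq> fst \<omega> m" by auto
          show "w (fst \<omega> ?M - fst \<omega> m) = snd \<omega> N" using \<omega> by (simp add: Zt_def)
          show "fst \<omega> m < fst \<omega> ?M \<longleftrightarrow> \<omega> \<in> {\<omega>. s = 1}" using b s1 by auto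
          have "noroots (R (fst \<omega>)) (fst \<omega> m) (2 * fst \<omega> ?M - fst \<omega> m)"
            using \<omega> by (intro nr \<open>R \<in> \<R>\<close>) (simp add: Zt_def)
          then show "noroots (R (fst \<omega>)) (fst \<omega> ?M - \<bar>fst \<omega> ?M - fst \<omega> m\<bar>) (fst \<omega> ?M + \<bar>fst \<omega> ?M - fst \<omega> m\<bar>)"
            by (rule noroots_mono) (auto simp: btw_def abs_if split: if_splits)
        qed simp
      qed
    qed auto
    then obtain B where B: "B \<in> dfn (polyfun ?M) ?J"
      "\<And>\<omega>. \<omega> \<in> Zt \<Longrightarrow> ((fst \<omega>)(m := fst \<omega> ?M), snd \<omega>) \<in> A \<longleftrightarrow> \<omega> \<in> B"
      unfolding dfn_on_def by blast
    have Bcong: "(x(?M := y), g) \<in> B \<longleftrightarrow> (x, g) \<in> B" for x y g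
      by (rule dfn_polyfun_cong[OF B(1)]) auto
    have key: "(x(m := y), g) \<in> A \<longleftrightarrow> (x(m := a), g(N := t)) \<in> B"
      if h: "s * a < s * y" "w (y - a) = t" "\<forall>c\<in>rts \<D> x. \<not> btw a c (2 * y - a)" for x g y a t
    proof -
      let ?x = "x(m := a, ?M := y)"
      have "(?x, g(N := t)) \<in> Zt"
        unfolding Zt_def mem_Collect_eq fst_conv snd_conv using h by (simp add: rcong)
      from B(2)[OF this] have "(?x(m := y), g(N := t)) \<in> A \<longleftrightarrow> (?x, g(N := t)) \<in> B"
        unfolding fst_conv snd_conv by simp
      then show ?thesis unfolding Acong Bcong .
    qed
    define C where "C = {\<omega> :: (nat \<Rightarrow> 'k) \<times> (nat \<Rightarrow> 'g).
      s * fst \<omega> m < s * fst \<omega> ?M \<and> w (fst \<omega> ?M - fst \<omega> m) < snd \<omega> N}"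
    have v2: "(\<lambda>x. x i) \<in> polyfun (Suc ?M)" if "i < Suc ?M" for i using that by (rule polyfun_var)
    have C: "C \<in> dfn (polyfun (Suc ?M)) ?J" unfolding C_def
      by (intro dfn_conj dfn_pf_less polyfun_mult polyfun_const v2 dfn_lin_less lin_var lin_w polyfun_diff) simp_all
    \<comment> \<open>The projection of \<open>Zt\<close> along \<open>y\<close>: a suitable
      \<open>y\<close> exists exactly if no root on the side \<open>s\<close> has distance from
      \<open>a\<close> of valuation below t. The coordinate \<open>?M\<close> now holds that other
      root.\<close>
    define Zd where "Zd = - {(x, g). \<exists>c\<in>rts \<D> x. (x(?M := c), g) \<in> C}"
    have Zd: "Zd \<in> dfn (polyfun ?M) ?J" unfolding Zd_def
      by (rule dfn_compl, rule dfn_ex_rts[OF root_elim \<D>(1,2) _ \<D>(3) C]) (simp_all add: J)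
    have Zd_iff: "(x(m := a), g(N := t)) \<in> Zd \<longleftrightarrow> (\<forall>c\<in>rts \<D> x. s * a < s * c \<longrightarrow> t \<le> w (c - a))" for x a g t
      unfolding Zd_def C_def by (simp add: rcong not_less imp_conv_disj)
    define W1 where "W1 = {(x, g). \<exists>t. (x, g(N := t)) \<in> Zd \<inter> B}"
    have W1: "W1 \<in> dfn (polyfun ?M) J" unfolding W1_def by (rule dfn_elim_gamma[OF dfn_Int[OF Zd B(1)]])
    define W where "W = {(x, g). \<exists>a\<in>rts \<D> x. (x(m := a), g) \<in> W1}"
    have W: "W \<in> dfn (polyfun m) J"
      unfolding W_def by (rule dfn_ex_rts[OF root_elim \<D>(1,2) _ \<D>(3) W1 J]) simp
    have "(\<exists>t. (x(m := a), g(N := t)) \<in> Zd \<inter> B) \<longleftrightarrow>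
      (\<exists>y. (\<forall>c\<in>rts \<D> x. \<not> btw a c (2 * y - a)) \<and> s * a < s * y \<and> (x(m := y), g) \<in> A)" for x g a
    proof
      assume "\<exists>t. (x(m := a), g(N := t)) \<in> Zd \<inter> B"
      then obtain t where t: "(x(m := a), g(N := t)) \<in> Zd" "(x(m := a), g(N := t)) \<in> B" by blast
      have "t \<le> w (c - a)" if "c \<in> rts \<D> x" "s * a < s * c" for c
        using t(1) that unfolding Zd_iff by blast
      from ex_point_at_distance_dir[OF finite_rts[OF \<D>(1)] s this]
      obtain y where y: "s * a < s * y" "w (y - a) = t" "\<forall>c\<in>rts \<D> x. \<not> btw a c (2 * y - a)" by blast
      then show "\<exists>y. (\<forall>c\<in>rts \<D> x. \<not> btw a c (2 * y - a)) \<and> s * a < s * y \<and> (x(m := y), g) \<in> A"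
        using key[OF y] t(2) by blast
    next
      assume "\<exists>y. (\<forall>c\<in>rts \<D> x. \<not> btw a c (2 * y - a)) \<and> s * a < s * y \<and> (x(m := y), g) \<in> A"
      then obtain y where y: "s * a < s * y" "\<forall>c\<in>rts \<D> x. \<not> btw a c (2 * y - a)" "(x(m := y), g) \<in> A" by blast
      have "w (y - a) \<le> w (c - a)" if c: "c \<in> rts \<D> x" "s * a < s * c" for c
      proof -
        have "\<not> btw a c (2 * y - a)" using y(2) c(1) by blast
        then have "\<bar>y - a\<bar> \<le> \<bar>c - a\<bar>" using y(1) c(2) s1 by (auto simp: btw_def)
        then have "y - a \<preceq> c - a" by (rule abs_le_imp_dom)
        moreover have "y - a \<noteq> 0" using y(1) by auto
        ultimately show ?thesis by (simp add: dom_iff)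
      qed
      then have "(x(m := a), g(N := w (y - a))) \<in> Zd" unfolding Zd_iff by blast
      moreover have "(x(m := a), g(N := w (y - a))) \<in> B" using key[OF y(1) refl y(2)] y(3) by blast
      ultimately show "\<exists>t. (x(m := a), g(N := t)) \<in> Zd \<inter> B" by blast
    qed
    then have "(x, g) \<in> W \<longleftrightarrow> (\<exists>a\<in>rts \<D> x. \<exists>y. (\<forall>c\<in>rts \<D> x. \<not> btw a c (2 * y - a)) \<and>
        s * a < s * y \<and> (x(m := y), g) \<in> A)" for x g
      unfolding W_def W1_def by simp
    then show ?thesis using W by blast
  qed
  obtain W1 where W1: "W1 \<in> dfn (polyfun m) J" "\<And>x g. (x, g) \<in> W1 \<longleftrightarrow>
      (\<exists>a\<in>rts \<D> x. \<exists>y. (\<forall>c\<in>rts \<D> x. \<not> btw a c (2 * y - a)) \<and> 1 * a < 1 * y \<and> (x(m := y), g) \<in> A)"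
    using side[of 1] by auto
  obtain W2 where W2: "W2 \<in> dfn (polyfun m) J" "\<And>x g. (x, g) \<in> W2 \<longleftrightarrow>
      (\<exists>a\<in>rts \<D> x. \<exists>y. (\<forall>c\<in>rts \<D> x. \<not> btw a c (2 * y - a)) \<and> (-1) * a < (-1) * y \<and> (x(m := y), g) \<in> A)"
    using side[of "-1"] by auto
  define W0 where "W0 = {(x, g). \<exists>y\<in>rts \<D> x. (x(m := y), g) \<in> A}"
  have W0: "W0 \<in> dfn (polyfun m) J"
    unfolding W0_def by (rule dfn_ex_rts[OF root_elim \<D>(1,2) _ \<D>(3) A J]) simp
  have eq: "(\<exists>y. (x(m := y), g) \<in> A) \<longleftrightarrow> (x, g) \<in> W0 \<or> (x, g) \<in> W1 \<or> (x, g) \<in> W2" for x g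
  proof
    assume "\<exists>y. (x(m := y), g) \<in> A"
    then obtain y where y: "(x(m := y), g) \<in> A" by blast
    show "(x, g) \<in> W0 \<or> (x, g) \<in> W1 \<or> (x, g) \<in> W2"
    proof (cases "y \<in> rts \<D> x")
      case True
      then show ?thesis using y unfolding W0_def by blast
    next
      case False
      obtain a where a: "a \<in> rts \<D> x" "\<And>c. c \<in> rts \<D> x \<Longrightarrow> \<bar>y - a\<bar> \<le> \<bar>y - c\<bar>"
        using ex_nearest[OF finite_rts[OF \<D>(1)] ne] by blast
      have nb: "\<forall>c\<in>rts \<D> x. \<not> btw a c (2 * y - a)"
      proof (intro ballI notI)
        fix c assume "c \<in> rts \<D> x" "btw a c (2 * y - a)"
        then show False using a(2)[of c] by (auto simp: btw_def abs_if split: if_splits)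
      qed
      have "a < y \<or> y < a" using a(1) False by (metis linorder_neqE)
      then have "1 * a < 1 * y \<or> (-1) * a < (-1) * y" by simp
      then show ?thesis unfolding W1(2) W2(2) using a(1) nb y by blast
    qed
  next
    assume "(x, g) \<in> W0 \<or> (x, g) \<in> W1 \<or> (x, g) \<in> W2"
    then show "\<exists>y. (x(m := y), g) \<in> A" unfolding W0_def W1(2) W2(2) by blast
  qed
  have "{\<omega>. \<omega> \<in> W0 \<or> \<omega> \<in> W1 \<or> \<omega> \<in> W2} \<in> dfn (polyfun m) J"
    by (intro dfn_disj dfn_mem W0 W1(1) W2(1))
  then show ?thesis by (rule back_subst[of "\<lambda>A. A \<in> _"]) (use eq in auto)
qed

text \<open>The field argument remains as a dummy, since sets in \<open>dfn (polyfun 0) J\<close> do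
  not depend on it.\<close>

lemma dfn_elim_all:
  assumes "A \<in> dfn (polyfun m) J" "finite J"
  shows "\<exists>B\<in>dfn (polyfun 0) J. \<forall>x g. (x, g) \<in> B \<longleftrightarrow> (\<exists>x. (x, g) \<in> A)"
  using assms(1)
proof (induction m arbitrary: A)
  case 0
  have "(x, g) \<in> A \<longleftrightarrow> (x', g) \<in> A" for x x' g by (rule dfn_polyfun_cong[OF 0]) simp_all
  then show ?case using 0 by blast
next
  case (Suc m)
  obtain B where B: "B \<in> dfn (polyfun 0) J"
    "\<forall>x g. (x, g) \<in> B \<longleftrightarrow> (\<exists>x. (x, g) \<in> {(x, g). \<exists>y. (x(m := y), g) \<in> A})"
    using Suc.IH[OF dfn_elim[OF Suc.prems assms(2)]] by blast
  have "(\<exists>x. (x, g) \<in> {(x, g). \<exists>y. (x(m := y), g) \<in> A}) \<longleftrightarrow> (\<exists>x. (x, g) \<in> A)" for g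
  proof
    assume "\<exists>x. (x, g) \<in> A"
    then obtain x where "(x, g) \<in> A" by blast
    then have "(x(m := x m), g) \<in> A" by simp
    then show "\<exists>x. (x, g) \<in> {(x, g). \<exists>y. (x(m := y), g) \<in> A}" by blast
  qed blast
  then show ?case using B(2) by (intro bexI[OF _ B(1)] allI) simp
qed

end

section \<open>Semilinear sets\<close>

lemma linear_form_add: "linear_form I (\<lambda>k. a k + b k) g = linear_form I a g + linear_form I b g"
  by (simp add: linear_form_def zmult_add_left sum.distrib)

lemma linear_form_uminus: "linear_form I (\<lambda>k. - a k) g = - linear_form I a g"
  by (simp add: linear_form_def sum_negf)

lemma linear_form_0: "linear_form I (\<lambda>_. 0) g = 0"
  by (simp add: linear_form_def)

lemma linear_form_unit: "finite I \<Longrightarrow> j \<in> I \<Longrightarrow> linear_form I (\<lambda>k. if k = j then 1 else 0) g = g j"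
proof -
  assume "finite I" "j \<in> I"
  then have "linear_form I (\<lambda>k. if k = j then 1 else 0) g = (\<Sum>k\<in>I. if k = j then g k else 0)"
    unfolding linear_form_def by (intro sum.cong) auto
  then show ?thesis using \<open>finite I\<close> \<open>j \<in> I\<close> by simp
qed

text \<open>With lists in place of index ranges, intersection becomes concatenation.\<close>

definition cell :: "nat set \<Rightarrow> ((nat \<Rightarrow> int) \<times> 'g) list \<Rightarrow> ((nat \<Rightarrow> int) \<times> 'g) list \<Rightarrow>
    (nat \<Rightarrow> 'g::linordered_ab_group_add) set" where
  "cell I ps es = {g \<in> I \<rightarrow>\<^sub>E UNIV. (\<forall>(f, h)\<in>set ps. linear_form I f g > h) \<and>
    (\<forall>(f, h)\<in>set es. linear_form I f g = h)}"

lemma basic_semilinear_cell: "basic_semilinear I (cell I ps es)"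
proof -
  define L where "L = ps @ es"
  define p q where "p = length ps" and "q = length L"
  define f h where "f i = fst (L ! (i - 1))" and "h i = snd (L ! (i - 1))" for i
  have ps: "(\<forall>i\<in>{1..p}. P (f i) (h i)) \<longleftrightarrow> (\<forall>(f, h)\<in>set ps. P f h)" for P
  proof -
    have "(\<forall>i\<in>{1..p}. P (f i) (h i)) \<longleftrightarrow> (\<forall>i<p. P (fst (ps ! i)) (snd (ps ! i)))"
      unfolding f_def h_def L_def p_def
      by (auto simp: nth_append Ball_def)
    then show ?thesis unfolding p_def by (auto simp: all_set_conv_all_nth split_beta)
  qed
  have es: "(\<forall>i\<in>{p + 1..q}. P (f i) (h i)) \<longleftrightarrow> (\<forall>(f, h)\<in>set es. P f h)" for P
  proof -
    have "(\<forall>i\<in>{p + 1..q}. P (f i) (h i)) \<longleftrightarrow> (\<forall>i<length es. P (f (p + 1 + i)) (h (p + 1 + i)))"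
    proof (intro iffI ballI allI impI)
      fix i assume *: "\<forall>i<length es. P (f (p + 1 + i)) (h (p + 1 + i))" "i \<in> {p + 1..q}"
      then have "i - (p + 1) < length es" "p + 1 + (i - (p + 1)) = i" by (auto simp: q_def p_def L_def)
      then show "P (f i) (h i)" using *(1) by metis
    qed (auto simp: q_def p_def L_def)
    then show ?thesis unfolding f_def h_def p_def L_def by (auto simp: nth_append all_set_conv_all_nth split_beta)
  qed
  have "cell I ps es = {g \<in> I \<rightarrow>\<^sub>E UNIV. (\<forall>i\<in>{1..p}. linear_form I (f i) g > h i) \<and>
      (\<forall>i\<in>{p + 1..q}. linear_form I (f i) g = h i)}"
    unfolding cell_def ps[of "\<lambda>f h. linear_form I f _ > h"] es[of "\<lambda>f h. linear_form I f _ = h"] ..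
  moreover have "p \<le> q" by (simp add: p_def q_def L_def)
  ultimately show ?thesis unfolding basic_semilinear_def by blast
qed

lemma basic_semilinear_eq_cell:
  fixes A :: "(nat \<Rightarrow> 'g::linordered_ab_group_add) set"
  assumes "basic_semilinear I A"
  obtains ps es where "A = cell I ps es"
proof -
  obtain p q and f :: "nat \<Rightarrow> nat \<Rightarrow> int" and h :: "nat \<Rightarrow> 'g" where A: "A = {g \<in> I \<rightarrow>\<^sub>E UNIV. (\<forall>i\<in>{1..p}. linear_form I (f i) g > h i) \<and>
      (\<forall>i\<in>{p+1..q}. linear_form I (f i) g = h i)}"
    using assms unfolding basic_semilinear_def by blast
  have "A = cell I (map (\<lambda>i. (f i, h i)) [1..<p + 1]) (map (\<lambda>i. (f i, h i)) [p + 1..<q + 1])"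
    unfolding A cell_def by (auto simp: less_Suc_eq_le)
  then show ?thesis by (rule that)
qed

lemma semilinear_basic: "basic_semilinear I A \<Longrightarrow> semilinear I A"
  unfolding semilinear_def by (intro exI[of _ "{A}"]) simp

lemma semilinear_empty: "semilinear I {}"
  unfolding semilinear_def by (intro exI[of _ "{}"]) simp

lemma semilinear_Un: "semilinear I A \<Longrightarrow> semilinear I B \<Longrightarrow> semilinear I (A \<union> B)"
  unfolding semilinear_def
proof (elim exE conjE)
  fix F G assume "finite F" "\<forall>B\<in>F. basic_semilinear I B" "A = \<Union>F"
    "finite G" "\<forall>B\<in>G. basic_semilinear I B" "B = \<Union>G"
  then show "\<exists>F. finite F \<and> (\<forall>B\<in>F. basic_semilinear I B) \<and> A \<union> B = \<Union>F"
    by (intro exI[of _ "F \<union> G"]) auto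
qed

lemma basic_semilinear_Int:
  assumes "basic_semilinear I A" "basic_semilinear I B"
  shows "basic_semilinear I (A \<inter> B)"
proof -
  obtain ps es where A: "A = cell I ps es" using basic_semilinear_eq_cell[OF assms(1)] .
  obtain ps' es' where B: "B = cell I ps' es'" using basic_semilinear_eq_cell[OF assms(2)] .
  have "A \<inter> B = cell I (ps @ ps') (es @ es')" unfolding A B cell_def set_append ball_Un
    by (rule Set.set_eqI, simp only: Int_iff mem_Collect_eq, intro iffI conjI; elim conjE; assumption)
  then show ?thesis by (simp add: basic_semilinear_cell)
qed

lemma semilinear_Int: "semilinear I A \<Longrightarrow> semilinear I B \<Longrightarrow> semilinear I (A \<inter> B)"
  unfolding semilinear_def
proof (elim exE conjE)
  fix F G assume FG: "finite F" "\<forall>B\<in>F. basic_semilinear I B" "A = \<Union>F"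
    "finite G" "\<forall>B\<in>G. basic_semilinear I B" "B = \<Union>G"
  show "\<exists>F. finite F \<and> (\<forall>B\<in>F. basic_semilinear I B) \<and> A \<inter> B = \<Union>F"
  proof (intro exI[of _ "(\<lambda>(C, D). C \<inter> D) ` (F \<times> G)"] conjI)
    show "\<forall>B\<in>(\<lambda>(C, D). C \<inter> D) ` (F \<times> G). basic_semilinear I B"
      using FG(2,5) by (auto intro: basic_semilinear_Int)
    show "A \<inter> B = \<Union>((\<lambda>(C, D). C \<inter> D) ` (F \<times> G))" unfolding FG(3,6) by auto
  qed (use FG(1,4) in simp)
qed

lemma semilinear_UNIV: "semilinear I (I \<rightarrow>\<^sub>E UNIV)"
  using semilinear_basic[OF basic_semilinear_cell[of I "[]" "[]"]] by (simp add: cell_def)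

lemma semilinear_greater: "semilinear I {g \<in> I \<rightarrow>\<^sub>E UNIV. linear_form I a g > h}"
  using semilinear_basic[OF basic_semilinear_cell[of I "[(a, h)]" "[]"]] by (simp add: cell_def)

text \<open>The complement of a strict inequality splits into the reversed strict one, written with
  the negated form, and an equation.\<close>

lemma semilinear_not_greater: "semilinear I {g \<in> I \<rightarrow>\<^sub>E UNIV. \<not> linear_form I a g > h}"
proof -
  have "semilinear I (cell I [(\<lambda>k. - a k, - h)] [] \<union> cell I [] [(a, h)])"
    by (intro semilinear_Un semilinear_basic basic_semilinear_cell)
  moreover have "cell I [(\<lambda>k. - a k, - h)] [] \<union> cell I [] [(a, h)] = {g \<in> I \<rightarrow>\<^sub>E UNIV. \<not> linear_form I a g > h}"
    unfolding cell_def by (auto simp: linear_form_uminus not_less le_less)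
  ultimately show ?thesis by simp
qed

context rcvf begin

section \<open>From definable sets to strata\<close>

lemma lin_eq_linear_form:
  assumes "l \<in> lin \<Phi> I" "finite I"
  shows "\<exists>c a. \<forall>g. l (x, g) = c + linear_form I a g"
  using assms(1)
proof (induction rule: lin.induct)
  case (lin_const c)
  show ?case by (intro exI[of _ c] exI[of _ "\<lambda>_. 0"]) (simp add: linear_form_0)
next
  case (lin_var j)
  show ?case
    by (intro exI[of _ 0] exI[of _ "\<lambda>k. if k = j then 1 else 0"]) (simp add: linear_form_unit[OF assms(2) lin_var])
next
  case (lin_w f)
  show ?case by (intro exI[of _ "w (f x)"] exI[of _ "\<lambda>_. 0"]) (simp add: linear_form_0)
next
  case (lin_add l l')
  then obtain c a c' a' where "\<forall>g. l (x, g) = c + linear_form I a g" "\<forall>g. l' (x, g) = c' + linear_form I a' g"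
    by blast
  then show ?case
    by (intro exI[of _ "c + c'"] exI[of _ "\<lambda>k. a k + a' k"]) (simp add: linear_form_add algebra_simps)
next
  case (lin_uminus l)
  then obtain c a where "\<forall>g. l (x, g) = c + linear_form I a g" by blast
  then show ?case
    by (intro exI[of _ "- c"] exI[of _ "\<lambda>k. - a k"]) (simp add: linear_form_uminus)
qed

text \<open>Carrying set and complement together through the induction makes negation a mere
  exchange of the two.\<close>

lemma dfn_fiber_semilinear:
  assumes "A \<in> dfn \<Phi> I" "finite I"
  shows "semilinear I {g \<in> I \<rightarrow>\<^sub>E UNIV. (x, g) \<in> A} \<and> semilinear I {g \<in> I \<rightarrow>\<^sub>E UNIV. (x, g) \<notin> A}"
  using assms(1)
proof (induction rule: dfn.induct)
  case (dfn_pos f)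
  show ?case by (cases "0 < f x") (simp_all add: semilinear_empty semilinear_UNIV)
next
  case (dfn_lin l)
  obtain c a where l: "\<And>g. l (x, g) = c + linear_form I a g"
    using lin_eq_linear_form[OF dfn_lin assms(2)] by blast
  have "0 < l (x, g) \<longleftrightarrow> linear_form I a g > - c" for g
    unfolding l using add_less_cancel_left[of c "- c" "linear_form I a g"] by simp
  then show ?case using semilinear_greater[of I "- c" a] semilinear_not_greater[of I "- c" a] by simp
next
  case (dfn_compl A)
  then show ?case by simp
next
  case (dfn_Int A B)
  have "{g \<in> I \<rightarrow>\<^sub>E UNIV. (x, g) \<in> A \<inter> B} = {g \<in> I \<rightarrow>\<^sub>E UNIV. (x, g) \<in> A} \<inter> {g \<in> I \<rightarrow>\<^sub>E UNIV. (x, g) \<in> B}"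
    "{g \<in> I \<rightarrow>\<^sub>E UNIV. (x, g) \<notin> A \<inter> B} = {g \<in> I \<rightarrow>\<^sub>E UNIV. (x, g) \<notin> A} \<union> {g \<in> I \<rightarrow>\<^sub>E UNIV. (x, g) \<notin> B}"
    by blast+
  then show ?case using dfn_Int.IH by (simp add: semilinear_Int semilinear_Un)
qed

text \<open>Variables are numbered from 1 to \<open>n\<close>, while \<open>polyfun m\<close> uses
  the coordinates below \<open>m\<close>; hence \<open>Suc n\<close>, with coordinate 0
  idle.\<close>

lemma mpoly_eval_polyfun:
  assumes "P \<in> mpolynomials n"
  shows "mpoly_eval P \<in> polyfun (Suc n)"
proof -
  have "(\<lambda>x. \<Sum>m\<in>Poly_Mapping.keys P. Poly_Mapping.lookup P m *
      (\<Prod>k\<in>Poly_Mapping.keys m. x k ^ Poly_Mapping.lookup m k)) \<in> polyfun (Suc n)"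
    using assms unfolding mpolynomials_def
    by (intro polyfun_sum polyfun_mult polyfun_const polyfun_prod polyfun_power polyfun_var) fastforce
  then show ?thesis by (simp add: mpoly_eval_def[abs_def])
qed

lemma mpoly_eval_restrict:
  assumes "P \<in> mpolynomials n"
  shows "mpoly_eval P (restrict x {1..n}) = mpoly_eval P x"
  unfolding mpoly_eval_def
proof (intro sum.cong refl arg_cong2[of _ _ _ _ "(*)"] prod.cong)
  fix m k assume "m \<in> Poly_Mapping.keys P" "k \<in> Poly_Mapping.keys m"
  then have "k \<in> {1..n}" using assms unfolding mpolynomials_def by blast
  then show "restrict x {1..n} k ^ Poly_Mapping.lookup m k = x k ^ Poly_Mapping.lookup m k" by simp
qed

text \<open>Points of \<open>S\<close> are extensional whereas definable sets live on all sequences;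
  \<open>restrict\<close> mediates.\<close>

lemma dfn_semialgebraic:
  assumes "semialgebraic n S"
  shows "{\<omega>. restrict (fst \<omega>) {1..n} \<in> S} \<in> dfn (polyfun (Suc n)) J"
proof -
  obtain F where F: "finite F" "\<forall>A\<in>F. basic_semialgebraic n A" "S = \<Union>F"
    using assms unfolding semialgebraic_def by blast
  have "{\<omega>. restrict (fst \<omega>) {1..n} \<in> A} \<in> dfn (polyfun (Suc n)) J" if "A \<in> F" for A
  proof -
    have "basic_semialgebraic n A" using that F(2) by blast
    then obtain p q and P :: "nat \<Rightarrow> 'k mpolynomial" where P: "p \<le> q" "\<forall>i\<in>{1..q}. P i \<in> mpolynomials n"
      and A: "A = {x \<in> {1..n} \<rightarrow>\<^sub>E UNIV. (\<forall>i\<in>{1..p}. mpoly_eval (P i) x > 0) \<and> (\<forall>i\<in>{p+1..q}. mpoly_eval (P i) x = 0)}"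
      unfolding basic_semialgebraic_def by blast
    have Pm: "P i \<in> mpolynomials n" if "i \<in> {1..p} \<or> i \<in> {p+1..q}" for i using that P by auto
    have "{\<omega>. (\<forall>i\<in>{1..p}. 0 < mpoly_eval (P i) (fst \<omega>)) \<and> (\<forall>i\<in>{p+1..q}. mpoly_eval (P i) (fst \<omega>) = 0)}
        \<in> dfn (polyfun (Suc n)) J"
      by (intro dfn_conj dfn_ball dfn_pos dfn_pf_eq[OF _ polyfun_const] mpoly_eval_polyfun Pm finite_atLeastAtMost) blast+
    moreover have "restrict x {1..n} \<in> A \<longleftrightarrow>
        (\<forall>i\<in>{1..p}. 0 < mpoly_eval (P i) x) \<and> (\<forall>i\<in>{p+1..q}. mpoly_eval (P i) x = 0)" for x
      unfolding A using mpoly_eval_restrict[OF Pm, of _ x] by auto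
    ultimately show ?thesis by simp
  qed
  then have "{\<omega>. \<exists>A\<in>F. restrict (fst \<omega>) {1..n} \<in> A} \<in> dfn (polyfun (Suc n)) J" by (rule dfn_bex[OF F(1)])
  then show ?thesis unfolding F(3) by (simp only: Union_iff)
qed

lemma semialgebraic_extensional: "semialgebraic n S \<Longrightarrow> S \<subseteq> {1..n} \<rightarrow>\<^sub>E (UNIV :: 'k set)"
proof
  fix x assume "semialgebraic n S" "x \<in> S"
  then obtain A where "basic_semialgebraic n A" "x \<in> A" unfolding semialgebraic_def by blast
  then show "x \<in> {1..n} \<rightarrow>\<^sub>E (UNIV :: 'k set)" unfolding basic_semialgebraic_def by auto
qed

text \<open>Presents the stratum as a projection from the two-sorted language. The conditions that
  coordinates in \<open>K\<close> be nonzero are what allows \<open>w\<close> to stand for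
  \<open>val\<close>.\<close>

lemma stratum_val_image:
  assumes S: "S \<subseteq> {1..n} \<rightarrow>\<^sub>E UNIV" and K: "K \<subseteq> {1..n}"
  shows "stratum n K (val_image n val S) = {g \<in> K \<rightarrow>\<^sub>E UNIV. \<exists>x. restrict x {1..n} \<in> S \<and>
    (\<forall>k\<in>K. x k \<noteq> 0 \<and> w (x k) = g k) \<and> (\<forall>k\<in>{1..n} - K. x k = 0)}" (is "?L = ?R")
proof (intro equalityI subsetI)
  fix g assume "g \<in> ?L"
  then obtain x where x: "x \<in> S" "support n (\<lambda>k\<in>{1..n}. val (x k)) = K"
    and g: "g = (\<lambda>k\<in>K. the ((\<lambda>k\<in>{1..n}. val (x k)) k))"
    unfolding stratum_def val_image_def by auto
  have K0: "k \<in> K \<longleftrightarrow> x k \<noteq> 0" if "k \<in> {1..n}" for k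
  proof -
    have "k \<in> K \<longleftrightarrow> val (x k) \<noteq> None"
      unfolding x(2)[symmetric] support_def using that by (simp del: not_None_eq)
    then show ?thesis unfolding val_eq_None_iff .
  qed
  have "restrict x {1..n} = x" using x(1) S by (metis PiE_restrict subsetD)
  then show "g \<in> ?R" using x(1) K K0 by (auto simp: g w_def intro!: exI[of _ x])
next
  fix g assume "g \<in> ?R"
  then obtain x where x: "restrict x {1..n} \<in> S" "\<forall>k\<in>K. x k \<noteq> 0 \<and> w (x k) = g k" "\<forall>k\<in>{1..n} - K. x k = 0"
    and g: "g \<in> K \<rightarrow>\<^sub>E UNIV" by blast
  let ?v = "\<lambda>k\<in>{1..n}. val (restrict x {1..n} k)"
  have "?v \<in> val_image n val S" unfolding val_image_def using x(1) by (rule imageI)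
  moreover have "support n ?v = K"
  proof -
    have "support n ?v = {k \<in> {1..n}. val (x k) \<noteq> None}"
      unfolding support_def by (rule Collect_cong) (simp del: not_None_eq cong: conj_cong)
    then show ?thesis unfolding val_eq_None_iff using x(2,3) K by auto
  qed
  moreover have "g = (\<lambda>k\<in>K. the (?v k))"
  proof
    fix k
    show "g k = (\<lambda>k\<in>K. the (?v k)) k"
    proof (cases "k \<in> K")
      case True
      then show ?thesis using x(2) K val_eq_Some[of "x k"] by auto
    next
      case False
      then show ?thesis using PiE_arb[OF g False] by simp
    qed
  qed
  ultimately show "g \<in> ?L" unfolding stratum_def by blast
qed

lemma semilinear_stratum:
  assumes S: "semialgebraic n S" and K: "K \<subseteq> {1..n}"
  shows "semilinear K (stratum n K (val_image n val S))"
proof -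
  have fin: "finite K" using K finite_subset by blast
  have v: "(\<lambda>x. x k) \<in> polyfun (Suc n)" if "k \<in> {1..n}" for k using that by (intro polyfun_var) simp
  define A where "A = {\<omega> :: (nat \<Rightarrow> 'k) \<times> (nat \<Rightarrow> 'g). restrict (fst \<omega>) {1..n} \<in> S \<and>
    (\<forall>k\<in>K. fst \<omega> k \<noteq> 0 \<and> w (fst \<omega> k) = snd \<omega> k) \<and> (\<forall>k\<in>{1..n} - K. fst \<omega> k = 0)}"
  have "A \<in> dfn (polyfun (Suc n)) K"
    unfolding A_def using K
    by (intro dfn_conj dfn_semialgebraic[OF S] dfn_ball dfn_pf_neq[OF v polyfun_const] dfn_pf_eq[OF v polyfun_const]
        dfn_lin_eq lin_w v lin_var fin) auto
  from dfn_elim_all[OF this fin] obtain B where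
    B: "B \<in> dfn (polyfun 0) K" "\<forall>x g. (x, g) \<in> B \<longleftrightarrow> (\<exists>x. (x, g) \<in> A)" by blast
  \<comment> \<open>The zero sequence is an arbitrary choice: membership in \<open>B\<close> does
    not depend on the field argument.\<close>
  have "stratum n K (val_image n val S) = {g \<in> K \<rightarrow>\<^sub>E UNIV. (\<lambda>_. 0, g) \<in> B}"
    unfolding stratum_val_image[OF semialgebraic_extensional[OF S] K] B(2)[rule_format] A_def by simp
  then show ?thesis using dfn_fiber_semilinear[OF B(1) fin] by simp
qed

end

theorem theorem3p1:
  fixes val :: "'k::real_closed_field \<Rightarrow> 'g::linordered_ab_group_add option"
    and n :: nat
    and S :: "(nat \<Rightarrow> 'k) set"
  assumes "valuation val"
    and "nontrivial_valuation val"
    and "convex_valuation val"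
    and "semialgebraic n S"
  shows "\<forall>K. K \<noteq> {} \<and> K \<subseteq> {1..n} \<longrightarrow> semilinear K (stratum n K (val_image n val S))"
proof -
  interpret rcvf val
    by (rule rcvf.intro[OF assms(1) rcvf_axioms.intro[OF assms(2,3)]])
  show ?thesis using semilinear_stratum[OF assms(4)] by blast
qed

end
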